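(* Let $l>0$, $\Omega=(0,\pi)\times(-l,l)$, $\sigma\in(0,1)$, $\Omega_O\subset\overline\Omega$ nonempty closed, $\gamma_-,\gamma_+>0$, $\psi_-\in O_-(\gamma_-)$, $\psi_+\in O_+(\gamma_+)$. Then the problem $$\mathcal{G}^\infty_{\psi_-,\psi_+}:=\max_{f\in\mathcal{F}}\mathcal{G}^\infty_{f,\psi_-,\psi_+},\qquad \mathcal{F}:=\{f\in(C^0(\overline\Omega))':\|f\|_{(C^0(\overline\Omega))'}\le1\},$$ admits a solution (the supremum is attained). Furthermore, if $-\psi_-\equiv\psi_+$ and $f$ is a maximizer, then $-f$ is a maximizer as well.
   Context: $H^2_*(\Omega):=\{v\in H^2(\Omega): v=0\text{ on }\{0,\pi\}\times(-l,l)\}$ with scalar product $(u,v)_{H^2_*(\Omega)}:=\int_\Omega\big(\Delta u\Delta v+(1-\sigma)(2u_{xy}v_{xy}-u_{xx}v_{yy}-u_{yy}v_{xx})\big)$; its elements are identified with continuous functions on $\overline\Omega$. $(C^0(\overline\Omega))'$ is the dual of $C^0(\overline\Omega)$ with the dual norm and pairing $\langle f,u\rangle$. $O_+(\gamma):=\{\psi\in C^0(\Omega_O):\psi\ge\gamma\text{ on }\Omega_O\}$, $O_-(\gamma):=\{\psi\in C^0(\Omega_O):\psi\le-\gamma\text{ on }\Omega_O\}$. $H^2_{*,\psi_-,\psi_+}(\Omega):=\{v\in H^2_*(\Omega):\psi_-\le v\le\psi_+\text{ on }\Omega_O\}$. For $f\in(C^0(\overline\Omega))'$, $u_{f,\psi_-,\psi_+}$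 is the unique $u\in H^2_{*,\psi_-,\psi_+}(\Omega)$ with $(u,\varphi-u)_{H^2_*(\Omega)}\ge\langle f,\varphi-u\rangle$ for all $\varphi\in H^2_{*,\psi_-,\psi_+}(\Omega)$ (the minimizer of $\int_\Omega\frac12(\Delta u)^2+(1-\sigma)(u_{xy}^2-u_{xx}u_{yy})-\langle f,u\rangle$). The gap function is $\mathcal{G}_{f,\psi_-,\psi_+}(x):=u_{f,\psi_-,\psi_+}(x,l)-u_{f,\psi_-,\psi_+}(x,-l)$, $x\in[0,\pi]$, and $\mathcal{G}^\infty_{f,\psi_-,\psi_+}:=\max_{x\in[0,\pi]}|\mathcal{G}_{f,\psi_-,\psi_+}(x)|$. *)

theory Defs
  imports "HOL-Analysis.Analysis"
begin

definition Omega :: "real \<Rightarrow> (real \<times> real) set" where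
  "Omega l = {0<..<pi} \<times> {-l<..<l}"

definition pd :: "real \<times> real \<Rightarrow> (real \<times> real \<Rightarrow> real) \<Rightarrow> real \<times> real \<Rightarrow> real" where
  "pd d f p = deriv (\<lambda>t. f (p + t *\<^sub>R d)) 0"

fun pds :: "(real \<times> real) list \<Rightarrow> (real \<times> real \<Rightarrow> real) \<Rightarrow> real \<times> real \<Rightarrow> real" where
  "pds [] f = f"
| "pds (d # ds) f = pd d (pds ds f)"

definition e1 :: "real \<times> real" where "e1 = (1, 0)"
definition e2 :: "real \<times> real" where "e2 = (0, 1)"

definition smooth :: "(real \<times> real \<Rightarrow> real) \<Rightarrow> bool" where
  "smooth f \<longleftrightarrow> (\<forall>ds. set ds \<subseteq> {e1, e2} \<longrightarrow> (\<forall>p. pds ds f differentiable (at p)))"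

definition test_fun :: "(real \<times> real) set \<Rightarrow> (real \<times> real \<Rightarrow> real) \<Rightarrow> bool" where
  "test_fun U \<phi> \<longleftrightarrow> smooth \<phi> \<and> compact (closure {p. \<phi> p \<noteq> 0})
      \<and> closure {p. \<phi> p \<noteq> 0} \<subseteq> U"

definition Dmulti :: "nat \<Rightarrow> nat \<Rightarrow> (real \<times> real \<Rightarrow> real) \<Rightarrow> real \<times> real \<Rightarrow> real" where
  "Dmulti i j f = pds (replicate i e1 @ replicate j e2) f"

definition L2 :: "(real \<times> real) set \<Rightarrow> (real \<times> real \<Rightarrow> real) \<Rightarrow> bool" where
  "L2 U g \<longleftrightarrow> set_borel_measurable lborel U g \<and> set_integrable lborel U (\<lambda>p. (g p)^2)"

definition weak_deriv ::
  "(real \<times> real) set \<Rightarrow> (real \<times> real \<Rightarrow> real) \<Rightarrow> nat \<Rightarrow> nat \<Rightarrow> (real \<times> real \<Rightarrow> real) \<Rightarrow> bool" where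
  "weak_deriv U v i j g \<longleftrightarrow>
     (\<forall>\<phi>. test_fun U \<phi> \<longrightarrow>
        set_integrable lborel U (\<lambda>p. v p * Dmulti i j \<phi> p) \<and>
        set_integrable lborel U (\<lambda>p. g p * \<phi> p) \<and>
        (LINT p:U|lborel. v p * Dmulti i j \<phi> p) = (-1) ^ (i + j) * (LINT p:U|lborel. g p * \<phi> p))"

text \<open>Sobolev space \<open>H^2(U)\<close> (functions, not a.e.-classes).\<close>
definition H2 :: "(real \<times> real) set \<Rightarrow> (real \<times> real \<Rightarrow> real) \<Rightarrow> bool" where
  "H2 U v \<longleftrightarrow> L2 U v \<and> (\<forall>i j. i + j \<le> 2 \<longrightarrow> (\<exists>g. weak_deriv U v i j g \<and> L2 U g))"

text \<open>The (a.e.-unique) weak derivative.\<close>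
definition wd :: "(real \<times> real) set \<Rightarrow> nat \<Rightarrow> nat \<Rightarrow> (real \<times> real \<Rightarrow> real) \<Rightarrow> real \<times> real \<Rightarrow> real" where
  "wd U i j v = (SOME g. weak_deriv U v i j g \<and> L2 U g)"

text \<open>Elements are identified with their continuous representatives on the closure;
  to make them unique as HOL functions we set them to 0 outside the closure.\<close>
definition H2star :: "real \<Rightarrow> (real \<times> real \<Rightarrow> real) set" where
  "H2star l = {v. H2 (Omega l) v \<and> continuous_on (closure (Omega l)) v
      \<and> (\<forall>p. p \<notin> closure (Omega l) \<longrightarrow> v p = 0)
      \<and> (\<forall>y\<in>{-l<..<l}. v (0, y) = 0 \<and> v (pi, y) = 0)}"

definition ip :: "real \<Rightarrow> real \<Rightarrow> (real \<times> real \<Rightarrow> real) \<Rightarrow> (real \<times> real \<Rightarrow> real) \<Rightarrow> real" where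
  "ip l \<sigma> u v = (LINT p:Omega l|lborel.
      (wd (Omega l) 2 0 u p + wd (Omega l) 0 2 u p) * (wd (Omega l) 2 0 v p + wd (Omega l) 0 2 v p)
      + (1 - \<sigma>) * (2 * wd (Omega l) 1 1 u p * wd (Omega l) 1 1 v p
                  - wd (Omega l) 2 0 u p * wd (Omega l) 0 2 v p
                  - wd (Omega l) 0 2 u p * wd (Omega l) 2 0 v p))"

text \<open>Bounded linear functionals on \<open>C^0(K)\<close>, represented as maps on real functions that only
  depend on the restriction to K.\<close>
definition dual_C0 :: "(real \<times> real) set \<Rightarrow> ((real \<times> real \<Rightarrow> real) \<Rightarrow> real) \<Rightarrow> bool" where
  "dual_C0 K f \<longleftrightarrow>
     (\<forall>u v. (\<forall>p\<in>K. u p = v p) \<longrightarrow> f u = f v) \<and>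
     (\<forall>u v. continuous_on K u \<and> continuous_on K v \<longrightarrow> f (\<lambda>p. u p + v p) = f u + f v) \<and>
     (\<forall>c u. continuous_on K u \<longrightarrow> f (\<lambda>p. c * u p) = c * f u) \<and>
     (\<exists>C. \<forall>u. continuous_on K u \<longrightarrow> \<bar>f u\<bar> \<le> C * (SUP p\<in>K. \<bar>u p\<bar>))"

definition dual_norm :: "(real \<times> real) set \<Rightarrow> ((real \<times> real \<Rightarrow> real) \<Rightarrow> real) \<Rightarrow> real" where
  "dual_norm K f = Sup {\<bar>f u\<bar> | u. continuous_on K u \<and> (\<forall>p\<in>K. \<bar>u p\<bar> \<le> 1)}"

definition Fset :: "real \<Rightarrow> ((real \<times> real \<Rightarrow> real) \<Rightarrow> real) set" where
  "Fset l = {f. dual_C0 (closure (Omega l)) f \<and> dual_norm (closure (Omega l)) f \<le> 1}"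

definition O_plus :: "(real \<times> real) set \<Rightarrow> real \<Rightarrow> (real \<times> real \<Rightarrow> real) set" where
  "O_plus Ob \<gamma> = {\<psi>. continuous_on Ob \<psi> \<and> (\<forall>p\<in>Ob. \<psi> p \<ge> \<gamma>)}"

definition O_minus :: "(real \<times> real) set \<Rightarrow> real \<Rightarrow> (real \<times> real \<Rightarrow> real) set" where
  "O_minus Ob \<gamma> = {\<psi>. continuous_on Ob \<psi> \<and> (\<forall>p\<in>Ob. \<psi> p \<le> -\<gamma>)}"

definition H2star_obst ::
  "real \<Rightarrow> (real \<times> real) set \<Rightarrow> (real \<times> real \<Rightarrow> real) \<Rightarrow> (real \<times> real \<Rightarrow> real) \<Rightarrow> (real \<times> real \<Rightarrow> real) set" where
  "H2star_obst l Ob \<psi>m \<psi>p = {v \<in> H2star l. \<forall>p\<in>Ob. \<psi>m p \<le> v p \<and> v p \<le> \<psi>p p}"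

definition u_sol ::
  "real \<Rightarrow> real \<Rightarrow> (real \<times> real) set \<Rightarrow> ((real \<times> real \<Rightarrow> real) \<Rightarrow> real)
     \<Rightarrow> (real \<times> real \<Rightarrow> real) \<Rightarrow> (real \<times> real \<Rightarrow> real) \<Rightarrow> real \<times> real \<Rightarrow> real" where
  "u_sol l \<sigma> Ob f \<psi>m \<psi>p = (THE u. u \<in> H2star_obst l Ob \<psi>m \<psi>p \<and>
      (\<forall>\<phi>\<in>H2star_obst l Ob \<psi>m \<psi>p. ip l \<sigma> u (\<lambda>p. \<phi> p - u p) \<ge> f (\<lambda>p. \<phi> p - u p)))"

definition gap ::
  "real \<Rightarrow> real \<Rightarrow> (real \<times> real) set \<Rightarrow> ((real \<times> real \<Rightarrow> real) \<Rightarrow> real)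
     \<Rightarrow> (real \<times> real \<Rightarrow> real) \<Rightarrow> (real \<times> real \<Rightarrow> real) \<Rightarrow> real \<Rightarrow> real" where
  "gap l \<sigma> Ob f \<psi>m \<psi>p x = u_sol l \<sigma> Ob f \<psi>m \<psi>p (x, l) - u_sol l \<sigma> Ob f \<psi>m \<psi>p (x, -l)"

definition gap_inf ::
  "real \<Rightarrow> real \<Rightarrow> (real \<times> real) set \<Rightarrow> ((real \<times> real \<Rightarrow> real) \<Rightarrow> real)
     \<Rightarrow> (real \<times> real \<Rightarrow> real) \<Rightarrow> (real \<times> real \<Rightarrow> real) \<Rightarrow> real" where
  "gap_inf l \<sigma> Ob f \<psi>m \<psi>p = (SUP x\<in>{0..pi}. \<bar>gap l \<sigma> Ob f \<psi>m \<psi>p x\<bar>)"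

end

theory Submission
  imports Defs "HOL-Computational_Algebra.Polynomial" "HOL-Complex_Analysis.Great_Picard"
begin

text \<open>
  On functions \<open>v\<close> vanishing at \<open>x = 0\<close> and \<open>x = \<pi>\<close> the energy \<open>ip v v\<close> dominates the
  \<open>L\<^sup>2\<close> norms of the second derivatives (pointwise, because \<open>0 < \<sigma> < 1\<close>), and these control the
  modulus of continuity: the difference of \<open>v\<close> over a rectangle is the integral of
  \<open>v\<^sub>x\<^sub>y\<close>, and a weighted mean of \<open>v\<close> over \<open>y\<close> is a function of \<open>x\<close> alone, determined by its second
  derivative and its zero boundary values. Both identities come from testing the weak derivatives
  with products \<open>a(x) b(y)\<close>. They give
  \<open>\<bar>v p - v q\<bar> \<le> C (ip v v)\<^bsup>1/2\<^esup> \<bar>p - q\<bar>\<^bsup>1/2\<^esup>\<close>, hence completeness of the energy space and, by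
  minimisation, unique solvability of the variational inequality.

  For a maximising sequence of loads \<open>f\<^sub>n\<close> the solutions \<open>u\<^sub>n\<close> have bounded energy, so a
  subsequence converges uniformly to some \<open>u\<close> (Arzela--Ascoli), while the \<open>f\<^sub>n\<close> have a pointwise
  cluster point \<open>f\<close> in the dual unit ball (Tychonoff). Comparing the two variational inequalities,
  the energy of \<open>u\<^sub>n - u\<^sub>f\<close> is at most \<open>(f\<^sub>n - f)(u\<^sub>n - u\<^sub>f)\<close>, which is small for infinitely many
  \<open>n\<close>, since only the fixed function \<open>u - u\<^sub>f\<close> has to be tested. So \<open>f\<close> is a maximiser.
  The symmetry holds because \<open>-u\<^sub>f\<close> solves the problem with load \<open>-f\<close>.
\<close>

text \<open>The energy controls second derivatives only. Its kernel consists of affine functions,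
  and among these only zero vanishes on both sides \<open>x = 0\<close> and
  \<open>x = \<pi>\<close>. Both halves of the modulus rest on that: the rectangle formula starts
  from \<open>x = 0\<close>, the mean over \<open>y\<close> uses both ends. \<open>H2\<close> also
  demands weak first derivatives, whose existence for a limit in energy is not part of the
  convergence. They are constructed for the limit: \<open>v\<^sub>y\<close> as an integral of
  \<open>v\<^sub>x\<^sub>y\<close>, and \<open>v\<^sub>x\<close> as another one corrected by a
  function of \<open>x\<close>. Product tests reduce identities in the plane to two facts on an
  interval: a continuous function is the primitive of its integrable weak derivative, and one with
  integrable weak second derivative and zero end values is the primitive of a bounded function. The
  same tests show that weak derivatives are unique up to null sets; since \<open>wd\<close> is a
  choice, the energy form is bilinear only because of this.\<close>

abbreviation ind :: "'a set \<Rightarrow> 'a \<Rightarrow> real" where "ind \<equiv> indicator"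

section \<open>Smooth functions of one variable\<close>

text \<open>Iterated \<open>deriv\<close> mirrors the recursion of \<open>pds\<close>, so that
  \<open>smooth\<close> for a product a(x) b(y) reduces to this notion for each factor.\<close>

definition smooth1 :: "(real \<Rightarrow> real) \<Rightarrow> bool" where
  "smooth1 f \<longleftrightarrow> (\<forall>k x. (deriv ^^ k) f field_differentiable (at x))"

text \<open>A family closed under \<open>deriv\<close> contains all iterated derivatives of its
  members, so no higher derivative ever has to be computed.\<close>

lemma smooth1_coinduct:
  assumes "f \<in> S" "\<And>g x. g \<in> S \<Longrightarrow> g field_differentiable (at x)" "\<And>g. g \<in> S \<Longrightarrow> deriv g \<in> S"
  shows "smooth1 f"
proof -
  have "(deriv ^^ k) f \<in> S" for k
    by (induction k) (use assms in auto)
  then show ?thesis using assms(2) unfolding smooth1_def by blast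
qed

lemma smooth1_deriv: "smooth1 f \<Longrightarrow> smooth1 (deriv f)"
  unfolding smooth1_def by (metis funpow_Suc_right comp_apply)

lemma smooth1_DERIV: "smooth1 f \<Longrightarrow> (f has_real_derivative deriv f x) (at x)"
  unfolding smooth1_def by (metis DERIV_deriv_iff_field_differentiable funpow_0)

lemma smooth1I_deriv:
  assumes "\<And>x. (f has_real_derivative g x) (at x)" "smooth1 g"
  shows "smooth1 f"
proof -
  have "deriv f = g" using assms(1) by (auto intro!: ext DERIV_imp_deriv)
  then have "(deriv ^^ k) f field_differentiable (at x)" for k x
  proof (cases k)
    case 0
    then show ?thesis using assms(1) by (auto simp: field_differentiable_def)
  next
    case (Suc j)
    then have "(deriv ^^ k) f = (deriv ^^ j) g" using \<open>deriv f = g\<close> by (simp add: funpow_Suc_right del: funpow.simps)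
    then show ?thesis using assms(2) by (simp add: smooth1_def)
  qed
  then show ?thesis by (simp add: smooth1_def)
qed

lemma smooth1_continuous: "smooth1 f \<Longrightarrow> continuous_on A f"
  by (meson DERIV_continuous_on smooth1_DERIV has_field_derivative_at_within)

lemma smooth1_affine:
  assumes "smooth1 f"
  shows "smooth1 (\<lambda>x. k * f (c * x + d))" and "deriv (\<lambda>x. k * f (c * x + d)) = (\<lambda>x. k * c * deriv f (c * x + d))"
proof -
  have D: "((\<lambda>x. k * f (c * x + d)) has_real_derivative k * c * deriv f (c * x + d)) (at x)"
    if "smooth1 f" for f k x
    using smooth1_DERIV[OF that, of "c * x + d"]
    by (auto intro!: derivative_eq_intros DERIV_chain2[of f])
  show "smooth1 (\<lambda>x. k * f (c * x + d))"
  \<comment> \<open>The factor \<open>k\<close> varies over the family because every derivative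
    multiplies it by \<open>c\<close>.\<close>
  proof (rule smooth1_coinduct[where S="{\<lambda>x. k * f (c * x + d) | k f. smooth1 f}"])
    show "deriv g \<in> {\<lambda>x. k * f (c * x + d) | k f. smooth1 f}"
      if asm: "g \<in> {\<lambda>x. k * f (c * x + d) | k f. smooth1 f}" for g
    proof -
      obtain k f where g: "g = (\<lambda>x. k * f (c * x + d))" "smooth1 f" using asm by blast
      have "deriv g = (\<lambda>x. (k * c) * deriv f (c * x + d))"
        using D[OF g(2), of k] g(1) by (auto intro!: ext DERIV_imp_deriv)
      then show ?thesis using smooth1_deriv[OF g(2)] by auto
    qed
  qed (use assms D in \<open>auto simp: field_differentiable_def\<close>)
  show "deriv (\<lambda>x. k * f (c * x + d)) = (\<lambda>x. k * c * deriv f (c * x + d))"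
    using D[OF assms, of k] by (auto intro!: ext DERIV_imp_deriv)
qed

lemma smooth1_add:
  assumes "smooth1 f" "smooth1 g"
  shows "smooth1 (\<lambda>x. f x + g x)" and "deriv (\<lambda>x. f x + g x) = (\<lambda>x. deriv f x + deriv g x)"
proof -
  have D: "((\<lambda>x. f x + g x) has_real_derivative deriv f x + deriv g x) (at x)"
    if "smooth1 f" "smooth1 g" for f g x
    using smooth1_DERIV[OF that(1), of x] smooth1_DERIV[OF that(2), of x]
    by (auto intro!: derivative_eq_intros)
  have E: "deriv (\<lambda>x. f x + g x) = (\<lambda>x. deriv f x + deriv g x)"  if "smooth1 f" "smooth1 g" for f g
    using D[OF that] by (auto intro!: ext DERIV_imp_deriv)
  show "smooth1 (\<lambda>x. f x + g x)"
  proof (rule smooth1_coinduct[where S="{\<lambda>x. f x + g x | f g. smooth1 f \<and> smooth1 g}"])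
    fix h assume "h \<in> {\<lambda>x. f x + g x | f g. smooth1 f \<and> smooth1 g}"
    then obtain f g where h: "h = (\<lambda>x. f x + g x)" "smooth1 f" "smooth1 g" by blast
    show "h field_differentiable (at x)" for x
      using D[OF h(2,3)] h(1) by (auto simp: field_differentiable_def)
    show "deriv h \<in> {\<lambda>x. f x + g x | f g. smooth1 f \<and> smooth1 g}"
      using E[OF h(2,3)] h smooth1_deriv by blast
  qed (use assms in blast)
  show "deriv (\<lambda>x. f x + g x) = (\<lambda>x. deriv f x + deriv g x)" by (rule E[OF assms])
qed

lemma smooth1_cmult:
  assumes "smooth1 f"
  shows "smooth1 (\<lambda>x. k * f x)" and "deriv (\<lambda>x. k * f x) = (\<lambda>x. k * deriv f x)"
  using smooth1_affine[OF assms, of k 1 0] by auto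

section \<open>A smooth step\<close>

text \<open>Meant for the edges of the bump, where two formulas meet: the difference quotient is at
  most \<open>C * \<bar>x - x0\<bar>\<close>.\<close>

lemma DERIV_zero_quadratic:
  fixes f :: "real \<Rightarrow> real"
  assumes "\<And>x. \<bar>f x\<bar> \<le> C * (x - x0)^2"
  shows "(f has_real_derivative 0) (at x0)"
proof -
  have 0: "f x0 = 0" using assms[of x0] by simp
  have "((\<lambda>x. (f x - f x0) / (x - x0)) \<longlongrightarrow> 0) (at x0)"
  proof (rule Lim_null_comparison)
    have "norm ((f x - f x0) / (x - x0)) \<le> C * \<bar>x - x0\<bar>" if "x \<noteq> x0" for x
    proof -
      have "\<bar>f x\<bar> \<le> C * \<bar>x - x0\<bar> * \<bar>x - x0\<bar>"
        using assms[of x] by (simp add: power2_eq_square mult.assoc)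
      then show ?thesis using that by (simp add: 0 pos_divide_le_eq)
    qed
    then show "\<forall>\<^sub>F x in at x0. norm ((f x - f x0) / (x - x0)) \<le> C * \<bar>x - x0\<bar>"
      by (simp add: eventually_at_filter)
    have "((\<lambda>x. C * \<bar>x - x0\<bar>) \<longlongrightarrow> C * \<bar>x0 - x0\<bar>) (at x0)"
      by (intro tendsto_intros)
    then show "((\<lambda>x. C * \<bar>x - x0\<bar>) \<longlongrightarrow> 0) (at x0)" by simp
  qed
  then show ?thesis by (simp add: has_field_derivative_iff)
qed

text \<open>Raise \<open>s / n \<le> exp (s / n)\<close> to the power \<open>n\<close>. With s = 1 /
  (1 - x^2), the factor exp(-s) of the bump thus beats every power of its pole.\<close>

lemma power_le_exp_mult:
  fixes s :: real
  assumes "s \<ge> 0" "n > 0"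
  shows "s ^ n \<le> real n ^ n * exp s"
proof -
  have "s / n \<le> exp (s / n)" using exp_ge_add_one_self[of "s / n"] by linarith
  then have "(s / n) ^ n \<le> exp (s / n) ^ n" using assms by (intro power_mono) auto
  also have "\<dots> = exp s" using assms by (simp flip: exp_of_nat_mult)
  finally show ?thesis using assms by (simp add: power_divide field_simps)
qed

text \<open>This family is closed under differentiation, which makes all its members smooth.\<close>

definition bump :: "real poly \<Rightarrow> nat \<Rightarrow> real \<Rightarrow> real" where
  "bump p m x = (if \<bar>x\<bar> < 1 then poly p x * (1 / (1 - x\<^sup>2)) ^ m * exp (- (1 / (1 - x\<^sup>2))) else 0)"

text \<open>Applying the exponential bound with exponent \<open>m + 2\<close> instead of
  \<open>m\<close> leaves two spare powers of 1 - x^2.\<close>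

lemma bump_quadratic:
  obtains C where "C \<ge> 0" "\<And>x. \<bar>bump p m x\<bar> \<le> C * (1 - x\<^sup>2)\<^sup>2"
proof -
  have "compact (poly p ` {-1..1})"
    by (intro compact_continuous_image continuous_intros) auto
  then obtain B where B: "B > 0" "\<And>x. x \<in> {-1..1} \<Longrightarrow> \<bar>poly p x\<bar> \<le> B"
    using compact_imp_bounded bounded_pos by (metis image_eqI real_norm_def)
  define K where "K = real (m+2) ^ (m+2)"
  have "\<bar>bump p m x\<bar> \<le> (B * K) * (1 - x\<^sup>2)\<^sup>2" for x
  proof (cases "\<bar>x\<bar> < 1")
    case True
    define s where "s = 1 / (1 - x\<^sup>2)"
    have "x\<^sup>2 < 1" using True by (simp add: abs_square_less_1)
    then have s: "s > 0" "1 - x\<^sup>2 = 1 / s" by (auto simp: s_def)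
    have "s ^ (m+2) \<le> K * exp s" unfolding K_def using s power_le_exp_mult[of s "m+2"] by auto
    then have "s ^ m * exp (-s) \<le> K * (1/s)\<^sup>2"
      using s by (simp add: power_add exp_minus divide_simps power2_eq_square mult_ac)
    then have "B * (s ^ m * exp (-s)) \<le> B * (K * (1/s)\<^sup>2)" using B by simp
    moreover have "\<bar>bump p m x\<bar> \<le> B * (s ^ m * exp (-s))"
      using True s B(2)[of x] abs_less_iff[of x 1] by (auto simp: bump_def abs_mult s_def[symmetric] mult_ac intro!: mult_left_mono)
    ultimately show ?thesis using s by simp
  qed (use B in \<open>auto simp: bump_def K_def\<close>)
  moreover have "B * K \<ge> 0" using B by (simp add: K_def)
  ultimately show ?thesis using that by blast
qed

text \<open>Let s = 1 / (1 - x^2), so that s' = 2 x s^2. The derivative of p s^m exp(-s) is exp(-s)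
  times p' s^m + 2 m x p s^(m+1) - 2 x p s^(m+2). Taking out s^(m+2) leaves the stated polynomial,
  with \<open>[:1,0,-1:]\<close> for 1 - x^2 and \<open>[:0,1:]\<close> for x.\<close>

lemma DERIV_bump:
  "(bump p m has_real_derivative bump (pderiv p * [:1,0,-1:]^2 + smult (2 * real m) ([:0,1:] * [:1,0,-1:] * p) - smult 2 ([:0,1:] * p)) (m + 2) x) (at x)"
    (is "(_ has_real_derivative bump ?q _ _) _")
proof -
  consider "\<bar>x\<bar> < 1" | "\<bar>x\<bar> = 1" | "\<bar>x\<bar> > 1" by linarith
  then show ?thesis
  proof cases
    case 1
    then have x: "x\<^sup>2 < 1" by (simp add: abs_square_less_1)
    define s where "s = 1 / (1 - x\<^sup>2)"
    have s: "s > 0" "1 - x\<^sup>2 = 1 / s" using x by (auto simp: s_def)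
    have ds: "((\<lambda>x. 1 / (1 - x\<^sup>2)) has_real_derivative 2 * x * s^2) (at x)"
      using x by (auto intro!: derivative_eq_intros simp: s_def field_simps power2_eq_square)
    have "((\<lambda>x. poly p x * (1 / (1 - x\<^sup>2)) ^ m * exp (- (1 / (1 - x\<^sup>2)))) has_real_derivative
       (poly (pderiv p) x * s ^ m + poly p x * (m * (2 * x * s^2) * s ^ (m - 1))) * exp (-s)
       - poly p x * s ^ m * (2 * x * s^2) * exp (- s)) (at x)"
      by (rule derivative_eq_intros ds refl | simp add: s_def[symmetric] algebra_simps)+
    moreover have "(poly (pderiv p) x * s ^ m + poly p x * (m * (2 * x * s^2) * s ^ (m - 1))) * exp (-s)
       - poly p x * s ^ m * (2 * x * s^2) * exp (- s) = bump ?q (m+2) x"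
    proof -
      have "poly ?q x = poly (pderiv p) x * (1 - x\<^sup>2)^2 + 2 * m * (x * (1 - x\<^sup>2) * poly p x) - 2 * (x * poly p x)"
        by (simp add: power2_eq_square algebra_simps)
      also have "\<dots> = poly (pderiv p) x * (1/s)^2 + 2 * m * (x * (1/s) * poly p x) - 2 * (x * poly p x)"
        by (simp only: s(2))
      finally have q: "poly ?q x = \<dots>" .
      have "bump ?q (m+2) x = poly ?q x * s ^ (m+2) * exp (-s)" using 1 by (simp add: bump_def s_def)
      also have "\<dots> = (poly (pderiv p) x * s ^ m + 2 * m * x * poly p x * (s ^ (m+1)) - 2 * x * poly p x * s ^ (m+2)) * exp (-s)"
        unfolding q using s(1) by (simp add: field_simps power2_eq_square)
      also have "\<dots> = (poly (pderiv p) x * s ^ m + poly p x * (m * (2 * x * s^2) * s ^ (m - 1))) * exp (-s)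
       - poly p x * s ^ m * (2 * x * s^2) * exp (- s)"
        by (cases m) (auto simp: algebra_simps power2_eq_square)
      finally show ?thesis by simp
    qed
    ultimately have "((\<lambda>x. poly p x * (1 / (1 - x\<^sup>2)) ^ m * exp (- (1 / (1 - x\<^sup>2)))) has_real_derivative bump ?q (m+2) x) (at x)"
      by simp
    then show ?thesis
      by (rule DERIV_cong_ev[THEN iffD1, rotated -1, OF _ refl _ refl])
        (use 1 in \<open>auto simp: bump_def eventually_nhds intro!: exI[of _ "{-1<..<1}"]\<close>)
  next
    case 2
    then have x: "x\<^sup>2 = 1" by (metis power2_abs power_one)
    obtain C where C: "C \<ge> 0" "\<And>x. \<bar>bump p m x\<bar> \<le> C * (1 - x\<^sup>2)\<^sup>2" using bump_quadratic by blast
    \<comment> \<open>As x^2 = 1, the factor 1 - y^2 equals (x - y)(x + y), and \<bar>x + y\<bar>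
      \<le> 2 inside the interval; hence the 4.\<close>
    have "\<bar>bump p m y\<bar> \<le> (4 * C) * (y - x)^2" for y
    proof (cases "\<bar>y\<bar> < 1")
      case True
      have "(1 - y\<^sup>2)\<^sup>2 = (y - x)^2 * (y + x)^2"
        unfolding x[symmetric] by (simp add: algebra_simps power2_eq_square)
      also have "(y + x)^2 \<le> 2^2" using True 2 by (intro power2_le_iff_abs_le[THEN iffD2]) auto
      then have "(y - x)^2 * (y + x)^2 \<le> (y - x)^2 * 4" by (intro mult_left_mono) auto
      finally have "C * (1 - y\<^sup>2)\<^sup>2 \<le> C * ((y - x)^2 * 4)" using C by (intro mult_left_mono) auto
      with C(2)[of y] show ?thesis by simp
    qed (use C in \<open>auto simp: bump_def\<close>)
    then have "(bump p m has_real_derivative 0) (at x)" by (rule DERIV_zero_quadratic)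
    then show ?thesis using 2 by (simp add: bump_def)
  next
    case 3
    have "(bump p m has_real_derivative 0) (at x)"
      by (rule DERIV_cong_ev[THEN iffD1, OF refl _ refl, OF _ DERIV_const[of 0]])
         (use 3 in \<open>auto simp: bump_def eventually_nhds intro!: exI[of _ "- {-1..1}"]\<close>)
    then show ?thesis using 3 by (simp add: bump_def)
  qed
qed

lemma smooth1_bump: "smooth1 (bump p m)"
proof (rule smooth1_coinduct[where S="{bump p m | p m. True}"])
  show "g field_differentiable (at x)" if "g \<in> {bump p m |p m. True}" for g x
    using that DERIV_bump by (auto simp: field_differentiable_def)
  show "deriv g \<in> {bump p m |p m. True}" if "g \<in> {bump p m |p m. True}" for g
  proof -
    obtain p m where g: "g = bump p m" using \<open>g \<in> _\<close> by auto
    have "deriv (bump p m) = bump (pderiv p * [:1,0,-1:]^2 + smult (2 * real m) ([:0,1:] * [:1,0,-1:] * p) - smult 2 ([:0,1:] * p)) (m + 2)"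
      by (intro ext DERIV_imp_deriv DERIV_bump)
    then show ?thesis using g by blast
  qed
qed auto

lemma smooth1_primitive:
  assumes "smooth1 f"
  obtains F where "smooth1 F" "deriv F = f" "F c = 0"
proof -
  have "isCont f x" for x using smooth1_DERIV[OF assms] DERIV_isCont by blast
  then obtain F0 where F0: "\<And>x. (F0 has_vector_derivative f x) (at x)"
    using einterval_antiderivative[of "-\<infinity>" "\<infinity>" f] by auto
  define F where "F = (\<lambda>x. F0 x - F0 c)"
  have D: "(F has_real_derivative f x) (at x)" for x
    using F0[of x] unfolding F_def
    by (auto intro!: derivative_eq_intros simp: has_real_derivative_iff_has_vector_derivative[symmetric])
  show ?thesis
  proof
    show "smooth1 F" by (rule smooth1I_deriv[OF D assms])
    show "deriv F = f" using D by (auto intro!: ext DERIV_imp_deriv)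
  qed (simp add: F_def)
qed

lemma zero_deriv_const:
  fixes F :: "real \<Rightarrow> real"
  assumes "\<And>x. x \<in> S \<Longrightarrow> (F has_real_derivative 0) (at x)" "convex S" "x \<in> S" "y \<in> S"
  shows "F x = F y"
  using has_field_derivative_zero_constant[of S F] assms
  by (metis has_field_derivative_at_within)

text \<open>Take the primitive of exp(-1 / (1 - x^2)) that starts at -1 and divide it by its total
  mass \<open>F 1\<close>.\<close>

lemma smooth_step_exists:
  "\<exists>R. smooth1 R \<and> (\<forall>x\<le>-1. R x = 0) \<and> (\<forall>x\<ge>1. R x = 1) \<and> mono R \<and> (\<forall>x. \<bar>x\<bar> \<ge> 1 \<longrightarrow> deriv R x = 0)"
proof -
  let ?b = "bump [:1:] 0"
  obtain F where F: "smooth1 F" "deriv F = ?b" "F (-1) = 0" using smooth1_primitive[OF smooth1_bump] by blast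
  have DF: "(F has_real_derivative ?b x) (at x)" for x using smooth1_DERIV[OF F(1)] F(2) by metis
  have b0: "?b x \<ge> 0" for x by (simp add: bump_def)
  have bpos: "?b x > 0" if "x \<in> {-1<..<1}" for x using that by (simp add: bump_def abs_less_iff)
  have z: "?b x = 0" if "\<bar>x\<bar> \<ge> 1" for x using that by (simp add: bump_def)
  have m: "F x \<le> F y" if "x \<le> y" for x y
    using DERIV_nonneg_imp_nondecreasing[OF that] DF b0 by metis
  have "F (-1) < F 1"
    by (rule DERIV_pos_imp_increasing_open[of "-1" 1 F])
      (use DF bpos in \<open>auto intro!: smooth1_continuous F simp: greaterThanLessThan_iff\<close>)
  then have pos: "F 1 > 0" using F by simp
  have l: "F x = 0" if "x \<le> -1" for x
    using zero_deriv_const[of "{..-1}" F x "-1"] DF that F(3) z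
    by (metis abs_ge_minus_self atMost_iff convex_real_interval(2) dual_order.trans order_refl le_minus_iff)
  have r: "F x = F 1" if "x \<ge> 1" for x
    using zero_deriv_const[of "{1..}" F x "1"] DF that z
    by (metis abs_ge_self atLeast_iff convex_real_interval(1) dual_order.trans order_refl)
  show ?thesis
  proof (intro exI[of _ "\<lambda>x. (1 / F 1) * F x"] conjI allI impI)
    show "mono (\<lambda>x. 1 / F 1 * F x)" using m pos by (auto simp: mono_def divide_simps)
    show "deriv (\<lambda>x. 1 / F 1 * F x) x = 0" if "\<bar>x\<bar> \<ge> 1" for x
      unfolding smooth1_cmult(2)[OF F(1)] F(2) z[OF that] by simp
    show "smooth1 (\<lambda>x. 1 / F 1 * F x)" by (rule smooth1_cmult(1)[OF F(1)])
    show "1 / F 1 * F x = 0" if "x \<le> -1" for x unfolding l[OF that] by simp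
    show "1 / F 1 * F x = 1" if "x \<ge> 1" for x unfolding r[OF that] using pos by simp
  qed
qed

section \<open>One-dimensional tools\<close>

lemma integrable_tensor:
  fixes f g :: "real \<Rightarrow> real"
  assumes f: "integrable lborel f" and g: "integrable lborel g"
  shows "integrable lborel (\<lambda>p. f (fst p) * g (snd p))"
proof -
  have [measurable]: "f \<in> borel_measurable borel" "g \<in> borel_measurable borel"
    using f g by (auto dest: borel_measurable_integrable)
  have "integrable (lborel \<Otimes>\<^sub>M lborel) (\<lambda>p. f (fst p) * g (snd p))"
  proof (rule lborel_pair.Fubini_integrable)
    show "integrable lborel (\<lambda>x. LBINT y. norm (f (fst (x, y)) * g (snd (x, y))))"
      using f by (simp add: abs_mult)
  qed (use g in auto)
  then show ?thesis by (simp only: lborel_prod)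
qed

lemma integrable_continuous_Icc:
  fixes f :: "real \<Rightarrow> real"
  assumes "continuous_on {a..b} f"
  shows "integrable lborel (\<lambda>x. ind {a..b} x * f x)"
  using borel_integrable_atLeastAtMost'[OF assms] by (simp add: set_integrable_def)

lemma integral_deriv_Icc:
  assumes "smooth1 f" "a \<le> b"
  shows "(LBINT x. ind {a..b} x * deriv f x) = f b - f a"
proof -
  have "isCont (deriv f) x" for x using smooth1_deriv[OF assms(1)] smooth1_DERIV DERIV_isCont by blast
  then show ?thesis
    using integral_FTC_Icc_real[OF assms(2), of f "deriv f"] smooth1_DERIV[OF assms(1)]
    by (simp add: mult.commute)
qed

definition step :: "real \<Rightarrow> real" where
  "step = (SOME R. smooth1 R \<and> (\<forall>x\<le>-1. R x = 0) \<and> (\<forall>x\<ge>1. R x = 1) \<and> mono R \<and> (\<forall>x. \<bar>x\<bar> \<ge> 1 \<longrightarrow> deriv R x = 0))"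

lemma step_smooth: "smooth1 step"
  and step_0: "x \<le> -1 \<Longrightarrow> step x = 0"
  and step_1: "x \<ge> 1 \<Longrightarrow> step x = 1"
  and step_mono: "x \<le> y \<Longrightarrow> step x \<le> step y"
  and step_deriv_0: "\<bar>x\<bar> \<ge> 1 \<Longrightarrow> deriv step x = 0"
  using someI_ex[OF smooth_step_exists] unfolding step_def[symmetric] by (auto simp: mono_def)

lemma step_range: "0 \<le> step x" "step x \<le> 1"
  using step_mono[of "min x (-1)" x] step_mono[of x "max x 1"] step_0[of "min x (-1)"] step_1[of "max x 1"] by auto

lemma step_deriv_nonneg: "0 \<le> deriv step x"
proof -
  have "mono_on UNIV step" by (auto simp: mono_on_def step_mono)
  then show ?thesis
    using mono_on_imp_deriv_nonneg[of UNIV step "deriv step x" x] smooth1_DERIV[OF step_smooth] by simp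
qed

text \<open>A smoothed Heaviside function with jump at \<open>X\<close> and half-width
  \<open>e\<close>; its derivative is an approximate delta at \<open>X\<close>.\<close>

definition stepx :: "real \<Rightarrow> real \<Rightarrow> real \<Rightarrow> real" where
  "stepx X e x = step ((x - X) / e)"

lemma stepx_smooth: "smooth1 (stepx X e)"
  and stepx_deriv: "deriv (stepx X e) x = deriv step ((x - X) / e) / e"
proof -
  have *: "stepx X e = (\<lambda>x. 1 * step ((1/e) * x + (- X / e)))"
    by (auto simp: stepx_def diff_divide_distrib)
  show "smooth1 (stepx X e)" unfolding * by (rule smooth1_affine[OF step_smooth])
  show "deriv (stepx X e) x = deriv step ((x - X) / e) / e"
    unfolding * smooth1_affine(2)[OF step_smooth] by (simp add: diff_divide_distrib)
qed

lemma stepx_deriv_nonneg: "e > 0 \<Longrightarrow> deriv (stepx X e) x \<ge> 0"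
  by (simp add: stepx_deriv step_deriv_nonneg)

lemma stepx_deriv_0: "e > 0 \<Longrightarrow> \<bar>x - X\<bar> \<ge> e \<Longrightarrow> deriv (stepx X e) x = 0"
  by (simp add: stepx_deriv step_deriv_0)

lemma stepx_0: "e > 0 \<Longrightarrow> x \<le> X - e \<Longrightarrow> stepx X e x = 0"
  by (simp add: stepx_def step_0 divide_simps)

lemma stepx_1: "e > 0 \<Longrightarrow> x \<ge> X + e \<Longrightarrow> stepx X e x = 1"
  by (simp add: stepx_def step_1 divide_simps)

text \<open>The centres may move, because the tests below are pushed away from the end points of the
  interval. At \<open>x0\<close> itself the limit would depend on how the centres approach
  it.\<close>

lemma stepx_limit:
  assumes "X \<longlonglongrightarrow> x0" "e \<longlonglongrightarrow> 0" "\<And>n. e n > 0" "x \<noteq> x0"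
  shows "(\<lambda>n. stepx (X n) (e n) x) \<longlonglongrightarrow> (if x > x0 then 1 else 0)"
proof (cases "x > x0")
  case True
  have "(\<lambda>n. X n + e n) \<longlonglongrightarrow> x0 + 0" by (intro tendsto_add assms)
  then have "\<forall>\<^sub>F n in sequentially. X n + e n < x" using True by (intro order_tendstoD) auto
  then have "\<forall>\<^sub>F n in sequentially. stepx (X n) (e n) x = 1"
    by eventually_elim (use assms(3) in \<open>auto intro!: stepx_1\<close>)
  then show ?thesis using True by (simp add: tendsto_eventually)
next
  case False
  have "(\<lambda>n. X n - e n) \<longlonglongrightarrow> x0 - 0" by (intro tendsto_diff assms)
  then have "\<forall>\<^sub>F n in sequentially. X n - e n > x" using False assms(4) by (intro order_tendstoD) auto
  then have "\<forall>\<^sub>F n in sequentially. stepx (X n) (e n) x = 0"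
    by eventually_elim (use assms(3) in \<open>auto intro!: stepx_0\<close>)
  then show ?thesis using False by (simp add: tendsto_eventually)
qed

text \<open>The derivatives form an approximate identity: nonnegative, supported within
  \<open>e n\<close> of \<open>X n\<close>, and of mass one, since the conditions on
  \<open>X n\<close> keep the whole transition inside \<open>{c..d}\<close>. The limit
  \<open>x\<close> may still be an end point.\<close>

lemma stepx_deriv_limit:
  assumes F: "continuous_on {c..d} F" and x: "x \<in> {c..d}"
    and X: "X \<longlonglongrightarrow> x" "\<And>n. c + e n \<le> X n" "\<And>n. X n \<le> d - e n"
    and e: "e \<longlonglongrightarrow> 0" "\<And>n. e n > 0"
  shows "(\<lambda>n. LBINT y. ind {c..d} y * (F y * deriv (stepx (X n) (e n)) y)) \<longlonglongrightarrow> F x"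
proof (rule LIMSEQ_I)
  fix r :: real assume r: "0 < r"
  obtain \<delta> where \<delta>: "\<delta> > 0" "\<And>y. y \<in> {c..d} \<Longrightarrow> \<bar>y - x\<bar> < \<delta> \<Longrightarrow> \<bar>F y - F x\<bar> < r / 2"
    using F x r unfolding continuous_on_iff dist_real_def by (metis half_gt_zero)
  have "(\<lambda>n. \<bar>X n - x\<bar> + e n) \<longlonglongrightarrow> \<bar>x - x\<bar> + 0" by (intro tendsto_intros assms)
  then have "\<forall>\<^sub>F n in sequentially. \<bar>X n - x\<bar> + e n < \<delta>" using \<delta> by (intro order_tendstoD) auto
  then obtain N where N: "\<And>n. n \<ge> N \<Longrightarrow> \<bar>X n - x\<bar> + e n < \<delta>" by (auto simp: eventually_sequentially)
  have "norm ((LBINT y. ind {c..d} y * (F y * deriv (stepx (X n) (e n)) y)) - F x) < r" if "n \<ge> N" for n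
  proof -
    let ?D = "deriv (stepx (X n) (e n))"
    have cD: "continuous_on {c..d} ?D" by (intro smooth1_continuous smooth1_deriv stepx_smooth)
    have cd: "c \<le> d" using x by auto
    have D1: "(LBINT y. ind {c..d} y * ?D y) = 1"
      unfolding integral_deriv_Icc[OF stepx_smooth cd]
      using stepx_0[of "e n" c "X n"] stepx_1[of "e n" "X n" d] e X(2,3)[of n] by simp
    have I1: "integrable lborel (\<lambda>y. ind {c..d} y * (F y * ?D y))"
      and I3: "integrable lborel (\<lambda>y. ind {c..d} y * (F x * ?D y))"
      and I5: "integrable lborel (\<lambda>y. ind {c..d} y * (r/2 * ?D y))"
      by (intro integrable_continuous_Icc continuous_intros F cD)+
    have "(LBINT y. ind {c..d} y * (F y * ?D y)) - F x
       = (LBINT y. ind {c..d} y * (F y * ?D y)) - F x * (LBINT y. ind {c..d} y * ?D y)"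
      using D1 by simp
    also have "\<dots> = (LBINT y. ind {c..d} y * (F y * ?D y)) - (LBINT y. ind {c..d} y * (F x * ?D y))"
      by (simp add: mult.left_commute)
    also have "\<dots> = (LBINT y. ind {c..d} y * (F y * ?D y) - ind {c..d} y * (F x * ?D y))"
      using I1 I3 by simp
    finally have "norm ((LBINT y. ind {c..d} y * (F y * ?D y)) - F x)
      = \<bar>LBINT y. ind {c..d} y * (F y * ?D y) - ind {c..d} y * (F x * ?D y)\<bar>" by simp
    also have "\<dots> \<le> (LBINT y. \<bar>ind {c..d} y * (F y * ?D y) - ind {c..d} y * (F x * ?D y)\<bar>)"
      by (rule integral_abs_bound)
    also have "\<dots> \<le> (LBINT y. ind {c..d} y * (r/2 * ?D y))"
    proof (rule integral_mono)
      show "\<bar>ind {c..d} y * (F y * ?D y) - ind {c..d} y * (F x * ?D y)\<bar> \<le> ind {c..d} y * (r/2 * ?D y)" for y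
      proof (cases "y \<in> {c..d} \<and> \<bar>y - X n\<bar> < e n")
        case True
        then have "\<bar>F y - F x\<bar> \<le> r / 2" using \<delta>(2)[of y] N[OF that] by (smt (verit))
        then have "\<bar>F y - F x\<bar> * ?D y \<le> r / 2 * ?D y"
          using stepx_deriv_nonneg[OF e(2)] by (intro mult_right_mono) auto
        then show ?thesis using True stepx_deriv_nonneg[OF e(2)] by (simp add: left_diff_distrib[symmetric] abs_mult)
      next
        case False
        then show ?thesis using stepx_deriv_0[OF e(2), of n y "X n"] by (auto simp: indicator_def)
      qed
      show "integrable lborel (\<lambda>y. \<bar>ind {c..d} y * (F y * ?D y) - ind {c..d} y * (F x * ?D y)\<bar>)"
        using I1 I3 by (intro integrable_abs Bochner_Integration.integrable_diff)
    qed (rule I5)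
    also have "\<dots> = r / 2 * (LBINT y. ind {c..d} y * ?D y)" by (simp add: mult.left_commute)
    also have "\<dots> < r" using D1 r by simp
    finally show ?thesis .
  qed
  then show "\<exists>no. \<forall>n\<ge>no. norm ((LBINT y. ind {c..d} y * (F y * deriv (stepx (X n) (e n)) y)) - F x) < r" by blast
qed

text \<open>The one-dimensional analogue of \<open>test_fun\<close> on the open interval, with the
  compact support given by explicit bounds.\<close>

definition test1 :: "real \<Rightarrow> real \<Rightarrow> (real \<Rightarrow> real) \<Rightarrow> bool" where
  "test1 c d a \<longleftrightarrow> smooth1 a \<and> (\<exists>c' d'. c < c' \<and> d' < d \<and> (\<forall>x. x \<notin> {c'..d'} \<longrightarrow> a x = 0))"

lemma test1_smooth: "test1 c d a \<Longrightarrow> smooth1 a" by (simp add: test1_def)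

lemma test1_0: "test1 c d a \<Longrightarrow> x \<notin> {c<..<d} \<Longrightarrow> a x = 0"
  unfolding test1_def by force

lemma stepx_diff_test1:
  assumes "e > 0" "c + e < X1" "X1 \<le> X2" "X2 < d - e"
  shows "test1 c d (\<lambda>x. stepx X1 e x - stepx X2 e x)"
    and "deriv (\<lambda>x. stepx X1 e x - stepx X2 e x) = (\<lambda>x. deriv (stepx X1 e) x - deriv (stepx X2 e) x)"
proof -
  have *: "(\<lambda>x. stepx X1 e x - stepx X2 e x) = (\<lambda>x. stepx X1 e x + (-1) * stepx X2 e x)" by auto
  note s = stepx_smooth[of X1 e] smooth1_cmult(1)[OF stepx_smooth[of X2 e], of "-1"]
  show "deriv (\<lambda>x. stepx X1 e x - stepx X2 e x) = (\<lambda>x. deriv (stepx X1 e) x - deriv (stepx X2 e) x)"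
    unfolding * smooth1_add(2)[OF s] smooth1_cmult(2)[OF stepx_smooth] by simp
  have "stepx X1 e x - stepx X2 e x = 0" if "x \<notin> {X1 - e .. X2 + e}" for x
    using that stepx_0[OF assms(1), of x X1] stepx_0[OF assms(1), of x X2]
      stepx_1[OF assms(1), of X1 x] stepx_1[OF assms(1), of X2 x] assms by (cases "x < X1 - e") auto
  moreover have "smooth1 (\<lambda>x. stepx X1 e x - stepx X2 e x)"
    unfolding * by (rule smooth1_add[OF s])
  ultimately show "test1 c d (\<lambda>x. stepx X1 e x - stepx X2 e x)"
    using assms unfolding test1_def
    by (intro conjI exI[of _ "X1 - e"] exI[of _ "X2 + e"]) auto
qed

text \<open>The tests are smoothed indicators of \<open>{x1..x2}\<close>, moved into the interior by \<open>2 e\<close> so that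
  \<open>x1 = c\<close> and \<open>x2 = d\<close> are allowed.\<close>

lemma weak_primitive:
  assumes cd: "c < d" and F: "continuous_on {c..d} F" and P: "integrable lborel P"
    and weak: "\<And>a. test1 c d a \<Longrightarrow>
       (LBINT x. ind {c..d} x * (F x * deriv a x)) = - (LBINT x. P x * a x)"
    and x: "c \<le> x1" "x1 \<le> x2" "x2 \<le> d"
  shows "F x2 - F x1 = (LBINT x. ind {x1..x2} x * P x)"
proof -
  \<comment> \<open>The 5 gives \<open>5 * e n \<le> d - c\<close>, so the two clamping bounds
    \<open>c + 2 * e n\<close> and \<open>d - 2 * e n\<close> are in the right order for every
    \<open>n\<close>.\<close>
  define e where "e n = (d - c) / (real n + 5)" for n
  have e0: "e n > 0" and e5: "5 * e n \<le> d - c" for n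
    using cd by (auto simp: e_def field_simps mult_right_mono)
  have "(\<lambda>n. (d - c) * inverse (real (n + 5))) \<longlonglongrightarrow> (d - c) * 0"
    by (intro tendsto_mult tendsto_const LIMSEQ_ignore_initial_segment LIMSEQ_inverse_real_of_nat_add[THEN LIMSEQ_ignore_initial_segment] lim_inverse_n)
  then have elim: "e \<longlonglongrightarrow> 0" by (simp add: e_def[abs_def] field_simps)
  define X where "X x n = max (c + 2 * e n) (min x (d - 2 * e n))" for x n
  have Xb: "c + 2 * e n \<le> X x n" "X x n \<le> d - 2 * e n" for x n
    using e5[of n] e0[of n] by (auto simp: X_def)
  have Xlim: "X x \<longlonglongrightarrow> x" if "x \<in> {c..d}" for x
  proof -
    have "X x \<longlonglongrightarrow> max (c + 2 * 0) (min x (d - 2 * 0))"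
      unfolding X_def by (intro tendsto_intros elim)
    then show ?thesis using that by (simp add: max_def min_def split: if_splits)
  qed
  define a where "a n x = stepx (X x1 n) (e n) x - stepx (X x2 n) (e n) x" for n x
  have X12: "X x1 n \<le> X x2 n" for n using x by (auto simp: X_def)
  have ta: "test1 c d (a n)" and da: "deriv (a n) = (\<lambda>x. deriv (stepx (X x1 n) (e n)) x - deriv (stepx (X x2 n) (e n)) x)" for n
  proof -
    have "c + e n < X x1 n" "X x2 n < d - e n" using e0[of n] Xb(1)[of n x1] Xb(2)[of x2 n] by linarith+
    note * = stepx_diff_test1[OF e0 this(1) X12 this(2)]
    show "test1 c d (a n)" "deriv (a n) = (\<lambda>x. deriv (stepx (X x1 n) (e n)) x - deriv (stepx (X x2 n) (e n)) x)"
      using * by (simp_all add: a_def[abs_def])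
  qed
  have L: "(\<lambda>n. LBINT y. ind {c..d} y * (F y * deriv (stepx (X x n) (e n)) y)) \<longlonglongrightarrow> F x" if "x \<in> {c..d}" for x
  proof (rule stepx_deriv_limit[OF F that Xlim[OF that] _ _ elim e0])
    show "c + e n \<le> X x n" "X x n \<le> d - e n" for n
      using e0[of n] Xb(1)[of n x] Xb(2)[of x n] by linarith+
  qed
  have "(LBINT y. ind {c..d} y * (F y * deriv (a n) y)) =
    (LBINT y. ind {c..d} y * (F y * deriv (stepx (X x1 n) (e n)) y)) - (LBINT y. ind {c..d} y * (F y * deriv (stepx (X x2 n) (e n)) y))" for n
    unfolding da right_diff_distrib
    by (intro Bochner_Integration.integral_diff integrable_continuous_Icc continuous_intros F smooth1_continuous smooth1_deriv stepx_smooth)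
  then have "(\<lambda>n. LBINT y. ind {c..d} y * (F y * deriv (a n) y)) \<longlonglongrightarrow> F x1 - F x2"
    using x by (auto intro!: tendsto_diff L)
  moreover have "(LBINT y. ind {c..d} y * (F y * deriv (a n) y)) = - (LBINT x. P x * a n x)" for n
    by (rule weak[OF ta])
  moreover have "(\<lambda>n. LBINT x. P x * a n x) \<longlonglongrightarrow> (LBINT x. ind {x1..x2} x * P x)"
  proof (rule integral_dominated_convergence)
    have [measurable]: "P \<in> borel_measurable borel" using P by (auto dest: borel_measurable_integrable)
    have [measurable]: "a n \<in> borel_measurable borel" for n
      using smooth1_continuous[OF test1_smooth[OF ta]] by (rule borel_measurable_continuous_onI)
    show "(\<lambda>x. ind {x1..x2} x * P x) \<in> borel_measurable lborel" by measurable
    show "(\<lambda>x. P x * a n x) \<in> borel_measurable lborel" for n by measurable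
    show "integrable lborel (\<lambda>x. \<bar>P x\<bar>)" using P by simp
    have "\<bar>a n x\<bar> \<le> 1" for n x
      unfolding a_def stepx_def using step_range by (smt (verit))
    then show "AE x in lborel. norm (P x * a n x) \<le> \<bar>P x\<bar>" for n
      by (auto simp: abs_mult mult_left_le)
    \<comment> \<open>Only at \<open>x1\<close> and \<open>x2\<close> may the smoothed steps fail to
      converge to the indicator.\<close>
    show "AE x in lborel. (\<lambda>n. P x * a n x) \<longlonglongrightarrow> ind {x1..x2} x * P x"
      using AE_lborel_singleton[of x1] AE_lborel_singleton[of x2]
    proof eventually_elim
      case (elim z)
      have "(\<lambda>n. P z * a n z) \<longlonglongrightarrow> P z * ((if z > x1 then 1 else 0) - (if z > x2 then 1 else 0))"
        unfolding a_def using x elim by (intro tendsto_mult tendsto_const tendsto_diff stepx_limit Xlim \<open>e \<longlonglongrightarrow> 0\<close> e0) auto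
      also have "P z * ((if z > x1 then 1 else 0) - (if z > x2 then 1 else 0)) = ind {x1..x2} z * P z"
        using elim x by (auto simp: indicator_def)
      finally show ?case .
    qed
  qed
  then have "(\<lambda>n. - (LBINT x. P x * a n x)) \<longlonglongrightarrow> - (LBINT x. ind {x1..x2} x * P x)"
    by (rule tendsto_minus)
  ultimately have "F x1 - F x2 = - (LBINT x. ind {x1..x2} x * P x)"
    using LIMSEQ_unique by simp
  then show ?thesis by simp
qed

text \<open>\<open>F\<close> is known only as a primitive of an integrable function, so its integral
  formula is inserted and Fubini applied on the triangle \<alpha> \<le> t \<le> y \<le> \<beta>. The
  inner integral of \<open>h'\<close> over \<open>{t..\<beta>}\<close> is \<open>- h t\<close>, and
  the constant \<open>c\<close> drops out because \<open>h\<close> vanishes at both ends.\<close>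

lemma integral_by_parts_primitive:
  fixes p h h' F :: "real \<Rightarrow> real"
  assumes p: "integrable lborel p"
    and F: "\<And>y. y \<in> {\<alpha>..\<beta>} \<Longrightarrow> F y = c + (LBINT t. ind {\<alpha>..y} t * p t)"
    and h: "\<And>x. (h has_real_derivative h' x) (at x)" "continuous_on UNIV h'"
    and h0: "\<And>y. y \<notin> {\<alpha><..<\<beta>} \<Longrightarrow> h y = 0"
    and "\<alpha> \<le> \<beta>"
  shows "(LBINT y. ind {\<alpha>..\<beta>} y * (F y * h' y)) = - (LBINT y. p y * h y)"
proof -
  have [measurable]: "p \<in> borel_measurable borel" using p by (auto dest: borel_measurable_integrable)
  have [measurable]: "h' \<in> borel_measurable borel" using h(2) by (rule borel_measurable_continuous_onI)
  have ih: "integrable lborel (\<lambda>y. ind {\<alpha>..\<beta>} y * h' y)"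
    using h(2) continuous_on_subset by (intro integrable_continuous_Icc) blast
  have I: "(LBINT y. ind {s..t} y * h' y) = h t - h s" if "s \<le> t" for s t
    using integral_FTC_Icc_real[OF that, of h h'] h by (simp add: mult.commute continuous_on_eq_continuous_at)
  define f where "f y t = ind {\<alpha>..\<beta>} y * h' y * (ind {\<alpha>..y} t * p t)" for y t
  have intf: "integrable lborel (\<lambda>(y, t). f y t)"
  proof (rule Bochner_Integration.integrable_bound[OF integrable_tensor[OF ih p]])
    have "(\<lambda>q. f (fst q) (snd q)) = (\<lambda>q. ind {\<alpha>..\<beta>} (fst q) * h' (fst q) * (ind {q. \<alpha> \<le> snd q \<and> snd q \<le> fst q} q * p (snd q)))"
      by (auto simp: f_def indicator_def)
    also have "\<dots> \<in> borel_measurable (lborel \<Otimes>\<^sub>M lborel)" by measurable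
    finally show "(\<lambda>(y, t). f y t) \<in> borel_measurable lborel" by (simp add: lborel_prod case_prod_beta')
    show "AE x in lborel. norm (case x of (y, t) \<Rightarrow> f y t) \<le> norm (ind {\<alpha>..\<beta>} (fst x) * h' (fst x) * p (snd x))"
      by (auto simp: f_def indicator_def)
  qed
  have "ind {\<alpha>..\<beta>} y * (F y * h' y) = c * (ind {\<alpha>..\<beta>} y * h' y) + (LBINT t. f y t)" for y
    by (auto simp: f_def F indicator_def algebra_simps)
  then have "(LBINT y. ind {\<alpha>..\<beta>} y * (F y * h' y))
    = (LBINT y. c * (ind {\<alpha>..\<beta>} y * h' y) + (LBINT t. f y t))" by simp
  also have "\<dots> = c * (LBINT y. ind {\<alpha>..\<beta>} y * h' y) + (LBINT y. LBINT t. f y t)"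
    using ih lborel_pair.integrable_fst[of f] intf by (subst Bochner_Integration.integral_add) (auto simp: lborel_prod)
  also have "(LBINT y. ind {\<alpha>..\<beta>} y * h' y) = 0"
    using I[of \<alpha> \<beta>] h0[of \<alpha>] h0[of \<beta>] \<open>\<alpha> \<le> \<beta>\<close> by simp
  also have "(LBINT y. LBINT t. f y t) = (LBINT t. LBINT y. f y t)"
    using lborel_pair.Fubini_integral[of f] intf by (simp add: lborel_prod)
  also have "\<dots> = (LBINT t. - (p t * h t))"
  proof (rule Bochner_Integration.integral_cong)
    fix t
    show "(LBINT y. f y t) = - (p t * h t)"
    proof (cases "t \<in> {\<alpha>..\<beta>}")
      case True
      then have "f y t = p t * (ind {t..\<beta>} y * h' y)" for y by (auto simp: f_def indicator_def)
      then show ?thesis using I[of t \<beta>] h0[of \<beta>] True by simp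
    next
      case False
      then have "f y t = 0" for y by (auto simp: f_def indicator_def)
      then show ?thesis using h0[of t] False by auto
    qed
  qed simp
  finally show ?thesis by simp
qed

section \<open>Tensor products as test functions\<close>

lemma borel_measurable_fst_snd [measurable]:
  "fst \<in> borel_measurable (borel :: (real \<times> real) measure)"
  "snd \<in> borel_measurable (borel :: (real \<times> real) measure)"
  by (intro borel_measurable_continuous_onI continuous_intros)+

lemma lborel_fubini:
  fixes f :: "real \<times> real \<Rightarrow> real"
  assumes "integrable lborel f"
  shows "(LBINT x. LBINT y. f (x, y)) = (LBINT p. f p)"
    and "(LBINT y. LBINT x. f (x, y)) = (LBINT p. f p)"
    and "integrable lborel (\<lambda>x. LBINT y. f (x, y))"
    and "integrable lborel (\<lambda>y. LBINT x. f (x, y))"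
    and "AE x in lborel. integrable lborel (\<lambda>y. f (x, y))"
    and "AE y in lborel. integrable lborel (\<lambda>x. f (x, y))"
proof -
  have 1: "integrable (lborel \<Otimes>\<^sub>M lborel) f" using assms by (simp only: lborel_prod)
  then have 2: "integrable (lborel \<Otimes>\<^sub>M lborel) (case_prod (\<lambda>x y. f (x, y)))" by simp
  show "(LBINT x. LBINT y. f (x, y)) = (LBINT p. f p)"
    using lborel_pair.integral_fst'[OF 1] by (simp add: lborel_prod)
  show "(LBINT y. LBINT x. f (x, y)) = (LBINT p. f p)"
    using lborel_pair.integral_snd[OF 2] by (simp add: lborel_prod)
  show "integrable lborel (\<lambda>x. LBINT y. f (x, y))" by (rule lborel_pair.integrable_fst'[OF 1])
  show "integrable lborel (\<lambda>y. LBINT x. f (x, y))" by (rule lborel_pair.integrable_snd[OF 2])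
  show "AE x in lborel. integrable lborel (\<lambda>y. f (x, y))" by (rule lborel_pair.AE_integrable_fst'[OF 1])
  show "AE y in lborel. integrable lborel (\<lambda>x. f (x, y))" by (rule lborel_pair.AE_integrable_snd[OF 2])
qed

definition tensor :: "(real \<Rightarrow> real) \<Rightarrow> (real \<Rightarrow> real) \<Rightarrow> real \<times> real \<Rightarrow> real" where
  "tensor a b p = a (fst p) * b (snd p)"

lemma pd_tensor:
  assumes "smooth1 a" "smooth1 b"
  shows "pd e1 (tensor a b) = tensor (deriv a) b" "pd e2 (tensor a b) = tensor a (deriv b)"
proof -
  have "((\<lambda>t. tensor a b (p + t *\<^sub>R e1)) has_real_derivative tensor (deriv a) b p) (at 0)" for p
    unfolding tensor_def e1_def
    by (auto intro!: derivative_eq_intros DERIV_chain2[of a] smooth1_DERIV[OF assms(1)])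
  then show "pd e1 (tensor a b) = tensor (deriv a) b"
    by (auto simp: pd_def intro!: ext DERIV_imp_deriv)
  have "((\<lambda>t. tensor a b (p + t *\<^sub>R e2)) has_real_derivative tensor a (deriv b) p) (at 0)" for p
    unfolding tensor_def e2_def
    by (auto intro!: derivative_eq_intros DERIV_chain2[of b] smooth1_DERIV[OF assms(2)])
  then show "pd e2 (tensor a b) = tensor a (deriv b)"
    by (auto simp: pd_def intro!: ext DERIV_imp_deriv)
qed

lemma pds_tensor:
  assumes "smooth1 a" "smooth1 b" "set ds \<subseteq> {e1, e2}"
  shows "\<exists>a' b'. smooth1 a' \<and> smooth1 b' \<and> pds ds (tensor a b) = tensor a' b'"
  using assms(3)
proof (induction ds)
  case (Cons d ds)
  then obtain a' b' where *: "smooth1 a'" "smooth1 b'" "pds ds (tensor a b) = tensor a' b'" by auto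
  show ?case
  proof (cases "d = e1")
    case True
    then show ?thesis using * pd_tensor(1)[OF *(1,2)] smooth1_deriv by (metis pds.simps(2))
  next
    case False
    then have "d = e2" using Cons by auto
    then show ?thesis using * pd_tensor(2)[OF *(1,2)] smooth1_deriv by (metis pds.simps(2))
  qed
qed (use assms in auto)

lemma tensor_differentiable:
  assumes "smooth1 a" "smooth1 b"
  shows "tensor a b differentiable (at p)"
proof -
  have "(\<lambda>p. a (fst p)) differentiable (at p)" "(\<lambda>p. b (snd p)) differentiable (at p)"
    unfolding differentiable_def
    using DERIV_compose_FDERIV[OF smooth1_DERIV[OF assms(1)] bounded_linear_imp_has_derivative[OF bounded_linear_fst]]
      DERIV_compose_FDERIV[OF smooth1_DERIV[OF assms(2)] bounded_linear_imp_has_derivative[OF bounded_linear_snd]]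
    by blast+
  then show ?thesis unfolding tensor_def[abs_def] by (rule differentiable_mult)
qed

lemma smooth_tensor:
  assumes "smooth1 a" "smooth1 b"
  shows "smooth (tensor a b)"
  unfolding smooth_def using pds_tensor[OF assms] tensor_differentiable by metis

lemma test_fun_tensor:
  assumes "test1 0 pi a" "test1 (-l) l b"
  shows "test_fun (Omega l) (tensor a b)"
proof -
  obtain c d where a: "0 < c" "d < pi" "\<And>x. x \<notin> {c..d} \<Longrightarrow> a x = 0" using assms by (auto simp: test1_def)
  obtain c' d' where b: "-l < c'" "d' < l" "\<And>x. x \<notin> {c'..d'} \<Longrightarrow> b x = 0" using assms unfolding test1_def by blast
  have cl: "closure {p. tensor a b p \<noteq> 0} \<subseteq> {c..d} \<times> {c'..d'}"
  proof (rule closure_minimal)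
    show "{p. tensor a b p \<noteq> 0} \<subseteq> {c..d} \<times> {c'..d'}"
      using a(3) b(3) by (force simp: tensor_def simp del: atLeastAtMost_iff)
  qed (simp add: closed_Times)
  have "compact ({c..d} \<times> {c'..d'})" by (intro compact_Times compact_Icc)
  then have "compact (closure {p. tensor a b p \<noteq> 0})"
    using cl compact_Int_closed[OF _ closed_closure] by (metis inf.absorb2)
  moreover have "{c..d} \<times> {c'..d'} \<subseteq> Omega l" using a b by (auto simp: Omega_def)
  ultimately show ?thesis
    using cl smooth_tensor test1_smooth assms by (auto simp: test_fun_def)
qed

lemma Dmulti_tensor:
  assumes "smooth1 a" "smooth1 b"
  shows "Dmulti 1 1 (tensor a b) = tensor (deriv a) (deriv b)"
    and "Dmulti 2 0 (tensor a b) = tensor (deriv (deriv a)) b"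
    and "Dmulti 0 2 (tensor a b) = tensor a (deriv (deriv b))"
  using assms by (simp_all add: Dmulti_def numeral_2_eq_2 pd_tensor smooth1_deriv)

section \<open>Mixed weak derivatives and rectangle differences\<close>

lemma closure_Omega:
  assumes "l > 0"
  shows "closure (Omega l) = {0..pi} \<times> {-l..l}"
  using assms by (simp add: Omega_def closure_Times)

lemma integrable_continuous_rect:
  fixes f :: "real \<times> real \<Rightarrow> real"
  assumes "continuous_on ({c..d} \<times> {c'..d'}) f"
  shows "integrable lborel (\<lambda>p. ind ({c..d} \<times> {c'..d'}) p * f p)"
  using borel_integrable_compact[OF compact_Times[OF compact_Icc compact_Icc] assms] by (simp cong: if_cong)

lemma continuous_on_section_integral:
  fixes f :: "real \<times> real \<Rightarrow> real"
  assumes "continuous_on ({c..d} \<times> {c'..d'}) f"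
  shows "continuous_on {c..d} (\<lambda>x. LBINT y. ind {c'..d'} y * f (x, y))"
proof -
  have "continuous_on {c..d} (\<lambda>x. integral (cbox c' d') (\<lambda>y. f (x, y)))"
    by (rule integral_continuous_on_param) (use assms in \<open>simp add: case_prod_beta'\<close>)
  moreover have "(LBINT y. ind {c'..d'} y * f (x, y)) = integral (cbox c' d') (\<lambda>y. f (x, y))"
    if "x \<in> {c..d}" for x
  proof -
    have "continuous_on {c'..d'} (\<lambda>y. f (x, y))"
      by (rule continuous_on_compose2[OF assms]) (use that in \<open>auto intro!: continuous_intros\<close>)
    then have "set_integrable lborel {c'..d'} (\<lambda>y. f (x, y))" by (rule borel_integrable_atLeastAtMost')
    from set_borel_integral_eq_integral(2)[OF this] show ?thesis by (simp add: set_lebesgue_integral_def)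
  qed
  ultimately show ?thesis using continuous_on_cong[OF refl] by (smt (verit, best))
qed

lemma integrable_mult_bounded:
  fixes f g :: "'a \<Rightarrow> real"
  assumes "integrable M f" "g \<in> borel_measurable M" "\<And>x. \<bar>g x\<bar> \<le> B"
  shows "integrable M (\<lambda>x. f x * g x)"
proof (rule Bochner_Integration.integrable_bound[where f="\<lambda>x. B * f x"])
  show "AE x in M. norm (f x * g x) \<le> norm (B * f x)"
  proof (rule AE_I2)
    fix x
    have "\<bar>f x\<bar> * \<bar>g x\<bar> \<le> \<bar>f x\<bar> * \<bar>B\<bar>" using assms(3)[of x] by (intro mult_left_mono) auto
    then show "norm (f x * g x) \<le> norm (B * f x)" by (simp add: abs_mult mult.commute)
  qed
qed (use assms in auto)

lemma test1_bounded:
  assumes "test1 c d a"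
  obtains B where "\<And>x. \<bar>a x\<bar> \<le> B"
proof -
  have "compact (a ` {c..d})"
    by (intro compact_continuous_image compact_Icc smooth1_continuous test1_smooth[OF assms])
  then obtain B where "B > 0" "\<And>x. x \<in> {c..d} \<Longrightarrow> \<bar>a x\<bar> \<le> B"
    using compact_imp_bounded bounded_pos by (metis image_eqI real_norm_def)
  then have "\<bar>a x\<bar> \<le> B" for x using test1_0[OF assms, of x] by (cases "x \<in> {c..d}") auto
  then show ?thesis using that by blast
qed

lemma test1_measurable: "test1 c d a \<Longrightarrow> a \<in> borel_measurable borel"
  by (intro borel_measurable_continuous_onI smooth1_continuous test1_smooth)

text \<open>\<open>weak_primitive\<close> is applied twice. For a fixed test \<open>b\<close> in
  \<open>y\<close> it computes the increment in \<open>x\<close> of the integral of \<open>v\<close>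
  against \<open>deriv b\<close>; this identifies \<open>P\<close> as the weak derivative of the
  increment \<open>F\<close>, to which it is applied again in \<open>y\<close>. Two integrations by
  parts explain the positive sign in \<open>weak\<close>.\<close>

lemma rectangle_difference:
  fixes v g :: "real \<times> real \<Rightarrow> real"
  assumes cd: "c < d" "c' < d'" and v: "continuous_on ({c..d} \<times> {c'..d'}) v" and g: "integrable lborel g"
    and weak: "\<And>a b. test1 c d a \<Longrightarrow> test1 c' d' b \<Longrightarrow>
      (LBINT p. ind ({c..d} \<times> {c'..d'}) p * (v p * tensor (deriv a) (deriv b) p)) =
      (LBINT p. g p * tensor a b p)"
    and x: "c \<le> x1" "x1 \<le> x2" "x2 \<le> d" and y: "c' \<le> y1" "y1 \<le> y2" "y2 \<le> d'"
  shows "v (x2, y2) - v (x1, y2) - v (x2, y1) + v (x1, y1)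
    = (LBINT p. ind ({x1..x2} \<times> {y1..y2}) p * g p)"
proof -
  have [measurable]: "g \<in> borel_measurable borel" using g by (auto dest: borel_measurable_integrable)
  have vy: "continuous_on {c'..d'} (\<lambda>y. v (x, y))" if "x \<in> {c..d}" for x
    by (rule continuous_on_compose2[OF v]) (use that in \<open>auto intro!: continuous_intros\<close>)
  have igx: "integrable lborel (\<lambda>p. ind {x1..x2} (fst p) * g p)"
    using integrable_mult_bounded[OF g, of "\<lambda>p. ind {x1..x2} (fst p)" 1]
    by (simp add: mult.commute[of "g _"])
  define P where "P y = (LBINT x. ind {x1..x2} x * g (x, y))" for y
  have iP: "integrable lborel P"
    using lborel_fubini(4)[OF igx] by (simp add: P_def[abs_def])
  define F where "F y = v (x2, y) - v (x1, y)" for y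
  have F: "continuous_on {c'..d'} F" unfolding F_def[abs_def] using x by (intro continuous_intros vy) auto
  have main: "F y2 - F y1 = (LBINT y. ind {y1..y2} y * P y)"
  proof (rule weak_primitive[OF cd(2) F iP _ y])
    fix b assume b: "test1 c' d' b"
    have [measurable]: "b \<in> borel_measurable borel" by (rule test1_measurable[OF b])
    obtain B where B: "\<And>x. \<bar>b x\<bar> \<le> B" using test1_bounded[OF b] by blast
    note sb = test1_smooth[OF b] smooth1_deriv[OF test1_smooth[OF b]]
    define V where "V x = (LBINT y. ind {c'..d'} y * (v (x, y) * deriv b y))" for x
    have cvb: "continuous_on ({c..d} \<times> {c'..d'}) (\<lambda>p. v p * deriv b (snd p))"
      by (intro continuous_intros v continuous_on_compose2[OF smooth1_continuous[OF sb(2), of UNIV]]) auto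
    have V: "continuous_on {c..d} V"
      unfolding V_def[abs_def] using continuous_on_section_integral[OF cvb] by simp
    have igb: "integrable lborel (\<lambda>p. g p * b (snd p))"
      by (rule integrable_mult_bounded[OF g _ B]) measurable
    define G where "G x = (LBINT y. g (x, y) * b y)" for x
    have iG: "integrable lborel G" using lborel_fubini(3)[OF igb] by (simp add: G_def[abs_def])
    \<comment> \<open>Inner application, in \<open>x\<close>, with the test \<open>b\<close>
      frozen.\<close>
    have 1: "V x2 - V x1 = (LBINT x. ind {x1..x2} x * (- G x))"
    proof (rule weak_primitive[OF cd(1) V _ _ x])
      show "integrable lborel (\<lambda>x. - G x)" using iG by simp
      fix a assume a: "test1 c d a"
      have [measurable]: "a \<in> borel_measurable borel" by (rule test1_measurable[OF a])
      obtain A where A: "\<And>x. \<bar>a x\<bar> \<le> A" using test1_bounded[OF a] by blast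
      note sa = test1_smooth[OF a] smooth1_deriv[OF test1_smooth[OF a]]
      have "continuous_on ({c..d} \<times> {c'..d'}) (\<lambda>p. v p * tensor (deriv a) (deriv b) p)"
        unfolding tensor_def
        by (intro continuous_intros v continuous_on_compose2[OF smooth1_continuous[OF sb(2), of UNIV]]
             continuous_on_compose2[OF smooth1_continuous[OF sa(2), of UNIV]]) auto
      note i1 = integrable_continuous_rect[OF this]
      have "(LBINT x. ind {c..d} x * (V x * deriv a x))
        = (LBINT x. LBINT y. ind ({c..d} \<times> {c'..d'}) (x, y) * (v (x, y) * tensor (deriv a) (deriv b) (x, y)))"
      proof (rule Bochner_Integration.integral_cong)
        fix x
        have "(LBINT y. ind ({c..d} \<times> {c'..d'}) (x, y) * (v (x, y) * tensor (deriv a) (deriv b) (x, y)))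
          = (LBINT y. (ind {c..d} x * deriv a x) * (ind {c'..d'} y * (v (x, y) * deriv b y)))"
          by (intro Bochner_Integration.integral_cong) (auto simp: indicator_def tensor_def)
        then show "ind {c..d} x * (V x * deriv a x) = (LBINT y. ind ({c..d} \<times> {c'..d'}) (x, y) * (v (x, y) * tensor (deriv a) (deriv b) (x, y)))"
          by (simp add: V_def)
      qed simp
      also have "\<dots> = (LBINT p. g p * tensor a b p)"
        unfolding lborel_fubini(1)[OF i1] by (rule weak[OF a b])
      also have "\<dots> = (LBINT p. g p * b (snd p) * a (fst p))"
        by (simp add: tensor_def mult_ac)
      also have "\<dots> = (LBINT x. LBINT y. g (x, y) * b y * a x)"
        using lborel_fubini(1)[OF integrable_mult_bounded[OF igb, of "\<lambda>p. a (fst p)" A]] A by simp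
      also have "\<dots> = (LBINT x. G x * a x)" by (simp add: G_def)
      finally show "(LBINT x. ind {c..d} x * (V x * deriv a x)) = - (LBINT x. - G x * a x)" by simp
    qed
    have "(LBINT y. ind {c'..d'} y * (F y * deriv b y)) = V x2 - V x1"
    proof -
      have "integrable lborel (\<lambda>y. ind {c'..d'} y * (v (x, y) * deriv b y))" if "x \<in> {c..d}" for x
        by (intro integrable_continuous_Icc continuous_intros vy that smooth1_continuous sb)
      from Bochner_Integration.integral_diff[OF this[of x2] this[of x1]] x
      show ?thesis by (simp add: V_def F_def algebra_simps)
    qed
    also have "\<dots> = - (LBINT x. LBINT y. ind {x1..x2} x * g (x, y) * b y)"
      unfolding 1 by (simp add: G_def mult.assoc)
    also have "\<dots> = - (LBINT y. LBINT x. ind {x1..x2} x * g (x, y) * b y)"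
      using lborel_fubini(1,2)[OF integrable_mult_bounded[OF igx, of "\<lambda>p. b (snd p)" B]] B by simp
    also have "\<dots> = - (LBINT y. P y * b y)" by (simp add: P_def)
    finally show "(LBINT y. ind {c'..d'} y * (F y * deriv b y)) = - (LBINT y. P y * b y)" .
  qed
  have ig: "integrable lborel (\<lambda>p. ind ({x1..x2} \<times> {y1..y2}) p * g p)"
    using integrable_mult_indicator[OF _ g, of "{x1..x2} \<times> {y1..y2}"] by (simp add: borel_closed closed_Times)
  have "(LBINT p. ind ({x1..x2} \<times> {y1..y2}) p * g p)
    = (LBINT y. LBINT x. ind {y1..y2} y * (ind {x1..x2} x * g (x, y)))"
    unfolding lborel_fubini(2)[OF ig, symmetric]
    by (intro Bochner_Integration.integral_cong) (auto simp: indicator_def)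
  also have "\<dots> = F y2 - F y1" using main by (simp add: P_def)
  finally show ?thesis by (simp add: F_def)
qed

text \<open>Boxes form an intersection-stable generator of the Borel sets, so the vanishing spreads
  to all of them by induction over complements and disjoint unions. The support condition makes the
  total integral a box integral, as the complement step requires.\<close>

lemma AE_zero_if_box_integrals_zero:
  fixes g :: "'a::euclidean_space \<Rightarrow> real"
  assumes g: "integrable lborel g" and z: "\<And>a b. (LBINT p. ind (box a b) p * g p) = 0"
    and supp: "\<And>p. p \<notin> box a0 b0 \<Longrightarrow> g p = 0"
  shows "AE p in lborel. g p = 0"
proof (rule density_unique_real[OF g, of "\<lambda>_. 0"])
  show "integrable lborel (\<lambda>_. 0::real)" by simp
  fix A :: "'a set" assume "A \<in> sets lborel"
  have "Int_stable (range (\<lambda>(a, b). box a (b::'a)))"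
    by (auto simp: Int_stable_def box_Int_box)
  moreover have "range (\<lambda>(a, b). box a (b::'a)) \<subseteq> Pow UNIV" by simp
  moreover have "A \<in> sigma_sets UNIV (range (\<lambda>(a, b). box a b))"
    using \<open>A \<in> sets lborel\<close> by (simp add: borel_eq_box)
  ultimately have "(LBINT p:A. g p) = 0"
  proof (induction rule: sigma_sets_induct_disjoint)
    case (basic A)
    then show ?case using z by (auto simp: set_lebesgue_integral_def)
  next
    case empty
    then show ?case by (simp add: set_lebesgue_integral_def)
  next
    case (compl A)
    have "A \<in> sets lborel" using compl(1) by (simp add: borel_eq_box)
    have tot: "(LBINT p:UNIV. g p) = 0"
    proof -
      have "(\<lambda>p. ind (box a0 b0) p * g p) = g"
      proof
        show "ind (box a0 b0) p * g p = g p" for p using supp[of p] by (cases "p \<in> box a0 b0") auto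
      qed
      then show ?thesis using z[of a0 b0] by (simp add: set_lebesgue_integral_def)
    qed
    have "(LBINT p:UNIV - A. g p) = (LBINT p. g p - ind A p *\<^sub>R g p)"
      unfolding set_lebesgue_integral_def
      by (intro Bochner_Integration.integral_cong) (auto simp: indicator_def)
    also have "\<dots> = (LBINT p:UNIV. g p) - (LBINT p:A. g p)"
      using integrable_mult_indicator[OF \<open>A \<in> sets lborel\<close> g] g
      by (simp add: set_lebesgue_integral_def)
    finally show ?case using tot compl(2) by simp
  next
    case (union A)
    have A: "A i \<in> sets lborel" for i using union(2) by (auto simp: borel_eq_box)
    have "set_integrable lborel (\<Union>i. A i) g"
      unfolding set_integrable_def using A by (intro integrable_mult_indicator g sets.countable_UN) auto
    then have "(LBINT p:(\<Union>i. A i). g p) = (\<Sum>i. LBINT p:A i. g p)"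
      by (intro lebesgue_integral_countable_add A) (use union(1) in \<open>auto simp: disjoint_family_on_def\<close>)
    then show ?case using union(3) by simp
  qed
  then show "(LBINT p:A. g p) = (LBINT p:A. 0)" by simp
qed

lemma AE_cbox_box: "AE p in lborel. p \<notin> cbox a b - box a (b::'a::euclidean_space)"
proof -
  have "emeasure lborel (cbox a b - box a b) = emeasure lborel (cbox a b) - emeasure lborel (box a b)"
    by (rule emeasure_Diff) (auto simp: box_subset_cbox emeasure_lborel_box_eq)
  also have "\<dots> = 0" by (simp add: emeasure_lborel_box_eq emeasure_lborel_cbox_eq)
  finally have "cbox a b - box a b \<in> null_sets lborel" by auto
  then show ?thesis by (rule AE_not_in)
qed

text \<open>The rectangle formula with \<open>v = 0\<close> shows that all integrals of \<open>g\<close> over rectangles vanish.\<close>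

lemma weak_zero_AE:
  fixes g :: "real \<times> real \<Rightarrow> real"
  assumes cd: "c < d" "c' < d'" and g: "integrable lborel g"
    and supp: "\<And>p. p \<notin> {c..d} \<times> {c'..d'} \<Longrightarrow> g p = 0"
    and weak: "\<And>a b. test1 c d a \<Longrightarrow> test1 c' d' b \<Longrightarrow> (LBINT p. g p * tensor a b p) = 0"
  shows "AE p in lborel. g p = 0"
\<comment> \<open>The support is a closed rectangle, hence the margin 1 for the open box containing
  it.\<close>
proof (rule AE_zero_if_box_integrals_zero[OF g, where ?a0.0="(c-1,c'-1)" and ?b0.0="(d+1,d'+1)"])
  have R: "(LBINT p. ind ({x1..x2} \<times> {y1..y2}) p * g p) = 0"
    if "c \<le> x1" "x1 \<le> x2" "x2 \<le> d" "c' \<le> y1" "y1 \<le> y2" "y2 \<le> d'" for x1 x2 y1 y2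
    using rectangle_difference[OF cd _ g _ that, of "\<lambda>_. 0"] weak by simp
  fix a b :: "real \<times> real"
  obtain a1 a2 b1 b2 where ab: "a = (a1, a2)" "b = (b1, b2)" by (cases a, cases b)
  \<comment> \<open>The rectangle formula applies only inside the support rectangle, so an arbitrary
    box is cut down to it; their boundaries differ by a null set.\<close>
  define x1 x2 y1 y2 where d: "x1 = max c a1" "x2 = min d b1" "y1 = max c' a2" "y2 = min d' b2"
  have "(LBINT p. ind (box a b) p * g p) = (LBINT p. ind ({x1..x2} \<times> {y1..y2}) p * g p)"
  proof (rule integral_cong_AE)
    have [measurable]: "g \<in> borel_measurable borel" using g by (auto dest: borel_measurable_integrable)
    show "(\<lambda>p. ind (box a b) p * g p) \<in> borel_measurable lborel" by measurable
    have [measurable]: "{x1..x2} \<times> {y1..y2} \<in> sets borel" by (intro borel_closed closed_Times closed_atLeastAtMost)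
    show "(\<lambda>p. ind ({x1..x2} \<times> {y1..y2}) p * g p) \<in> borel_measurable lborel" by measurable
    show "AE p in lborel. ind (box a b) p * g p = ind ({x1..x2} \<times> {y1..y2}) p * g p"
      using AE_cbox_box[of a b]
    proof eventually_elim
      case (elim p)
      show ?case
      proof (cases "p \<in> {c..d} \<times> {c'..d'}")
        case True
        have "p \<in> cbox a b \<longleftrightarrow> p \<in> {x1..x2} \<times> {y1..y2}"
          using True by (auto simp: ab d cbox_Pair_eq)
        then show ?thesis using elim box_subset_cbox[of a b] by (auto simp: indicator_def)
      qed (use supp in auto)
    qed
  qed
  also have "\<dots> = 0"
    by (cases "x1 \<le> x2 \<and> y1 \<le> y2") (use R in \<open>auto simp: d\<close>)
  finally show "(LBINT p. ind (box a b) p * g p) = 0" .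
next
  fix p assume "p \<notin> box (c-1,c'-1) (d+1,d'+1)"
  then show "g p = 0" using supp[of p] by (cases p) (force simp: mem_box Basis_prod_def)
qed

section \<open>Weak derivatives\<close>

lemma test_fun_pds_continuous:
  assumes "test_fun U \<phi>" "set ds \<subseteq> {e1, e2}"
  shows "continuous_on A (pds ds \<phi>)"
  using assms unfolding test_fun_def smooth_def
  by (meson continuous_at_imp_continuous_on differentiable_imp_continuous_within)

lemma pds_outside_support:
  assumes "p \<notin> closure {p. \<phi> p \<noteq> 0}"
  shows "pds ds \<phi> p = 0"
  using assms
proof (induction ds arbitrary: p)
  case Nil
  then show ?case using closure_subset by force
next
  case (Cons d ds)
  let ?S = "closure {p. \<phi> p \<noteq> 0}"
  have "((\<lambda>t. p + t *\<^sub>R d) \<longlongrightarrow> p + 0 *\<^sub>R d) (nhds 0)"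
    by (intro tendsto_intros filterlim_ident)
  then have "\<forall>\<^sub>F t in nhds 0. p + t *\<^sub>R d \<in> - ?S"
    using Cons.prems by (intro topological_tendstoD) auto
  then have "\<forall>\<^sub>F t in nhds 0. pds ds \<phi> (p + t *\<^sub>R d) = (0::real)"
    by eventually_elim (use Cons.IH in auto)
  then have "((\<lambda>t. pds ds \<phi> (p + t *\<^sub>R d)) has_real_derivative 0) (at 0)"
    using DERIV_cong_ev[OF refl _ refl, of "\<lambda>t. pds ds \<phi> (p + t *\<^sub>R d)" "\<lambda>_. 0" 0] by simp
  then show ?case by (simp add: pd_def DERIV_imp_deriv)
qed

lemma test_fun_pds_0:
  "test_fun U \<phi> \<Longrightarrow> p \<notin> U \<Longrightarrow> pds ds \<phi> p = 0"
  by (rule pds_outside_support) (auto simp: test_fun_def)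

lemma test_fun_pds_bounded:
  assumes "test_fun U \<phi>" "set ds \<subseteq> {e1, e2}"
  obtains B where "\<And>p. \<bar>pds ds \<phi> p\<bar> \<le> B"
proof -
  let ?S = "closure {p. \<phi> p \<noteq> 0}"
  have "compact (pds ds \<phi> ` ?S)"
    using assms(1) by (intro compact_continuous_image test_fun_pds_continuous[OF assms]) (simp add: test_fun_def)
  then obtain B where "B > 0" "\<And>p. p \<in> ?S \<Longrightarrow> \<bar>pds ds \<phi> p\<bar> \<le> B"
    using compact_imp_bounded bounded_pos by (metis image_eqI real_norm_def)
  then have "\<bar>pds ds \<phi> p\<bar> \<le> B" for p
    using pds_outside_support[of p \<phi> ds] by (cases "p \<in> ?S") auto
  then show ?thesis using that by blast
qed

lemma set_replicate_e: "set (replicate i e1 @ replicate j e2) \<subseteq> {e1, e2}"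
  by auto

lemma Dmulti_test:
  assumes "test_fun U \<phi>"
  shows "Dmulti i j \<phi> \<in> borel_measurable borel" "p \<notin> U \<Longrightarrow> Dmulti i j \<phi> p = 0"
    and "\<exists>B. \<forall>p. \<bar>Dmulti i j \<phi> p\<bar> \<le> B"
  unfolding Dmulti_def
  using test_fun_pds_continuous[OF assms set_replicate_e] test_fun_pds_0[OF assms]
    test_fun_pds_bounded[OF assms set_replicate_e]
  by (blast intro: borel_measurable_continuous_onI)+

lemma Dmulti_0_0 [simp]: "Dmulti 0 0 \<phi> = \<phi>" by (simp add: Dmulti_def)

lemma test_fun_bounds:
  assumes "test_fun U \<phi>"
  shows "\<phi> \<in> borel_measurable borel" "p \<notin> U \<Longrightarrow> \<phi> p = 0" "\<exists>B. \<forall>p. \<bar>\<phi> p\<bar> \<le> B"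
  using Dmulti_test(1)[OF assms, of 0 0] Dmulti_test(2)[OF assms, of p 0 0] Dmulti_test(3)[OF assms, of 0 0]
  unfolding Dmulti_0_0 by auto

section \<open>Square integrable functions and the Cauchy-Schwarz inequality\<close>

definition sq_integrable :: "('a::euclidean_space \<Rightarrow> real) \<Rightarrow> bool" where
  "sq_integrable f \<longleftrightarrow> f \<in> borel_measurable borel \<and> integrable lborel (\<lambda>p. (f p)\<^sup>2)"

lemma sq_integrable_mult:
  assumes "sq_integrable f" "sq_integrable g"
  shows "integrable lborel (\<lambda>p. f p * g p)"
proof (rule Bochner_Integration.integrable_bound[where f="\<lambda>p. (f p)\<^sup>2 + (g p)\<^sup>2"])
  have [measurable]: "f \<in> borel_measurable borel" "g \<in> borel_measurable borel"
    using assms by (auto simp: sq_integrable_def)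
  show "(\<lambda>p. f p * g p) \<in> borel_measurable lborel" by measurable
  show "integrable lborel (\<lambda>p. (f p)\<^sup>2 + (g p)\<^sup>2)" using assms by (auto simp: sq_integrable_def)
  have "2 * \<bar>f p * g p\<bar> \<le> (f p)\<^sup>2 + (g p)\<^sup>2" for p
    using sum_squares_bound[of "\<bar>f p\<bar>" "\<bar>g p\<bar>"] by (simp add: abs_mult)
  then show "AE p in lborel. norm (f p * g p) \<le> norm ((f p)\<^sup>2 + (g p)\<^sup>2)"
    by (intro AE_I2) (smt (verit) real_norm_def)
qed

lemma sq_integrable_lincomb:
  assumes "sq_integrable f" "sq_integrable g"
  shows "sq_integrable (\<lambda>p. a * f p + b * g p)"
proof -
  have [measurable]: "f \<in> borel_measurable borel" "g \<in> borel_measurable borel"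
    using assms by (auto simp: sq_integrable_def)
  have "(\<lambda>p. (a * f p + b * g p)\<^sup>2) = (\<lambda>p. a^2 * (f p)\<^sup>2 + b^2 * (g p)\<^sup>2 + 2 * a * b * (f p * g p))"
    by (auto simp: power2_eq_square algebra_simps)
  moreover have "integrable lborel (\<lambda>p. a^2 * (f p)\<^sup>2 + b^2 * (g p)\<^sup>2 + 2 * a * b * (f p * g p))"
    using assms sq_integrable_mult[OF assms] by (auto simp: sq_integrable_def)
  ultimately show ?thesis by (simp add: sq_integrable_def)
qed

lemma Cauchy_Schwarz_integral:
  assumes "sq_integrable f" "sq_integrable g"
  shows "\<bar>LBINT p. f p * g p\<bar> \<le> sqrt (LBINT p. (f p)\<^sup>2) * sqrt (LBINT p. (g p)\<^sup>2)"
proof -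
  have [measurable]: "f \<in> borel_measurable borel" "g \<in> borel_measurable borel"
    using assms by (auto simp: sq_integrable_def)
  have fin: "(\<integral>\<^sup>+p. ennreal \<bar>f p\<bar> ^ 2 \<partial>lborel) = ennreal (LBINT p. (f p)\<^sup>2)" if "sq_integrable f" for f :: "'a \<Rightarrow> real"
    using that by (subst nn_integral_eq_integral[symmetric]) (auto simp: sq_integrable_def ennreal_power)
  have i: "integrable lborel (\<lambda>p. \<bar>f p\<bar> * \<bar>g p\<bar>)" using integrable_abs[OF sq_integrable_mult[OF assms]] by (simp add: abs_mult)
  have "(\<integral>\<^sup>+p. ennreal \<bar>f p\<bar> * ennreal \<bar>g p\<bar> \<partial>lborel)\<^sup>2 \<le> (\<integral>\<^sup>+p. ennreal \<bar>f p\<bar> ^ 2 \<partial>lborel) * (\<integral>\<^sup>+p. ennreal \<bar>g p\<bar> ^ 2 \<partial>lborel)"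
    by (rule Cauchy_Schwarz_nn_integral) measurable
  also have "(\<integral>\<^sup>+p. ennreal \<bar>f p\<bar> * ennreal \<bar>g p\<bar> \<partial>lborel) = ennreal (LBINT p. \<bar>f p\<bar> * \<bar>g p\<bar>)"
    using i by (subst nn_integral_eq_integral[symmetric]) (auto simp: ennreal_mult)
  finally have "(LBINT p. \<bar>f p\<bar> * \<bar>g p\<bar>)\<^sup>2 \<le> (LBINT p. (f p)\<^sup>2) * (LBINT p. (g p)\<^sup>2)"
    using fin[OF assms(1)] fin[OF assms(2)]
    by (simp add: ennreal_power flip: ennreal_mult)
  then have "(LBINT p. \<bar>f p\<bar> * \<bar>g p\<bar>) \<le> sqrt (LBINT p. (f p)\<^sup>2) * sqrt (LBINT p. (g p)\<^sup>2)"
    by (simp add: real_le_rsqrt flip: real_sqrt_mult)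
  moreover have "\<bar>LBINT p. f p * g p\<bar> \<le> (LBINT p. \<bar>f p\<bar> * \<bar>g p\<bar>)"
    using integral_abs_bound[of lborel "\<lambda>p. f p * g p"] by (simp add: abs_mult)
  ultimately show ?thesis by linarith
qed

text \<open>Extension by zero, so that all integrals run over the whole plane.\<close>

definition zext :: "real \<Rightarrow> (real \<times> real \<Rightarrow> real) \<Rightarrow> real \<times> real \<Rightarrow> real" where
  "zext l g p = ind (Omega l) p * g p"

lemma zext_0: "p \<notin> Omega l \<Longrightarrow> zext l g p = 0" by (simp add: zext_def)

lemma Omega_sets [measurable]: "Omega l \<in> sets borel"
  unfolding Omega_def by (intro borel_open open_Times) auto

lemma L2_iff: "L2 (Omega l) g \<longleftrightarrow> sq_integrable (zext l g)"
proof -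
  have "(\<lambda>p. (zext l g p)\<^sup>2) = (\<lambda>p. ind (Omega l) p *\<^sub>R (g p)\<^sup>2)" by (auto simp: zext_def indicator_def)
  then show ?thesis
    by (simp add: L2_def sq_integrable_def set_borel_measurable_def set_integrable_def zext_def[abs_def])
qed

lemma sq_integrable_indicator:
  assumes "A \<in> sets borel" "emeasure lborel A < \<infinity>"
  shows "sq_integrable (ind A)"
proof -
  have "(\<lambda>p. (ind A p)\<^sup>2) = (ind A)" by (auto simp: indicator_def)
  then show ?thesis using assms by (simp add: sq_integrable_def)
qed

lemma emeasure_bounded_lt: "bounded A \<Longrightarrow> emeasure lborel A < \<infinity>"
  by (rule emeasure_bounded_finite)

lemma bounded_Omega: "bounded (Omega l)"
  unfolding Omega_def by (intro bounded_Times) auto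

text \<open>Pair \<open>f\<close> with the indicator of \<open>A\<close>, which is square integrable
  as \<open>A\<close> has finite measure.\<close>

lemma sq_integrable_supp_integrable:
  assumes "sq_integrable f" "bounded A" "A \<in> sets borel" "\<And>p. p \<notin> A \<Longrightarrow> f p = 0"
  shows "integrable lborel f"
proof -
  have "(\<lambda>p. ind A p * f p) = f"
  proof
    show "ind A p * f p = f p" for p using assms(4)[of p] by (cases "p \<in> A") auto
  qed
  with sq_integrable_mult[OF sq_integrable_indicator[OF assms(3) emeasure_bounded_lt[OF assms(2)]] assms(1)]
  show ?thesis by simp
qed

lemma zext_integrable: "L2 (Omega l) g \<Longrightarrow> integrable lborel (zext l g)"
  by (rule sq_integrable_supp_integrable[OF _ bounded_Omega Omega_sets, of _ l]) (auto simp: L2_iff zext_0)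

lemma set_integral_zext:
  assumes "\<And>p. p \<notin> Omega l \<Longrightarrow> \<psi> p = 0"
  shows "(LBINT p:Omega l. g p * \<psi> p) = (LBINT p. zext l g p * \<psi> p)"
    and "set_integrable lborel (Omega l) (\<lambda>p. g p * \<psi> p) \<longleftrightarrow> integrable lborel (\<lambda>p. zext l g p * \<psi> p)"
proof -
  have "(\<lambda>p. ind (Omega l) p *\<^sub>R (g p * \<psi> p)) = (\<lambda>p. zext l g p * \<psi> p)" by (auto simp: zext_def)
  then show "(LBINT p:Omega l. g p * \<psi> p) = (LBINT p. zext l g p * \<psi> p)"
    "set_integrable lborel (Omega l) (\<lambda>p. g p * \<psi> p) \<longleftrightarrow> integrable lborel (\<lambda>p. zext l g p * \<psi> p)"
    by (simp_all add: set_lebesgue_integral_def set_integrable_def)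
qed

section \<open>Uniqueness and linearity of weak derivatives\<close>

lemma integrable_zext_Dmulti:
  assumes "L2 (Omega l) v" "test_fun (Omega l) \<phi>"
  shows "integrable lborel (\<lambda>p. zext l v p * Dmulti i j \<phi> p)"
  using integrable_mult_bounded[OF zext_integrable[OF assms(1)]] Dmulti_test(1,3)[OF assms(2), of i j] by auto

text \<open>The integrability clauses of \<open>weak_deriv\<close> hold automatically for
  \<open>L2\<close> functions: on the bounded domain these are integrable, and test functions have
  bounded derivatives.\<close>

lemma weak_deriv_iff:
  assumes "L2 (Omega l) v" "L2 (Omega l) g"
  shows "weak_deriv (Omega l) v i j g \<longleftrightarrow> (\<forall>\<phi>. test_fun (Omega l) \<phi> \<longrightarrow>
    (LBINT p. zext l v p * Dmulti i j \<phi> p) = (-1) ^ (i + j) * (LBINT p. zext l g p * \<phi> p))"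
proof -
  have F: "(LBINT p:Omega l. v p * Dmulti i j \<phi> p) = (LBINT p. zext l v p * Dmulti i j \<phi> p)"
    "(LBINT p:Omega l. g p * \<phi> p) = (LBINT p. zext l g p * \<phi> p)"
    "set_integrable lborel (Omega l) (\<lambda>p. v p * Dmulti i j \<phi> p)"
    "set_integrable lborel (Omega l) (\<lambda>p. g p * \<phi> p)" if T: "test_fun (Omega l) \<phi>" for \<phi>
    using set_integral_zext[of l "Dmulti i j \<phi>", OF Dmulti_test(2)[OF T]]
      set_integral_zext[of l \<phi>, OF test_fun_bounds(2)[OF T]]
      integrable_zext_Dmulti[OF assms(1) T, of i j] integrable_zext_Dmulti[OF assms(2) T, of 0 0]
    by auto
  then show ?thesis unfolding weak_deriv_def by (simp cong: imp_cong)
qed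

text \<open>Products a(x) b(y) already separate integrable functions, so the difference is tested
  with them alone.\<close>

lemma weak_deriv_unique:
  assumes l: "l > 0" and "L2 (Omega l) g" "L2 (Omega l) h"
    and "weak_deriv (Omega l) v i j g" "weak_deriv (Omega l) v i j h"
  shows "AE p in lborel. zext l g p = zext l h p"
proof -
  have "AE p in lborel. zext l g p - zext l h p = 0"
  proof (rule weak_zero_AE[of 0 pi "-l" l])
    show "integrable lborel (\<lambda>p. zext l g p - zext l h p)"
      using assms by (intro Bochner_Integration.integrable_diff zext_integrable)
    show "zext l g p - zext l h p = 0" if "p \<notin> {0..pi} \<times> {- l..l}" for p
      using that by (subst (1 2) zext_0) (auto simp: Omega_def)
    fix a b assume "test1 0 pi a" "test1 (-l) l b"
    then have T: "test_fun (Omega l) (tensor a b)" by (rule test_fun_tensor)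
    note e = set_integral_zext[OF test_fun_bounds(2)[OF T]]
    have "(-1) ^ (i + j) * (LBINT p:Omega l. g p * tensor a b p) = (-1) ^ (i + j) * (LBINT p:Omega l. h p * tensor a b p)"
      using assms(4,5)[unfolded weak_deriv_def, rule_format, OF T] by simp
    then have "(LBINT p. zext l g p * tensor a b p) = (LBINT p. zext l h p * tensor a b p)"
      by (simp add: e)
    moreover have "integrable lborel (\<lambda>p. zext l g p * tensor a b p)" "integrable lborel (\<lambda>p. zext l h p * tensor a b p)"
      using integrable_zext_Dmulti[OF _ T, of _ 0 0] assms by auto
    ultimately show "(LBINT p. (zext l g p - zext l h p) * tensor a b p) = 0"
      by (simp add: left_diff_distrib)
  qed (use l in auto)
  then show ?thesis by simp
qed

lemma wd_props:
  assumes "H2 (Omega l) v" "i + j \<le> 2"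
  shows "weak_deriv (Omega l) v i j (wd (Omega l) i j v)" "L2 (Omega l) (wd (Omega l) i j v)"
proof -
  have "\<exists>g. weak_deriv (Omega l) v i j g \<and> L2 (Omega l) g" using assms by (auto simp: H2_def)
  from someI_ex[OF this] show "weak_deriv (Omega l) v i j (wd (Omega l) i j v)" "L2 (Omega l) (wd (Omega l) i j v)"
    by (auto simp: wd_def)
qed

lemma zext_lincomb: "zext l (\<lambda>p. a * u p + b * v p) = (\<lambda>p. a * zext l u p + b * zext l v p)"
  by (auto simp: zext_def algebra_simps)

lemma L2_lincomb: "L2 (Omega l) u \<Longrightarrow> L2 (Omega l) v \<Longrightarrow> L2 (Omega l) (\<lambda>p. a * u p + b * v p)"
  by (simp add: L2_iff zext_lincomb sq_integrable_lincomb)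

lemma weak_deriv_lincomb:
  assumes "L2 (Omega l) u" "L2 (Omega l) v" "L2 (Omega l) g" "L2 (Omega l) h"
    and "weak_deriv (Omega l) u i j g" "weak_deriv (Omega l) v i j h"
  shows "weak_deriv (Omega l) (\<lambda>p. a * u p + b * v p) i j (\<lambda>p. a * g p + b * h p)"
proof -
  have "(LBINT p. zext l (\<lambda>p. a * u p + b * v p) p * Dmulti i j \<phi> p)
    = (-1) ^ (i + j) * (LBINT p. zext l (\<lambda>p. a * g p + b * h p) p * \<phi> p)" if T: "test_fun (Omega l) \<phi>" for \<phi>
  proof -
    have "(LBINT p. zext l (\<lambda>p. a * u p + b * v p) p * Dmulti i j \<phi> p)
      = (LBINT p. a * (zext l u p * Dmulti i j \<phi> p) + b * (zext l v p * Dmulti i j \<phi> p))"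
      by (simp add: zext_lincomb algebra_simps)
    also have "\<dots> = a * (LBINT p. zext l u p * Dmulti i j \<phi> p) + b * (LBINT p. zext l v p * Dmulti i j \<phi> p)"
      using integrable_zext_Dmulti[OF _ T] assms by (subst Bochner_Integration.integral_add) auto
    also have "\<dots> = (-1) ^ (i + j) * (a * (LBINT p. zext l g p * \<phi> p) + b * (LBINT p. zext l h p * \<phi> p))"
      using assms T weak_deriv_iff[of l u g] weak_deriv_iff[of l v h] by (simp add: algebra_simps)
    also have "a * (LBINT p. zext l g p * \<phi> p) + b * (LBINT p. zext l h p * \<phi> p)
      = (LBINT p. a * (zext l g p * \<phi> p) + b * (zext l h p * \<phi> p))"
      using integrable_zext_Dmulti[OF _ T, of _ 0 0] assms by (subst Bochner_Integration.integral_add) auto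
    also have "\<dots> = (LBINT p. zext l (\<lambda>p. a * g p + b * h p) p * \<phi> p)"
      by (simp add: zext_lincomb algebra_simps)
    finally show ?thesis .
  qed
  then show ?thesis
    unfolding weak_deriv_iff[OF L2_lincomb[OF assms(1,2)] L2_lincomb[OF assms(3,4)]] by blast
qed

lemma H2_lincomb:
  assumes "H2 (Omega l) u" "H2 (Omega l) v"
  shows "H2 (Omega l) (\<lambda>p. a * u p + b * v p)"
  unfolding H2_def
proof (intro conjI allI impI)
  show "L2 (Omega l) (\<lambda>p. a * u p + b * v p)" using assms by (auto simp: H2_def intro!: L2_lincomb)
  fix i j :: nat assume "i + j \<le> 2"
  then show "\<exists>g. weak_deriv (Omega l) (\<lambda>p. a * u p + b * v p) i j g \<and> L2 (Omega l) g"
    using wd_props[OF assms(1)] wd_props[OF assms(2)] assms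
    by (intro exI[of _ "\<lambda>p. a * wd (Omega l) i j u p + b * wd (Omega l) i j v p"] conjI weak_deriv_lincomb L2_lincomb)
       (auto simp: H2_def)
qed

text \<open>Since \<open>wd\<close> is a choice, this is determined only up to null sets; every
  identity between such functions of different arguments is therefore an almost everywhere
  statement.\<close>

definition Dx :: "real \<Rightarrow> nat \<Rightarrow> nat \<Rightarrow> (real \<times> real \<Rightarrow> real) \<Rightarrow> real \<times> real \<Rightarrow> real" where
  "Dx l i j v = zext l (wd (Omega l) i j v)"

lemma Dx_sq: "H2 (Omega l) v \<Longrightarrow> i + j \<le> 2 \<Longrightarrow> sq_integrable (Dx l i j v)"
  using wd_props by (auto simp: Dx_def L2_iff)

lemma Dx_AE:
  assumes "l > 0" "H2 (Omega l) v" "i + j \<le> 2" "weak_deriv (Omega l) v i j g" "L2 (Omega l) g"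
  shows "AE p in lborel. Dx l i j v p = zext l g p"
  unfolding Dx_def by (rule weak_deriv_unique[OF assms(1) wd_props(2)[OF assms(2,3)] assms(5) wd_props(1)[OF assms(2,3)] assms(4)])

lemma Dx_lincomb:
  assumes "l > 0" "H2 (Omega l) u" "H2 (Omega l) v" "i + j \<le> 2"
  shows "AE p in lborel. Dx l i j (\<lambda>p. a * u p + b * v p) p = a * Dx l i j u p + b * Dx l i j v p"
proof -
  have "AE p in lborel. Dx l i j (\<lambda>p. a * u p + b * v p) p = zext l (\<lambda>p. a * wd (Omega l) i j u p + b * wd (Omega l) i j v p) p"
    using assms wd_props
    by (intro Dx_AE H2_lincomb weak_deriv_lincomb L2_lincomb) (auto simp: H2_def)
  then show ?thesis by (simp add: zext_lincomb Dx_def)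
qed

section \<open>The energy form and its comparison with the second derivatives\<close>

definition qf :: "real \<Rightarrow> real \<Rightarrow> (real \<times> real \<Rightarrow> real) \<Rightarrow> (real \<times> real \<Rightarrow> real) \<Rightarrow> real \<times> real \<Rightarrow> real" where
  "qf l \<sigma> u v p = (Dx l 2 0 u p + Dx l 0 2 u p) * (Dx l 2 0 v p + Dx l 0 2 v p)
      + (1 - \<sigma>) * (2 * Dx l 1 1 u p * Dx l 1 1 v p - Dx l 2 0 u p * Dx l 0 2 v p - Dx l 0 2 u p * Dx l 2 0 v p)"

lemma ip_qf: "ip l \<sigma> u v = (LBINT p. qf l \<sigma> u v p)"
  unfolding ip_def set_lebesgue_integral_def
  by (intro Bochner_Integration.integral_cong) (auto simp: qf_def Dx_def zext_def indicator_def)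

lemma qf_integrable:
  assumes "H2 (Omega l) u" "H2 (Omega l) v"
  shows "integrable lborel (qf l \<sigma> u v)"
proof -
  have *: "integrable lborel (\<lambda>p. Dx l i j u p * Dx l i' j' v p)" if "i + j \<le> 2" "i' + j' \<le> 2" for i j i' j'
    by (rule sq_integrable_mult[OF Dx_sq[OF assms(1) that(1)] Dx_sq[OF assms(2) that(2)]])
  have "integrable lborel (\<lambda>p. Dx l 2 0 u p * Dx l 2 0 v p + \<sigma> * (Dx l 2 0 u p * Dx l 0 2 v p) + \<sigma> * (Dx l 0 2 u p * Dx l 2 0 v p)
     + Dx l 0 2 u p * Dx l 0 2 v p + (2 * (1 - \<sigma>)) * (Dx l 1 1 u p * Dx l 1 1 v p))"
    using *[of 2 0 2 0] *[of 2 0 0 2] *[of 0 2 2 0] *[of 0 2 0 2] *[of 1 1 1 1]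
    by (intro Bochner_Integration.integrable_add integrable_mult_right) simp_all
  moreover have "qf l \<sigma> u v p = Dx l 2 0 u p * Dx l 2 0 v p + \<sigma> * (Dx l 2 0 u p * Dx l 0 2 v p) + \<sigma> * (Dx l 0 2 u p * Dx l 2 0 v p)
     + Dx l 0 2 u p * Dx l 0 2 v p + (2 * (1 - \<sigma>)) * (Dx l 1 1 u p * Dx l 1 1 v p)" for p
    by (simp add: qf_def algebra_simps)
  ultimately show ?thesis by presburger
qed

lemma ip_sym: "ip l \<sigma> u v = ip l \<sigma> v u"
  unfolding ip_qf by (intro Bochner_Integration.integral_cong) (auto simp: qf_def algebra_simps)

lemma ip_lincomb:
  assumes l: "l > 0" and u: "H2 (Omega l) u" "H2 (Omega l) v" and w: "H2 (Omega l) w"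
  shows "ip l \<sigma> (\<lambda>p. a * u p + b * v p) w = a * ip l \<sigma> u w + b * ip l \<sigma> v w"
proof -
  have "ip l \<sigma> (\<lambda>p. a * u p + b * v p) w = (LBINT p. a * qf l \<sigma> u w p + b * qf l \<sigma> v w p)"
    unfolding ip_qf
  proof (rule integral_cong_AE)
    show "AE p in lborel. qf l \<sigma> (\<lambda>p. a * u p + b * v p) w p = a * qf l \<sigma> u w p + b * qf l \<sigma> v w p"
      using Dx_lincomb[OF l u, of 2 0 a b, simplified] Dx_lincomb[OF l u, of 1 1 a b, simplified] Dx_lincomb[OF l u, of 0 2 a b, simplified]
      by eventually_elim (simp add: qf_def algebra_simps)
    show "qf l \<sigma> (\<lambda>p. a * u p + b * v p) w \<in> borel_measurable lborel"
      using qf_integrable[OF H2_lincomb[OF u] w] by blast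
    show "(\<lambda>p. a * qf l \<sigma> u w p + b * qf l \<sigma> v w p) \<in> borel_measurable lborel"
      using qf_integrable[OF u(1) w, of \<sigma>] qf_integrable[OF u(2) w, of \<sigma>] by (auto dest!: borel_measurable_integrable)
  qed
  also have "\<dots> = a * ip l \<sigma> u w + b * ip l \<sigma> v w"
    unfolding ip_qf using qf_integrable u w by (subst Bochner_Integration.integral_add) auto
  finally show ?thesis .
qed

abbreviation hess2 :: "real \<Rightarrow> (real \<times> real \<Rightarrow> real) \<Rightarrow> real" where
  "hess2 l u \<equiv> LBINT p. (Dx l 2 0 u p)\<^sup>2 + (Dx l 1 1 u p)\<^sup>2 + (Dx l 0 2 u p)\<^sup>2"

text \<open>The integrands differ by \<sigma> times the squared Laplacian plus (1 - \<sigma>) times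
  the squared mixed derivative. Coercivity thus uses both bounds on \<sigma>.\<close>

lemma ip_lower:
  assumes "0 < \<sigma>" "\<sigma> < 1" "H2 (Omega l) u"
  shows "(1 - \<sigma>) * hess2 l u \<le> ip l \<sigma> u u"
proof -
  have i: "integrable lborel (\<lambda>p. (Dx l i j u p)\<^sup>2)" if "i + j \<le> 2" for i j
    using Dx_sq[OF assms(3) that] by (simp add: sq_integrable_def)
  have "(LBINT p. (1 - \<sigma>) * ((Dx l 2 0 u p)\<^sup>2 + (Dx l 1 1 u p)\<^sup>2 + (Dx l 0 2 u p)\<^sup>2)) \<le> (LBINT p. qf l \<sigma> u u p)"
  proof (rule integral_mono)
    show "(1 - \<sigma>) * ((Dx l 2 0 u p)\<^sup>2 + (Dx l 1 1 u p)\<^sup>2 + (Dx l 0 2 u p)\<^sup>2) \<le> qf l \<sigma> u u p" for p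
    proof -
      have "qf l \<sigma> u u p - (1 - \<sigma>) * ((Dx l 2 0 u p)\<^sup>2 + (Dx l 1 1 u p)\<^sup>2 + (Dx l 0 2 u p)\<^sup>2)
        = \<sigma> * (Dx l 2 0 u p + Dx l 0 2 u p)\<^sup>2 + (1 - \<sigma>) * (Dx l 1 1 u p)\<^sup>2"
        by (simp add: qf_def power2_eq_square algebra_simps)
      also have "\<dots> \<ge> 0" using assms by simp
      finally show ?thesis by simp
    qed
    show "integrable lborel (\<lambda>p. (1 - \<sigma>) * ((Dx l 2 0 u p)\<^sup>2 + (Dx l 1 1 u p)\<^sup>2 + (Dx l 0 2 u p)\<^sup>2))"
      by (intro integrable_mult_right Bochner_Integration.integrable_add i) auto
  qed (rule qf_integrable[OF assms(3,3)])
  then show ?thesis unfolding ip_qf Bochner_Integration.integral_mult_right_zero .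
qed

text \<open>Converts L2 convergence of the three second derivatives back into convergence in energy.
  The difference of the integrands is again a sum of squares with nonnegative weights.\<close>

lemma ip_upper:
  assumes "0 < \<sigma>" "\<sigma> < 1" "H2 (Omega l) u"
  shows "ip l \<sigma> u u \<le> 2 * hess2 l u"
proof -
  have i: "integrable lborel (\<lambda>p. (Dx l i j u p)\<^sup>2)" if "i + j \<le> 2" for i j
    using Dx_sq[OF assms(3) that] by (simp add: sq_integrable_def)
  have "(LBINT p. qf l \<sigma> u u p) \<le> (LBINT p. 2 * ((Dx l 2 0 u p)\<^sup>2 + (Dx l 1 1 u p)\<^sup>2 + (Dx l 0 2 u p)\<^sup>2))"
  proof (rule integral_mono)
    show "qf l \<sigma> u u p \<le> 2 * ((Dx l 2 0 u p)\<^sup>2 + (Dx l 1 1 u p)\<^sup>2 + (Dx l 0 2 u p)\<^sup>2)" for p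
    proof -
      have "2 * ((Dx l 2 0 u p)\<^sup>2 + (Dx l 1 1 u p)\<^sup>2 + (Dx l 0 2 u p)\<^sup>2) - qf l \<sigma> u u p
        = \<sigma> * (Dx l 2 0 u p - Dx l 0 2 u p)\<^sup>2 + (1 - \<sigma>) * ((Dx l 2 0 u p)\<^sup>2 + (Dx l 0 2 u p)\<^sup>2) + 2 * \<sigma> * (Dx l 1 1 u p)\<^sup>2"
        by (simp add: qf_def power2_eq_square algebra_simps)
      also have "\<dots> \<ge> 0" using assms by simp
      finally show ?thesis by simp
    qed
    show "integrable lborel (\<lambda>p. 2 * ((Dx l 2 0 u p)\<^sup>2 + (Dx l 1 1 u p)\<^sup>2 + (Dx l 0 2 u p)\<^sup>2))"
      by (intro integrable_mult_right Bochner_Integration.integrable_add i) auto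
  qed (rule qf_integrable[OF assms(3,3)])
  then show ?thesis unfolding ip_qf Bochner_Integration.integral_mult_right_zero .
qed

section \<open>Functions of one variable vanishing at both ends\<close>

lemma running_integral_measurable:
  fixes W :: "real \<Rightarrow> real"
  assumes "W \<in> borel_measurable borel"
  shows "(\<lambda>x. LBINT t. ind {c..x} t * W t) \<in> borel_measurable borel"
proof -
  have [measurable]: "W \<in> borel_measurable borel" by fact
  have "(\<lambda>(x, t). ind {p. c \<le> snd p \<and> snd p \<le> fst p} (x, t) * W t :: real) \<in> borel_measurable (borel \<Otimes>\<^sub>M lborel)"
    by measurable
  then have "(\<lambda>x. LBINT t. ind {p. c \<le> snd p \<and> snd p \<le> fst p} (x, t) * W t) \<in> borel_measurable borel"
    by (rule lborel.borel_measurable_lebesgue_integral)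
  also have "(\<lambda>x. LBINT t. ind {p. c \<le> snd p \<and> snd p \<le> fst p} (x, t) * W t) = (\<lambda>x. LBINT t. ind {c..x} t * W t)"
    by (intro ext Bochner_Integration.integral_cong) (auto simp: indicator_def)
  finally show ?thesis .
qed

lemma running_integral_bound:
  fixes W :: "'a::euclidean_space \<Rightarrow> real"
  assumes "integrable lborel W" "A \<in> sets borel"
  shows "\<bar>LBINT t. ind A t * W t\<bar> \<le> (LBINT t. \<bar>W t\<bar>)"
proof -
  have i: "integrable lborel (\<lambda>t. ind A t * W t)"
    using integrable_mult_indicator[OF _ assms(1), of A] assms(2) by simp
  have "\<bar>LBINT t. ind A t * W t\<bar> \<le> (LBINT t. \<bar>ind A t * W t\<bar>)"
    by (rule integral_abs_bound)
  also have "\<dots> \<le> (LBINT t. \<bar>W t\<bar>)"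
    using i assms by (intro integral_mono) (auto simp: indicator_def)
  finally show ?thesis .
qed

lemma integrable_indicator_bounded:
  fixes f :: "'a::euclidean_space \<Rightarrow> real"
  assumes "f \<in> borel_measurable borel" "A \<in> sets borel" "bounded A" "\<And>x. \<bar>f x\<bar> \<le> B"
  shows "integrable lborel (\<lambda>x. ind A x * f x)"
  by (rule integrable_mult_bounded[of lborel "ind A" f B])
    (use assms emeasure_bounded_lt[OF assms(3)] in auto)

text \<open>The derivative of a smoothed step has mass one; centring it at the midpoint with
  half-width \<open>(d - c) / 4\<close> keeps its support inside.\<close>

lemma mollifier_exists:
  assumes "c < d"
  obtains \<xi> where "test1 c d \<xi>" "(LBINT x. ind {c..d} x * \<xi> x) = 1" "\<And>x. \<xi> x \<ge> 0"
proof -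
  define e where "e = (d - c) / 4"
  define m where "m = (c + d) / 2"
  have e: "e > 0" "c < m - e" "m + e < d" using assms by (auto simp: e_def m_def field_simps)
  have "(LBINT x. ind {c..d} x * deriv (stepx m e) x) = 1"
    using integral_deriv_Icc[OF stepx_smooth, of c d m e] stepx_0[OF e(1), of c m] stepx_1[OF e(1), of m d] e assms by simp
  moreover have "test1 c d (deriv (stepx m e))"
    unfolding test1_def using e stepx_deriv_0[OF e(1), of _ m]
    by (intro conjI smooth1_deriv stepx_smooth exI[of _ "m - e"] exI[of _ "m + e"]) auto
  ultimately show ?thesis using that stepx_deriv_nonneg[OF e(1)] by blast
qed

text \<open>A test \<open>b\<close> is corrected by a multiple of a fixed mollifier to have mean zero; then it is the
  derivative of a test \<open>a\<close>, and \<open>deriv (deriv a)\<close> can be used in \<open>weak\<close>.\<close>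

lemma second_order_primitive:
  fixes V W :: "real \<Rightarrow> real"
  assumes cd: "c < d" and V: "continuous_on {c..d} V" "V c = 0" "V d = 0" and W: "integrable lborel W"
    and weak: "\<And>a. test1 c d a \<Longrightarrow>
       (LBINT x. ind {c..d} x * (V x * deriv (deriv a) x)) = (LBINT x. W x * a x)"
  obtains Q where "Q \<in> borel_measurable borel" "\<And>x. \<bar>Q x\<bar> \<le> 2 * (LBINT t. \<bar>W t\<bar>)"
    "\<And>x1 x2. c \<le> x1 \<Longrightarrow> x1 \<le> x2 \<Longrightarrow> x2 \<le> d \<Longrightarrow> V x2 - V x1 = (LBINT t. ind {x1..x2} t * Q t)"
proof -
  have [measurable]: "W \<in> borel_measurable borel" using W by (auto dest: borel_measurable_integrable)
  \<comment> \<open>A primitive of the second derivative, so the first derivative must be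
    \<open>R\<close> up to a constant of integration.\<close>
  define R where "R x = (LBINT t. ind {c..x} t * W t)" for x
  have R[measurable]: "R \<in> borel_measurable borel"
    unfolding R_def[abs_def] by (rule running_integral_measurable) measurable
  define N where "N = (LBINT t. \<bar>W t\<bar>)"
  have RN: "\<bar>R x\<bar> \<le> N" for x unfolding R_def N_def by (rule running_integral_bound[OF W]) simp
  have iR: "integrable lborel (\<lambda>x. ind {c..d} x * R x)"
    by (rule integrable_indicator_bounded[OF R _ _ RN]) auto
  obtain \<xi> where \<xi>: "test1 c d \<xi>" "(LBINT x. ind {c..d} x * \<xi> x) = 1" using mollifier_exists[OF cd] .
  \<comment> \<open>The constant of integration. Its value is forced by testing the desired
    identity, with weak derivative \<open>R x - \<kappa>\<close>, against \<xi>, which has mass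
    one.\<close>
  define \<kappa> where "\<kappa> = (LBINT x. ind {c..d} x * (V x * deriv \<xi> x)) + (LBINT x. ind {c..d} x * R x * \<xi> x)"
  have iRk: "integrable lborel (\<lambda>x. ind {c..d} x * (R x - \<kappa>))"
  proof (rule integrable_indicator_bounded[where B="N + \<bar>\<kappa>\<bar>"])
    show "\<bar>R x - \<kappa>\<bar> \<le> N + \<bar>\<kappa>\<bar>" for x using RN[of x] by linarith
  qed auto
  have main: "V x2 - V x1 = (LBINT t. ind {x1..x2} t * (ind {c..d} t * (R t - \<kappa>)))"
    if x: "c \<le> x1" "x1 \<le> x2" "x2 \<le> d" for x1 x2
  proof (rule weak_primitive[OF cd V(1) iRk _ x])
    fix b assume b: "test1 c d b"
    define B where "B = (LBINT x. ind {c..d} x * b x)"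
    note sb = test1_smooth[OF b] and s\<xi> = test1_smooth[OF \<xi>(1)]
    have ib: "integrable lborel (\<lambda>x. ind {c..d} x * b x)"
      and i\<xi>: "integrable lborel (\<lambda>x. ind {c..d} x * \<xi> x)"
      by (intro integrable_continuous_Icc smooth1_continuous sb s\<xi>)+
    define b1 where "b1 x = b x + (-B) * \<xi> x" for x
    have sb1: "smooth1 b1" and db1: "deriv b1 = (\<lambda>x. deriv b x + (-B) * deriv \<xi> x)"
      unfolding b1_def[abs_def] smooth1_add(2)[OF sb smooth1_cmult(1)[OF s\<xi>]] smooth1_cmult(2)[OF s\<xi>]
      by (intro smooth1_add sb smooth1_cmult s\<xi>) simp
    obtain a where a: "smooth1 a" "deriv a = b1" "a c = 0" using smooth1_primitive[OF sb1] .
    have Da: "(a has_real_derivative b1 x) (at x)" for x using smooth1_DERIV[OF a(1)] a(2) by metis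
    obtain c1 d1 where cd1: "c < c1" "d1 < d" "\<And>x. x \<notin> {c1..d1} \<Longrightarrow> b x = 0" using b by (auto simp: test1_def)
    obtain c2 d2 where cd2: "c < c2" "d2 < d" "\<And>x. x \<notin> {c2..d2} \<Longrightarrow> \<xi> x = 0" using \<xi>(1) by (auto simp: test1_def)
    have b10: "b1 x = 0" if "x < min c1 c2 \<or> x > max d1 d2" for x
      unfolding b1_def using that cd1(3)[of x] cd2(3)[of x] by auto
    have "a d - a c = (LBINT x. ind {c..d} x * b1 x)"
      using integral_deriv_Icc[OF a(1), of c d] a(2) cd by simp
    also have "\<dots> = (LBINT x. ind {c..d} x * b x + (-B) * (ind {c..d} x * \<xi> x))"
      by (intro Bochner_Integration.integral_cong) (auto simp: b1_def algebra_simps)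
    also have "\<dots> = B + (-B) * 1"
      unfolding B_def using ib i\<xi> \<xi>(2) by (subst Bochner_Integration.integral_add) auto
    finally have ad: "a d = 0" using a(3) by simp
    have a0: "a x = 0" if "x \<notin> {min c1 c2 .. max d1 d2}" for x
    proof (cases "x < min c1 c2")
      case True
      have "a x = a c"
      proof (rule zero_deriv_const[of "{..<min c1 c2}" a])
        show "(a has_real_derivative 0) (at z)" if "z \<in> {..<min c1 c2}" for z
          using Da[of z] b10[of z] that by auto
      qed (use True cd1 cd2 in auto)
      then show ?thesis using a(3) by simp
    next
      case False
      have "a x = a d"
      proof (rule zero_deriv_const[of "{max d1 d2<..}" a])
        show "(a has_real_derivative 0) (at z)" if "z \<in> {max d1 d2<..}" for z
          using Da[of z] b10[of z] that by auto
      qed (use False that cd1 cd2 in auto)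
      then show ?thesis using ad by simp
    qed
    have ta: "test1 c d a"
      unfolding test1_def using a(1) a0 cd1 cd2
      by (intro conjI exI[of _ "min c1 c2"] exI[of _ "max d1 d2"]) auto
    have I: "integrable lborel (\<lambda>x. ind {c..d} x * (V x * f x))" if "smooth1 f" for f
      by (intro integrable_continuous_Icc continuous_intros V smooth1_continuous that)
    have J: "integrable lborel (\<lambda>x. ind {c..d} x * R x * f x)" if f: "test1 c d f" for f
    proof -
      obtain B where "\<And>x. \<bar>f x\<bar> \<le> B" using test1_bounded[OF f] by blast
      then show ?thesis by (rule integrable_mult_bounded[OF iR, rotated]) (use test1_measurable[OF f] in simp)
    qed
    have "(LBINT x. ind {c..d} x * (V x * deriv b1 x)) = (LBINT x. W x * a x)"
      using weak[OF ta] a(2) by simp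
    also have "(LBINT x. ind {c..d} x * (V x * deriv b1 x))
      = (LBINT x. ind {c..d} x * (V x * deriv b x) + (-B) * (ind {c..d} x * (V x * deriv \<xi> x)))"
      unfolding db1 by (intro Bochner_Integration.integral_cong) (auto simp: algebra_simps)
    also have "\<dots> = (LBINT x. ind {c..d} x * (V x * deriv b x)) - B * (LBINT x. ind {c..d} x * (V x * deriv \<xi> x))"
      using I[OF smooth1_deriv[OF sb]] I[OF smooth1_deriv[OF s\<xi>]] by (subst Bochner_Integration.integral_add) auto
    also have "(LBINT x. W x * a x) = - (LBINT x. ind {c..d} x * (R x * b1 x))"
      using integral_by_parts_primitive[OF W, of c d R 0 a b1] Da smooth1_continuous[OF sb1] test1_0[OF ta] cd
      by (simp add: R_def)
    also have "(LBINT x. ind {c..d} x * (R x * b1 x))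
      = (LBINT x. ind {c..d} x * R x * b x + (-B) * (ind {c..d} x * R x * \<xi> x))"
      unfolding b1_def by (intro Bochner_Integration.integral_cong) (auto simp: algebra_simps)
    also have "\<dots> = (LBINT x. ind {c..d} x * R x * b x) - B * (LBINT x. ind {c..d} x * R x * \<xi> x)"
      using J[OF b] J[OF \<xi>(1)] by (subst Bochner_Integration.integral_add) auto
    finally have "(LBINT x. ind {c..d} x * (V x * deriv b x))
      = - ((LBINT x. ind {c..d} x * R x * b x) - \<kappa> * B)"
      by (simp add: \<kappa>_def algebra_simps)
    also have "(LBINT x. ind {c..d} x * R x * b x) - \<kappa> * B
      = (LBINT x. ind {c..d} x * R x * b x - \<kappa> * (ind {c..d} x * b x))"
      unfolding B_def using J[OF b] ib by (subst Bochner_Integration.integral_diff) auto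
    also have "\<dots> = (LBINT x. ind {c..d} x * (R x - \<kappa>) * b x)"
      by (intro Bochner_Integration.integral_cong) (auto simp: algebra_simps)
    finally show "(LBINT x. ind {c..d} x * (V x * deriv b x)) = - (LBINT x. ind {c..d} x * (R x - \<kappa>) * b x)" .
  qed
  \<comment> \<open>Because \<open>V\<close> vanishes at both ends, \<open>R - \<kappa>\<close> has
    mean zero. So \<kappa> is the mean of \<open>R\<close> and inherits its bound, which explains
    the factor 2 in the conclusion.\<close>
  have \<kappa>N: "\<bar>\<kappa>\<bar> \<le> N"
  proof -
    have "0 = (LBINT t. ind {c..d} t * R t - ind {c..d} t * \<kappa>)"
    proof -
      have "(LBINT t. ind {c..d} t * (ind {c..d} t * (R t - \<kappa>))) = (LBINT t. ind {c..d} t * R t - ind {c..d} t * \<kappa>)"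
        by (intro Bochner_Integration.integral_cong) (auto simp: indicator_def)
      then show ?thesis using main[of c d] cd V(2,3) by simp
    qed
    also have "\<dots> = (LBINT t. ind {c..d} t * R t) - \<kappa> * (d - c)"
      using iR cd by (subst Bochner_Integration.integral_diff) auto
    finally have "\<kappa> * (d - c) = (LBINT t. ind {c..d} t * R t)" by simp
    then have "\<bar>\<kappa>\<bar> * (d - c) = \<bar>LBINT t. ind {c..d} t * R t\<bar>" using cd by (metis abs_mult abs_of_pos diff_gt_0_iff_gt)
    also have "\<dots> \<le> (LBINT t. \<bar>ind {c..d} t * R t\<bar>)" by (rule integral_abs_bound)
    also have "\<dots> \<le> (LBINT t. ind {c..d} t * N)"
    proof (rule integral_mono)
      show "integrable lborel (\<lambda>t. \<bar>ind {c..d} t * R t\<bar>)" using iR by (rule integrable_abs)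
      show "integrable lborel (\<lambda>t. ind {c..d} t * N)"
        by (rule integrable_continuous_Icc) (rule continuous_on_const)
      show "\<bar>ind {c..d} t * R t\<bar> \<le> ind {c..d} t * N" for t
        using RN[of t] by (simp add: abs_mult mult_left_mono)
    qed
    also have "\<dots> = N * (d - c)" using cd by simp
    finally show ?thesis using cd by simp
  qed
  show ?thesis
  proof
    show "(\<lambda>t. R t - \<kappa>) \<in> borel_measurable borel" by measurable
    show "\<bar>R x - \<kappa>\<bar> \<le> 2 * (LBINT t. \<bar>W t\<bar>)" for x
      using RN[of x] \<kappa>N unfolding N_def by linarith
    show "V x2 - V x1 = (LBINT t. ind {x1..x2} t * (R t - \<kappa>))"
      if "c \<le> x1" "x1 \<le> x2" "x2 \<le> d" for x1 x2
    proof -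
      have "(LBINT t. ind {x1..x2} t * (ind {c..d} t * (R t - \<kappa>))) = (LBINT t. ind {x1..x2} t * (R t - \<kappa>))"
        using that by (intro Bochner_Integration.integral_cong) (auto simp: indicator_def)
      then show ?thesis using main[OF that] by simp
    qed
  qed
qed

section \<open>Square integrability of integrals along one variable\<close>

lemma sq_integrable_swap:
  fixes f :: "real \<times> real \<Rightarrow> real"
  assumes "sq_integrable f"
  shows "sq_integrable (\<lambda>p. f (snd p, fst p))"
proof -
  have [measurable]: "f \<in> borel_measurable borel" using assms by (auto simp: sq_integrable_def)
  have "integrable (lborel \<Otimes>\<^sub>M lborel) (\<lambda>p. (f p)\<^sup>2)" using assms by (simp add: sq_integrable_def lborel_prod)
  from lborel_pair.integrable_product_swap[OF this]
  have "integrable lborel (\<lambda>p. (f (snd p, fst p))\<^sup>2)" by (simp add: lborel_prod case_prod_beta')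
  moreover have "(\<lambda>p. f (snd p, fst p)) \<in> borel_measurable borel" 
  proof -
    have "(\<lambda>p::real\<times>real. (snd p, fst p)) \<in> borel_measurable borel"
      by (intro borel_measurable_continuous_onI continuous_intros)
    from measurable_compose[OF this, of f borel] show ?thesis by simp
  qed
  ultimately show ?thesis by (simp add: sq_integrable_def)
qed

text \<open>Cauchy-Schwarz in \<open>t\<close> bounds the squared inner integral by
  \<open>B\<^sup>2 * (d - c)\<close> times the integral of \<open>h\<^sup>2\<close> over the line,
  independently of \<open>snd q\<close>; integrating over the strip costs another factor
  \<open>d - c\<close>. The kernel \<open>k\<close> will be the indicator of a triangle, for running
  integrals, or the weight \<open>eta l\<close>.\<close>

lemma sq_integrable_section_integral:
  fixes h :: "real \<times> real \<Rightarrow> real"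
  assumes h: "sq_integrable h" and supp: "\<And>p. snd p \<notin> {c..d} \<Longrightarrow> h p = 0" and "c \<le> d"
    and k: "k \<in> borel_measurable borel" "\<And>p. \<bar>k p\<bar> \<le> B"
  shows "sq_integrable (\<lambda>q. ind (UNIV \<times> {c..d}) q * (LBINT t. k (snd q, t) * h (fst q, t)))"
    (is "sq_integrable ?F")
proof -
  have [measurable]: "h \<in> borel_measurable borel" "k \<in> borel_measurable borel"
    using h k by (auto simp: sq_integrable_def)
  have [measurable]: "h \<in> borel_measurable (borel \<Otimes>\<^sub>M borel)" "k \<in> borel_measurable (borel \<Otimes>\<^sub>M borel)"
    by (simp_all add: borel_prod)
  have m: "(\<lambda>(q, t). k (snd q, t) * h (fst q, t)) \<in> borel_measurable (borel \<Otimes>\<^sub>M lborel)"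
    by measurable
  have mF: "?F \<in> borel_measurable borel"
    using lborel.borel_measurable_lebesgue_integral[of "\<lambda>q t. k (snd q, t) * h (fst q, t)" borel, OF m]
    by (intro borel_measurable_times borel_measurable_indicator) (auto intro!: borel_closed closed_Times)
  define H where "H x = (\<integral>\<^sup>+t. ennreal ((h (x, t))\<^sup>2) \<partial>lborel)" for x
  have [measurable]: "H \<in> borel_measurable borel"
    unfolding H_def[abs_def] by measurable
  have pt: "ennreal ((?F q)\<^sup>2) \<le> (ennreal (B\<^sup>2 * (d - c)) * H (fst q)) * indicator {c..d} (snd q)" for q
  \<comment> \<open>On a line where the product is not integrable the Bochner integral is 0 by
    default, so the bound holds at every point rather than almost everywhere.\<close>
  proof (cases "snd q \<in> {c..d} \<and> integrable lborel (\<lambda>t. k (snd q, t) * h (fst q, t))")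
    case True
    let ?f = "\<lambda>t. k (snd q, t) * h (fst q, t)"
    have mm[measurable]: "(\<lambda>t. k (snd q, t)) \<in> borel_measurable borel" "(\<lambda>t. h (fst q, t)) \<in> borel_measurable borel"
      by measurable
    have "ennreal \<bar>LBINT t. ?f t\<bar> \<le> (\<integral>\<^sup>+t. ennreal \<bar>?f t\<bar> \<partial>lborel)"
      using integral_norm_bound_ennreal[of lborel ?f] True by simp
    also have "\<dots> = (\<integral>\<^sup>+t. ennreal (\<bar>k (snd q, t)\<bar> * indicator {c..d} t) * ennreal \<bar>h (fst q, t)\<bar> \<partial>lborel)"
      by (intro nn_integral_cong) (use supp in \<open>auto simp: abs_mult ennreal_mult indicator_def\<close>)
    finally have "(ennreal \<bar>LBINT t. ?f t\<bar>)\<^sup>2 \<le> \<dots>\<^sup>2" by (rule power_mono) simp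
    also have "\<dots> \<le> (\<integral>\<^sup>+t. ennreal (\<bar>k (snd q, t)\<bar> * indicator {c..d} t) ^ 2 \<partial>lborel) * (\<integral>\<^sup>+t. ennreal \<bar>h (fst q, t)\<bar> ^ 2 \<partial>lborel)"
      by (rule Cauchy_Schwarz_nn_integral) measurable
    also have "(\<integral>\<^sup>+t. ennreal \<bar>h (fst q, t)\<bar> ^ 2 \<partial>lborel) = H (fst q)"
      by (simp add: H_def ennreal_power)
    also have "(\<integral>\<^sup>+t. ennreal (\<bar>k (snd q, t)\<bar> * indicator {c..d} t) ^ 2 \<partial>lborel) \<le> (\<integral>\<^sup>+t. ennreal (B\<^sup>2) * indicator {c..d} t \<partial>lborel)"
    proof (rule nn_integral_mono)
      fix t
      have "\<bar>k (snd q, t)\<bar> ^ 2 \<le> B ^ 2" using k(2)[of "(snd q, t)"] by (intro power_mono) auto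
      then show "ennreal (\<bar>k (snd q, t)\<bar> * indicator {c..d} t) ^ 2 \<le> ennreal (B\<^sup>2) * indicator {c..d} t"
        by (auto simp: indicator_def ennreal_power intro!: ennreal_leI)
    qed
    also have "(\<integral>\<^sup>+t. ennreal (B\<^sup>2) * indicator {c..d} t \<partial>lborel) = ennreal (B\<^sup>2 * (d - c))"
      using \<open>c \<le> d\<close> by (simp add: nn_integral_cmult ennreal_mult)
    finally have "(ennreal \<bar>LBINT t. ?f t\<bar>)\<^sup>2 \<le> ennreal (B\<^sup>2 * (d - c)) * H (fst q)"
      by (simp add: mult_right_mono)
    then show ?thesis using True by (cases q) (simp add: ennreal_power)
  next
    case False
    then show ?thesis by (cases q) (auto simp: not_integrable_integral_eq)
  qed
  have "(\<integral>\<^sup>+q. ennreal ((?F q)\<^sup>2) \<partial>lborel) \<le> (\<integral>\<^sup>+q. (ennreal (B\<^sup>2 * (d - c)) * H (fst q)) * indicator {c..d} (snd q) \<partial>lborel)"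
    by (rule nn_integral_mono) (rule pt)
  also have "\<dots> = (\<integral>\<^sup>+x. \<integral>\<^sup>+y. (ennreal (B\<^sup>2 * (d - c)) * H x) * indicator {c..d} y \<partial>lborel \<partial>lborel)"
    unfolding lborel_prod[symmetric] by (subst lborel.nn_integral_fst[symmetric]) auto
  also have "\<dots> = (\<integral>\<^sup>+x. (ennreal (B\<^sup>2 * (d - c)) * H x) * ennreal (d - c) \<partial>lborel)"
    using \<open>c \<le> d\<close> by (subst nn_integral_cmult) auto
  also have "\<dots> = ennreal (B\<^sup>2 * (d - c)) * (\<integral>\<^sup>+x. H x \<partial>lborel) * ennreal (d - c)"
    by (simp add: nn_integral_multc nn_integral_cmult)
  also have "(\<integral>\<^sup>+x. H x \<partial>lborel) = (\<integral>\<^sup>+p. ennreal ((h p)\<^sup>2) \<partial>lborel)"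
    unfolding H_def lborel_prod[symmetric] by (subst lborel.nn_integral_fst[symmetric]) auto
  also have "\<dots> = ennreal (LBINT p. (h p)\<^sup>2)"
    using h by (intro nn_integral_eq_integral) (auto simp: sq_integrable_def)
  finally have "(\<integral>\<^sup>+q. ennreal ((?F q)\<^sup>2) \<partial>lborel) < \<infinity>"
    by (rule le_less_trans) (simp add: ennreal_mult_less_top)
  then show ?thesis
    unfolding sq_integrable_def using mF by (auto intro!: integrableI_bounded)
qed

section \<open>Continuous functions with square integrable second derivatives\<close>

text \<open>Weight for averaging in \<open>y\<close>. Its compact support makes
  \<open>tensor a (eta l)\<close> an admissible test function, which the constant weight would not
  do.\<close>

definition eta :: "real \<Rightarrow> real \<Rightarrow> real" where
  "eta l = (SOME \<eta>. test1 (-l) l \<eta> \<and> (LBINT x. ind {-l..l} x * \<eta> x) = 1 \<and> (\<forall>x. \<eta> x \<ge> 0))"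

lemma eta:
  assumes "l > 0"
  shows eta_test: "test1 (-l) l (eta l)" and eta_1: "(LBINT x. ind {-l..l} x * eta l x) = 1"
    and eta_nonneg: "eta l x \<ge> 0"
proof -
  obtain \<eta> where "test1 (-l) l \<eta>" "(LBINT x. ind {-l..l} x * \<eta> x) = 1" "\<And>x. \<eta> x \<ge> 0"
    using mollifier_exists[of "-l" l] assms by auto
  then have "\<exists>\<eta>. test1 (-l) l \<eta> \<and> (LBINT x. ind {-l..l} x * \<eta> x) = 1 \<and> (\<forall>x. \<eta> x \<ge> 0)" by blast
  from someI_ex[OF this] show "test1 (-l) l (eta l)" "(LBINT x. ind {-l..l} x * eta l x) = 1" "eta l x \<ge> 0"
    by (auto simp: eta_def)
qed

definition eta_bound :: "real \<Rightarrow> real" where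
  "eta_bound l = (SOME B. \<forall>x. \<bar>eta l x\<bar> \<le> B)"

lemma eta_bound: "l > 0 \<Longrightarrow> \<bar>eta l x\<bar> \<le> eta_bound l"
  using someI_ex[of "\<lambda>B. \<forall>x. \<bar>eta l x\<bar> \<le> B"] test1_bounded[OF eta_test] by (metis eta_bound_def)

definition nrm :: "('a::euclidean_space \<Rightarrow> real) \<Rightarrow> real" where
  "nrm f = sqrt (LBINT p. (f p)\<^sup>2)"

lemma nrm_nonneg: "nrm f \<ge> 0" by (simp add: nrm_def)

lemma rect_sets [measurable]: "{a..b::real} \<times> {c..d::real} \<in> sets borel"
  by (intro borel_closed closed_Times closed_atLeastAtMost)

lemma measure_rect:
  assumes "a \<le> b" "c \<le> d"
  shows "measure lborel ({a..b::real} \<times> {c..d::real}) = (b - a) * (d - c)"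
proof -
  have "emeasure lborel ({a..b} \<times> {c..d}) = emeasure lborel {a..b} * emeasure lborel {c..d}"
    unfolding lborel_prod[symmetric] by (rule lborel.emeasure_pair_measure_Times) auto
  then show ?thesis using assms by (simp add: measure_def enn2real_mult)
qed

lemma bounded_rect: "bounded ({a..b::real} \<times> {c..d::real})"
  by (intro bounded_Times bounded_closed_interval)

text \<open>Cauchy-Schwarz against the indicator of the rectangle. The square root of the area is
  the origin of the Hoelder exponent 1/2.\<close>

lemma rect_integral_bound:
  fixes G :: "real \<times> real \<Rightarrow> real"
  assumes "sq_integrable G" "a \<le> b" "c \<le> d"
  shows "\<bar>LBINT p. ind ({a..b} \<times> {c..d}) p * G p\<bar> \<le> sqrt ((b - a) * (d - c)) * nrm G"
proof -
  let ?R = "{a..b} \<times> {c..d}"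
  have s: "sq_integrable (ind ?R)"
    by (intro sq_integrable_indicator rect_sets emeasure_bounded_lt bounded_rect)
  have "(\<lambda>p. (ind ?R p :: real)\<^sup>2) = ind ?R" by (auto simp: indicator_def)
  then have "(LBINT p. (ind ?R p :: real)\<^sup>2) = (b - a) * (d - c)"
    using measure_rect[OF assms(2,3)] by simp
  with Cauchy_Schwarz_integral[OF s assms(1)] show ?thesis by (simp add: nrm_def)
qed

lemma sq_integrable_mult_indicator:
  assumes "sq_integrable f" "A \<in> sets borel"
  shows "sq_integrable (\<lambda>p. ind A p * f p)"
proof -
  have "(\<lambda>p. (ind A p * f p)\<^sup>2) = (\<lambda>p. ind A p *\<^sub>R (f p)\<^sup>2)" by (auto simp: indicator_def)
  moreover have "integrable lborel (\<lambda>p. ind A p *\<^sub>R (f p)\<^sup>2)"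
    using assms by (intro integrable_mult_indicator) (auto simp: sq_integrable_def)
  ultimately show ?thesis using assms unfolding sq_integrable_def by auto
qed

lemma sq_integrable_continuous_rect:
  fixes v :: "real \<times> real \<Rightarrow> real"
  assumes "continuous_on ({a..b} \<times> {c..d}) v"
  shows "sq_integrable (\<lambda>p. ind ({a..b} \<times> {c..d}) p * v p)"
proof -
  have "continuous_on ({a..b} \<times> {c..d}) (\<lambda>p. (v p)\<^sup>2)" by (intro continuous_intros assms)
  then have "integrable lborel (\<lambda>p. ind ({a..b} \<times> {c..d}) p * (v p)\<^sup>2)" by (rule integrable_continuous_rect)
  moreover have "(\<lambda>p. (ind ({a..b} \<times> {c..d}) p * v p)\<^sup>2) = (\<lambda>p. ind ({a..b} \<times> {c..d}) p * (v p)\<^sup>2)"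
    by (auto simp: indicator_def)
  ultimately show ?thesis
    using integrable_continuous_rect[OF assms] by (auto simp: sq_integrable_def dest: borel_measurable_integrable)
qed

lemma L2_continuous:
  assumes "continuous_on ({0..pi} \<times> {-l..l}) v"
  shows "L2 (Omega l) v"
proof -
  have "zext l v = (\<lambda>p. ind (Omega l) p * (ind ({0..pi} \<times> {-l..l}) p * v p))"
    by (rule ext) (auto simp: zext_def indicator_def Omega_def)
  then show ?thesis
    unfolding L2_iff using sq_integrable_mult_indicator[OF sq_integrable_continuous_rect[OF assms] Omega_sets] by simp
qed

lemma test_fun_DERIV:
  assumes "test_fun U \<phi>"
  shows "((\<lambda>x. \<phi> (x, y)) has_real_derivative Dmulti 1 0 \<phi> (x, y)) (at x)"
    and "((\<lambda>y. \<phi> (x, y)) has_real_derivative Dmulti 0 1 \<phi> (x, y)) (at y)"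
proof -
  have "\<phi> differentiable (at (x, y))" using assms unfolding test_fun_def smooth_def by (metis empty_subsetI list.set(1) pds.simps(1))
  then obtain D where D: "(\<phi> has_derivative D) (at (x, y))" by (auto simp: differentiable_def)
  then have lin: "linear D" using has_derivative_linear by blast
  have gen: "((\<lambda>t. \<phi> ((x, y) + t *\<^sub>R d)) has_real_derivative D d) (at 0)" for d
  proof -
    have "((\<lambda>t. (x, y) + t *\<^sub>R d) has_derivative (\<lambda>t. t *\<^sub>R d)) (at 0)"
      by (auto intro!: derivative_eq_intros)
    then have "((\<lambda>t. \<phi> ((x, y) + t *\<^sub>R d)) has_derivative (\<lambda>t. D (t *\<^sub>R d))) (at 0)"
      by (rule has_derivative_compose) (use D in simp)
    then show ?thesis
      using lin has_derivative_transform[of 0 UNIV "(*) (D d)"]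
      by (simp add: has_field_derivative_def linear_cmul mult.commute[of "D d" for d] mult_commute_abs)
  qed
  have D1: "Dmulti 1 0 \<phi> (x, y) = D e1" and D2: "Dmulti 0 1 \<phi> (x, y) = D e2"
  proof -
    have "pd e1 \<phi> (x, y) = D e1" "pd e2 \<phi> (x, y) = D e2"
      unfolding pd_def by (rule DERIV_imp_deriv[OF gen])+
    then show "Dmulti 1 0 \<phi> (x, y) = D e1" "Dmulti 0 1 \<phi> (x, y) = D e2" by (simp_all add: Dmulti_def)
  qed
  have "((\<lambda>t. \<phi> (x + t, y)) has_real_derivative D e1) (at 0)"
    using gen[of e1] by (simp add: e1_def)
  then show "((\<lambda>x. \<phi> (x, y)) has_real_derivative Dmulti 1 0 \<phi> (x, y)) (at x)"
    unfolding D1 using DERIV_shift[of "\<lambda>x. \<phi> (x, y)" "D e1" 0 x] by (simp add: add.commute)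
  have "((\<lambda>t. \<phi> (x, y + t)) has_real_derivative D e2) (at 0)"
    using gen[of e2] by (simp add: e2_def)
  then show "((\<lambda>y. \<phi> (x, y)) has_real_derivative Dmulti 0 1 \<phi> (x, y)) (at y)"
    unfolding D2 using DERIV_shift[of "\<lambda>y. \<phi> (x, y)" "D e2" 0 y] by (simp add: add.commute)
qed

text \<open>Continuity and the weak derivatives \<open>v\<^sub>x\<^sub>y\<close> and
  \<open>v\<^sub>x\<^sub>x\<close> are all that is assumed, so the locale can be instantiated with a
  limit function before its membership in \<open>H2\<close> is known.\<close>

locale plate_fun =
  fixes l :: real and v g w :: "real \<times> real \<Rightarrow> real"
  assumes l: "l > 0" and v: "continuous_on ({0..pi} \<times> {-l..l}) v"
    and side: "\<And>y. y \<in> {-l<..<l} \<Longrightarrow> v (0, y) = 0" "\<And>y. y \<in> {-l<..<l} \<Longrightarrow> v (pi, y) = 0"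
    and g: "L2 (Omega l) g" "weak_deriv (Omega l) v 1 1 g"
    and w: "L2 (Omega l) w" "weak_deriv (Omega l) v 2 0 w"
begin

abbreviation "K \<equiv> {0..pi} \<times> {-l..l}"
abbreviation "G \<equiv> zext l g"

lemma G_sq: "sq_integrable G" using g(1) by (simp add: L2_iff)

lemma G_int: "integrable lborel G" by (rule zext_integrable[OF g(1)])

lemma G_supp: "p \<notin> {0<..<pi} \<times> {-l<..<l} \<Longrightarrow> G p = 0" by (rule zext_0) (simp add: Omega_def)

lemma vL2: "L2 (Omega l) v" by (rule L2_continuous[OF v])

lemma weak_K:
  assumes "L2 (Omega l) h" "weak_deriv (Omega l) v i j h" "test_fun (Omega l) \<phi>"
  shows "(LBINT p. ind K p * (v p * Dmulti i j \<phi> p)) = (-1) ^ (i + j) * (LBINT p. zext l h p * \<phi> p)"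
proof -
  have "ind K p * (v p * Dmulti i j \<phi> p) = zext l v p * Dmulti i j \<phi> p" for p
    using Dmulti_test(2)[OF assms(3), of p i j]
    by (cases "p \<in> Omega l") (auto simp: zext_def Omega_def indicator_def)
  then have "(LBINT p. ind K p * (v p * Dmulti i j \<phi> p)) = (LBINT p. zext l v p * Dmulti i j \<phi> p)"
    by (simp only:)
  then show ?thesis using assms(2)[unfolded weak_deriv_iff[OF vL2 assms(1)], rule_format, OF assms(3)] by simp
qed

lemma rect:
  assumes "0 \<le> x1" "x1 \<le> x2" "x2 \<le> pi" "-l \<le> y1" "y1 \<le> y2" "y2 \<le> l"
  shows "v (x2, y2) - v (x1, y2) - v (x2, y1) + v (x1, y1) = (LBINT p. ind ({x1..x2} \<times> {y1..y2}) p * G p)"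
proof (rule rectangle_difference[OF _ _ v G_int _ assms])
  fix a b assume ab: "test1 0 pi a" "test1 (-l) l b"
  have "(LBINT p. ind K p * (v p * Dmulti 1 1 (tensor a b) p)) = (LBINT p. zext l g p * tensor a b p)"
    using weak_K[OF g test_fun_tensor[OF ab]] by simp
  then show "(LBINT p. ind K p * (v p * tensor (deriv a) (deriv b) p)) = (LBINT p. G p * tensor a b p)"
    unfolding Dmulti_tensor(1)[OF test1_smooth[OF ab(1)] test1_smooth[OF ab(2)]] .
qed (use l in auto)

lemma v_section: "x \<in> {0..pi} \<Longrightarrow> continuous_on {-l..l} (\<lambda>y. v (x, y))"
  by (rule continuous_on_compose2[OF v]) (auto intro!: continuous_intros)

lemma side_closed:
  assumes "y \<in> {-l..l}"
  shows "v (0, y) = 0" "v (pi, y) = 0"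
proof -
  have cl: "closure {-l<..<l} = {-l..l}" using l by simp
  show "v (0, y) = 0"
    by (rule continuous_constant_on_closure[of "{-l<..<l}" "\<lambda>y. v (0, y)"]) (use v_section[of 0] assms side in \<open>auto simp: cl simp del: closure_greaterThanLessThan\<close>)
  show "v (pi, y) = 0"
    by (rule continuous_constant_on_closure[of "{-l<..<l}" "\<lambda>y. v (pi, y)"]) (use v_section[of pi] assms side in \<open>auto simp: cl simp del: closure_greaterThanLessThan\<close>)
qed

lemma diff_y:
  assumes "x \<in> {0..pi}" "-l \<le> y1" "y1 \<le> y2" "y2 \<le> l"
  shows "v (x, y2) - v (x, y1) = (LBINT p. ind ({0..x} \<times> {y1..y2}) p * G p)"
  using rect[of 0 x y1 y2] assms side_closed[of y1] side_closed[of y2] by simp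

text \<open>Use the rectangle that reaches back to the side \<open>x = 0\<close>, where
  \<open>v\<close> vanishes; its width is at most \<open>pi\<close>.\<close>

lemma diff_y_bound:
  assumes "x \<in> {0..pi}" "y1 \<in> {-l..l}" "y2 \<in> {-l..l}"
  shows "\<bar>v (x, y2) - v (x, y1)\<bar> \<le> sqrt (pi * \<bar>y2 - y1\<bar>) * nrm G"
proof -
  have *: "\<bar>v (x, y2) - v (x, y1)\<bar> \<le> sqrt (pi * (y2 - y1)) * nrm G" if "-l \<le> y1" "y1 \<le> y2" "y2 \<le> l" for y1 y2
  proof -
    have "\<bar>v (x, y2) - v (x, y1)\<bar> \<le> sqrt ((x - 0) * (y2 - y1)) * nrm G"
      unfolding diff_y[OF assms(1) that] using assms(1) that by (intro rect_integral_bound G_sq) auto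
    also have "\<dots> \<le> sqrt (pi * (y2 - y1)) * nrm G"
      using assms(1) that by (intro mult_right_mono nrm_nonneg real_sqrt_le_mono) auto
    finally show ?thesis .
  qed
  show ?thesis
    using *[of y1 y2] *[of y2 y1] assms(2,3) by (cases "y1 \<le> y2") (auto simp: abs_minus_commute)
qed

text \<open>\<open>V\<close> is the mean of \<open>v\<close> in \<open>y\<close> with weight \<open>eta l\<close>, \<open>W\<close> its weak second derivative and
  \<open>Q\<close> (below) its weak first derivative.\<close>

definition V :: "real \<Rightarrow> real" where "V x = (LBINT y. ind {-l..l} y * (v (x, y) * eta l y))"
definition W :: "real \<Rightarrow> real" where "W x = (LBINT y. zext l w (x, y) * eta l y)"

lemma eta_cont: "continuous_on A (eta l)" by (rule smooth1_continuous[OF test1_smooth[OF eta_test[OF l]]])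

lemma eta_meas [measurable]: "eta l \<in> borel_measurable borel" by (rule test1_measurable[OF eta_test[OF l]])

lemma V_cont: "continuous_on {0..pi} V"
proof -
  have "continuous_on K (\<lambda>p. v p * eta l (snd p))"
    by (intro continuous_intros v continuous_on_compose2[OF eta_cont[of UNIV]]) auto
  from continuous_on_section_integral[OF this] show ?thesis by (simp add: V_def[abs_def])
qed

lemma V_0: "V 0 = 0" "V pi = 0"
proof -
  have "ind {-l..l} y * (v (0, y) * eta l y) = 0" "ind {-l..l} y * (v (pi, y) * eta l y) = 0" for y
    using side_closed[of y] by (cases "y \<in> {-l..l}"; simp)+
  then show "V 0 = 0" "V pi = 0" unfolding V_def by (simp_all only: Bochner_Integration.integral_zero)
qed

lemma w_eta_int: "integrable lborel (\<lambda>p. zext l w p * eta l (snd p))"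
  by (rule integrable_mult_bounded[OF zext_integrable[OF w(1)] _ eta_bound[OF l]]) measurable

lemma W_int: "integrable lborel W"
  using lborel_fubini(3)[OF w_eta_int] by (simp add: W_def[abs_def])

text \<open>Bound the weight by its supremum and apply Cauchy-Schwarz on the rectangle of area
  \<open>pi * (2 * l)\<close>.\<close>

lemma W_bound: "(LBINT x. \<bar>W x\<bar>) \<le> eta_bound l * sqrt (pi * (2 * l)) * nrm (zext l w)"
proof -
  note ia = integrable_abs[OF w_eta_int]
  have "(LBINT x. \<bar>W x\<bar>) \<le> (LBINT x. LBINT y. \<bar>zext l w (x, y) * eta l y\<bar>)"
  proof (rule integral_mono)
    show "integrable lborel (\<lambda>x. \<bar>W x\<bar>)" using W_int by simp
    show "integrable lborel (\<lambda>x. LBINT y. \<bar>zext l w (x, y) * eta l y\<bar>)" using lborel_fubini(3)[OF ia] by simp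
    show "\<bar>W x\<bar> \<le> (LBINT y. \<bar>zext l w (x, y) * eta l y\<bar>)" for x unfolding W_def by (rule integral_abs_bound)
  qed
  also have "\<dots> = (LBINT p. \<bar>zext l w p * eta l (snd p)\<bar>)" using lborel_fubini(1)[OF ia] by simp
  also have "\<dots> \<le> (LBINT p. eta_bound l * (ind K p * \<bar>zext l w p\<bar>))"
  proof (rule integral_mono[OF ia])
    have "(\<lambda>p. ind K p * \<bar>zext l w p\<bar>) = (\<lambda>p. \<bar>zext l w p\<bar>)"
      by (rule ext) (auto simp: zext_def Omega_def indicator_def)
    then show "integrable lborel (\<lambda>p. eta_bound l * (ind K p * \<bar>zext l w p\<bar>))"
      using zext_integrable[OF w(1)] by (auto intro!: integrable_mult_right)
    show "\<bar>zext l w p * eta l (snd p)\<bar> \<le> eta_bound l * (ind K p * \<bar>zext l w p\<bar>)" for p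
      using mult_left_mono[OF eta_bound[OF l, of "snd p"], of "\<bar>zext l w p\<bar>"]
      by (cases "p \<in> Omega l") (auto simp: abs_mult mult.commute zext_def Omega_def)
  qed
  also have "\<dots> = eta_bound l * (LBINT p. ind K p * \<bar>zext l w p\<bar>)" by simp
  also have "\<dots> \<le> eta_bound l * (sqrt (pi * (2 * l)) * nrm (zext l w))"
  proof (rule mult_left_mono)
    have "sq_integrable (\<lambda>p. \<bar>zext l w p\<bar>)" using w(1) by (auto simp: L2_iff sq_integrable_def)
    from rect_integral_bound[OF this, of 0 pi "-l" l] l
    show "(LBINT p. ind K p * \<bar>zext l w p\<bar>) \<le> sqrt (pi * (2 * l)) * nrm (zext l w)"
      by (simp add: nrm_def)
    show "0 \<le> eta_bound l" using eta_bound[OF l, of 0] by linarith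
  qed
  finally show ?thesis by (simp add: mult_ac)
qed

lemma VW_weak:
  assumes a: "test1 0 pi a"
  shows "(LBINT x. ind {0..pi} x * (V x * deriv (deriv a) x)) = (LBINT x. W x * a x)"
proof -
  note sa = test1_smooth[OF a]
  have [measurable]: "a \<in> borel_measurable borel" by (rule test1_measurable[OF a])
  obtain A where A: "\<And>x. \<bar>a x\<bar> \<le> A" using test1_bounded[OF a] by blast
  note T = test_fun_tensor[OF a eta_test[OF l]]
  have "continuous_on K (\<lambda>p. v p * tensor (deriv (deriv a)) (eta l) p)"
    unfolding tensor_def
    by (intro continuous_intros v continuous_on_compose2[OF eta_cont[of UNIV]]
        continuous_on_compose2[OF smooth1_continuous[OF smooth1_deriv[OF smooth1_deriv[OF sa]], of UNIV]]) auto
  note i1 = integrable_continuous_rect[OF this]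
  have "(LBINT x. ind {0..pi} x * (V x * deriv (deriv a) x))
    = (LBINT x. LBINT y. ind K (x, y) * (v (x, y) * tensor (deriv (deriv a)) (eta l) (x, y)))"
  proof (rule Bochner_Integration.integral_cong)
    fix x
    have "(LBINT y. ind K (x, y) * (v (x, y) * tensor (deriv (deriv a)) (eta l) (x, y)))
      = (LBINT y. (ind {0..pi} x * deriv (deriv a) x) * (ind {-l..l} y * (v (x, y) * eta l y)))"
      by (intro Bochner_Integration.integral_cong) (auto simp: indicator_def tensor_def)
    then show "ind {0..pi} x * (V x * deriv (deriv a) x) = (LBINT y. ind K (x, y) * (v (x, y) * tensor (deriv (deriv a)) (eta l) (x, y)))"
      by (simp add: V_def)
  qed simp
  also have "\<dots> = (LBINT p. ind K p * (v p * Dmulti 2 0 (tensor a (eta l)) p))"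
    unfolding lborel_fubini(1)[OF i1] Dmulti_tensor(2)[OF sa test1_smooth[OF eta_test[OF l]]] ..
  also have "\<dots> = (LBINT p. zext l w p * tensor a (eta l) p)"
    unfolding weak_K[OF w T] by simp
  also have "\<dots> = (LBINT p. zext l w p * eta l (snd p) * a (fst p))"
    by (simp add: tensor_def mult_ac)
  also have "\<dots> = (LBINT x. LBINT y. zext l w (x, y) * eta l y * a x)"
    using lborel_fubini(1)[OF integrable_mult_bounded[OF w_eta_int, of "\<lambda>p. a (fst p)" A]] A by simp
  also have "\<dots> = (LBINT x. W x * a x)" by (simp add: W_def)
  finally show ?thesis .
qed

definition Q :: "real \<Rightarrow> real" where
  "Q = (SOME Q. Q \<in> borel_measurable borel \<and> (\<forall>x. \<bar>Q x\<bar> \<le> 2 * (LBINT t. \<bar>W t\<bar>)) \<and>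
    (\<forall>x1 x2. 0 \<le> x1 \<longrightarrow> x1 \<le> x2 \<longrightarrow> x2 \<le> pi \<longrightarrow> V x2 - V x1 = (LBINT t. ind {x1..x2} t * Q t)))"

lemma Q_meas [measurable]: "Q \<in> borel_measurable borel"
  and Q_bound: "\<bar>Q x\<bar> \<le> 2 * (LBINT t. \<bar>W t\<bar>)"
  and Q_diff: "0 \<le> x1 \<Longrightarrow> x1 \<le> x2 \<Longrightarrow> x2 \<le> pi \<Longrightarrow> V x2 - V x1 = (LBINT t. ind {x1..x2} t * Q t)"
proof -
  have "\<exists>Q. Q \<in> borel_measurable borel \<and> (\<forall>x. \<bar>Q x\<bar> \<le> 2 * (LBINT t. \<bar>W t\<bar>)) \<and>
    (\<forall>x1 x2. 0 \<le> x1 \<longrightarrow> x1 \<le> x2 \<longrightarrow> x2 \<le> pi \<longrightarrow> V x2 - V x1 = (LBINT t. ind {x1..x2} t * Q t))"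
    using second_order_primitive[OF pi_gt_zero V_cont V_0 W_int VW_weak] by metis
  from someI_ex[OF this, folded Q_def]
  show "Q \<in> borel_measurable borel" "\<bar>Q x\<bar> \<le> 2 * (LBINT t. \<bar>W t\<bar>)"
    "0 \<le> x1 \<Longrightarrow> x1 \<le> x2 \<Longrightarrow> x2 \<le> pi \<Longrightarrow> V x2 - V x1 = (LBINT t. ind {x1..x2} t * Q t)" by auto
qed

lemma V_bound:
  assumes "0 \<le> x1" "x1 \<le> x2" "x2 \<le> pi"
  shows "\<bar>V x2 - V x1\<bar> \<le> (x2 - x1) * (2 * (LBINT t. \<bar>W t\<bar>))"
proof -
  have iQ: "integrable lborel (\<lambda>t. ind {x1..x2} t * Q t)"
    by (rule integrable_indicator_bounded[OF Q_meas _ _ Q_bound]) auto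
  have "\<bar>V x2 - V x1\<bar> \<le> (LBINT t. \<bar>ind {x1..x2} t * Q t\<bar>)"
    unfolding Q_diff[OF assms] by (rule integral_abs_bound)
  also have "\<dots> \<le> (LBINT t. ind {x1..x2} t * (2 * (LBINT t. \<bar>W t\<bar>)))"
  proof (rule integral_mono)
    show "integrable lborel (\<lambda>t. \<bar>ind {x1..x2} t * Q t\<bar>)" using iQ by (rule integrable_abs)
    show "integrable lborel (\<lambda>t. ind {x1..x2} t * (2 * (LBINT t. \<bar>W t\<bar>)))"
      by (rule integrable_continuous_Icc) (rule continuous_on_const)
    show "\<bar>ind {x1..x2} t * Q t\<bar> \<le> ind {x1..x2} t * (2 * (LBINT t. \<bar>W t\<bar>))" for t
      unfolding abs_mult using Q_bound[of t] by (intro mult_mono) auto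
  qed
  also have "\<dots> = (x2 - x1) * (2 * (LBINT t. \<bar>W t\<bar>))" using assms by simp
  finally show ?thesis .
qed

text \<open>By the rectangle formula the increment \<open>D y\<close> in \<open>x\<close> varies by
  at most \<open>B\<close> over all heights \<open>y\<close>, and its mean with weight
  \<open>eta l\<close> is \<open>V x2 - V x1\<close>. So \<open>D y\<close> lies within
  \<open>B\<close> of that mean, which is controlled because \<open>V\<close> is Lipschitz.\<close>

lemma diff_x_bound:
  assumes x: "0 \<le> x1" "x1 \<le> x2" "x2 \<le> pi" and y: "y \<in> {-l..l}"
  shows "\<bar>v (x2, y) - v (x1, y)\<bar> \<le> sqrt ((x2 - x1) * (2 * l)) * nrm G + (x2 - x1) * (2 * (LBINT t. \<bar>W t\<bar>))"
proof -
  define D where "D y = v (x2, y) - v (x1, y)" for y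
  define B where "B = sqrt ((x2 - x1) * (2 * l)) * nrm G"
  have DD: "\<bar>D y - D z\<bar> \<le> B" if "z \<in> {-l..l}" for z
  proof -
    have *: "\<bar>D y2 - D y1\<bar> \<le> B" if "-l \<le> y1" "y1 \<le> y2" "y2 \<le> l" for y1 y2
    proof -
      have "D y2 - D y1 = (LBINT p. ind ({x1..x2} \<times> {y1..y2}) p * G p)"
        using rect[OF x that] by (simp add: D_def)
      then have "\<bar>D y2 - D y1\<bar> \<le> sqrt ((x2 - x1) * (y2 - y1)) * nrm G"
        using rect_integral_bound[OF G_sq, of x1 x2 y1 y2] x that by simp
      also have "\<dots> \<le> B" unfolding B_def using x that
        by (intro mult_right_mono nrm_nonneg real_sqrt_le_mono mult_left_mono) auto
      finally show ?thesis .
    qed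
    show ?thesis using *[of y z] *[of z y] that y by (cases "y \<le> z") (auto simp: abs_minus_commute)
  qed
  have iv: "integrable lborel (\<lambda>y. ind {-l..l} y * (v (x, y) * eta l y))" if "x \<in> {0..pi}" for x
    by (intro integrable_continuous_Icc continuous_intros v_section that eta_cont)
  have ie: "integrable lborel (\<lambda>y. ind {-l..l} y * eta l y)"
    by (intro integrable_continuous_Icc eta_cont)
  have eq: "D y - (V x2 - V x1) = (LBINT z. ind {-l..l} z * eta l z * (D y - D z))"
  proof -
    have "(LBINT z. ind {-l..l} z * eta l z * (D y - D z)) =
      (LBINT z. D y * (ind {-l..l} z * eta l z) -
        (ind {-l..l} z * (v (x2, z) * eta l z) - ind {-l..l} z * (v (x1, z) * eta l z)))"
      by (intro Bochner_Integration.integral_cong) (auto simp: D_def algebra_simps)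
    also have "\<dots> = D y * (LBINT z. ind {-l..l} z * eta l z) - (V x2 - V x1)"
      unfolding V_def using iv[of x1] iv[of x2] ie x
      by (subst Bochner_Integration.integral_diff) auto
    finally show ?thesis using eta_1[OF l] by simp
  qed
  have "\<bar>D y - (V x2 - V x1)\<bar> \<le> (LBINT z. \<bar>ind {-l..l} z * eta l z * (D y - D z)\<bar>)"
    unfolding eq by (rule integral_abs_bound)
  also have "\<dots> \<le> (LBINT z. (ind {-l..l} z * eta l z) * B)"
  proof (rule integral_mono)
    have "integrable lborel (\<lambda>z. ind {-l..l} z * (eta l z * (D y - D z)))"
      unfolding D_def using x by (intro integrable_continuous_Icc continuous_intros v_section eta_cont) auto
    then show "integrable lborel (\<lambda>z. \<bar>ind {-l..l} z * eta l z * (D y - D z)\<bar>)"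
      using integrable_abs by (simp add: mult.assoc)
    show "integrable lborel (\<lambda>z. (ind {-l..l} z * eta l z) * B)" using ie by simp
    show "\<bar>ind {-l..l} z * eta l z * (D y - D z)\<bar> \<le> (ind {-l..l} z * eta l z) * B" for z
      using DD[of z] eta_nonneg[OF l, of z] by (cases "z \<in> {-l..l}") (auto simp: abs_mult mult_left_mono)
  qed
  also have "\<dots> = B" using eta_1[OF l] by simp
  finally have "\<bar>D y\<bar> \<le> B + \<bar>V x2 - V x1\<bar>" by linarith
  also have "\<dots> \<le> B + (x2 - x1) * (2 * (LBINT t. \<bar>W t\<bar>))" using V_bound[OF x] by simp
  finally show ?thesis by (simp add: D_def B_def)
qed

end

section \<open>Reconstruction of the weak first derivatives\<close>

context plate_fun
begin

lemma G_rect_int: "integrable lborel (\<lambda>p. ind ({a..b} \<times> {c..d}) p * G p)"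
  using integrable_mult_indicator[OF _ G_int, of "{a..b} \<times> {c..d}"] by simp

text \<open>\<open>P\<close> is \<open>v\<^sub>x\<close> up to its unknown values on the bottom edge \<open>y = -l\<close>; these are recovered as
  \<open>Q - Pbar\<close> because the weighted mean of \<open>v\<^sub>x\<close> in \<open>y\<close> must be \<open>Q\<close>.\<close>

definition P :: "real \<times> real \<Rightarrow> real" where
  "P q = ind (UNIV \<times> {-l..l}) q * (LBINT t. ind {-l..snd q} t * G (fst q, t))"

definition Pbar :: "real \<times> real \<Rightarrow> real" where
  "Pbar q = ind (UNIV \<times> {-l..l}) q * (LBINT t. eta l t * P (fst q, t))"

text \<open>The idle factors 1 and -1 give the term the shape of
  \<open>sq_integrable_lincomb\<close>.\<close>

definition vx :: "real \<times> real \<Rightarrow> real" where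
  "vx q = 1 * (ind K q * Q (fst q)) + 1 * (P q + (-1) * Pbar q)"

lemma triangle_kernel: "(\<lambda>p. ind {a..fst p} (snd p) :: real) \<in> borel_measurable (borel :: (real \<times> real) measure)"
proof -
  have "(\<lambda>p. ind {a..fst p} (snd p) :: real) = ind {p. a \<le> snd p \<and> snd p \<le> fst p}"
    by (auto simp: indicator_def)
  moreover have "{p :: real \<times> real. a \<le> snd p \<and> snd p \<le> fst p} \<in> sets borel"
    by measurable
  ultimately show ?thesis by simp
qed

lemma P_sq: "sq_integrable P"
proof -
  have "sq_integrable (\<lambda>q. ind (UNIV \<times> {-l..l}) q * (LBINT t. (\<lambda>p. ind {-l..fst p} (snd p)) (snd q, t) * G (fst q, t)))"
    by (rule sq_integrable_section_integral[OF G_sq _ _ triangle_kernel, where B=1])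
      (use l in \<open>auto simp: indicator_def intro!: G_supp\<close>)
  then show ?thesis by (simp add: P_def[abs_def])
qed

lemma Pbar_sq: "sq_integrable Pbar"
proof -
  have "sq_integrable (\<lambda>q. ind (UNIV \<times> {-l..l}) q * (LBINT t. (\<lambda>p. eta l (snd p)) (snd q, t) * P (fst q, t)))"
    by (rule sq_integrable_section_integral[OF P_sq _ _ _ eta_bound[OF l]])
      (use l in \<open>auto simp: P_def indicator_def\<close>)
  then show ?thesis by (simp add: Pbar_def[abs_def])
qed

lemma vx_sq: "sq_integrable vx"
proof -
  have "sq_integrable (\<lambda>q. ind K q * Q (fst q))"
  proof -
    have "integrable lborel (\<lambda>q. ind K q * (Q (fst q))\<^sup>2)"
    proof (rule integrable_indicator_bounded[where B="(2 * (LBINT t. \<bar>W t\<bar>))\<^sup>2"])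
      show "\<bar>(Q (fst q))\<^sup>2\<bar> \<le> (2 * (LBINT t. \<bar>W t\<bar>))\<^sup>2" for q :: "real \<times> real"
        using power_mono[OF Q_bound[of "fst q"], of 2] by simp
    qed (auto intro!: bounded_rect)
    moreover have "(\<lambda>q. (ind K q * Q (fst q))\<^sup>2) = (\<lambda>q. ind K q * (Q (fst q))\<^sup>2)"
      by (auto simp: indicator_def)
    ultimately show ?thesis by (simp add: sq_integrable_def)
  qed
  moreover have "sq_integrable (\<lambda>q. P q + (-1) * Pbar q)"
    using sq_integrable_lincomb[OF P_sq Pbar_sq, of 1 "-1"] by simp
  ultimately show ?thesis
    unfolding vx_def[abs_def] by (rule sq_integrable_lincomb)
qed

lemma G_outside: "x \<notin> {0..pi} \<Longrightarrow> G (x, y) = 0" "y \<notin> {-l..l} \<Longrightarrow> G (x, y) = 0"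
  by (auto intro: G_supp)

lemma P_zero_x: "x \<notin> {0..pi} \<Longrightarrow> P (x, y) = 0"
  unfolding P_def fst_conv by (subst G_outside(1)) auto

lemma P_supp: "p \<notin> K \<Longrightarrow> P p = 0"
  by (cases p, cases "fst p \<in> {0..pi}") (auto simp: P_zero_x simp del: atLeastAtMost_iff, simp add: P_def)

lemma P_int: "integrable lborel P"
  by (rule sq_integrable_supp_integrable[OF P_sq bounded_rect rect_sets P_supp])

lemma Pbar_zero_x: "x \<notin> {0..pi} \<Longrightarrow> Pbar (x, y) = 0"
  unfolding Pbar_def fst_conv by (subst P_zero_x) auto

lemma Pbar_supp: "p \<notin> K \<Longrightarrow> Pbar p = 0"
  by (cases p, cases "fst p \<in> {0..pi}") (auto simp: Pbar_zero_x simp del: atLeastAtMost_iff, simp add: Pbar_def)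

lemma vx_supp: "p \<notin> K \<Longrightarrow> vx p = 0"
  by (simp add: vx_def P_supp Pbar_supp)

lemma P_eta_int: "integrable lborel (\<lambda>p. P p * eta l (snd p))"
  by (rule integrable_mult_bounded[OF P_int _ eta_bound[OF l]]) measurable

text \<open>Fubini for \<open>P\<close> would give this for almost every \<open>y\<close> only. For
  each fixed \<open>y\<close> the section is itself a partial integral of \<open>G\<close> over a
  rectangle, so it holds on every line.\<close>

lemma P_section_int: "y \<in> {-l..l} \<Longrightarrow> integrable lborel (\<lambda>s. P (s, y))"
proof -
  assume y: "y \<in> {-l..l}"
  have "(\<lambda>s. LBINT t. ind ({0..pi} \<times> {-l..y}) (s, t) * G (s, t)) = (\<lambda>s. P (s, y))"
  proof
    fix s
    show "(LBINT t. ind ({0..pi} \<times> {-l..y}) (s, t) * G (s, t)) = P (s, y)"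
    proof (cases "s \<in> {0..pi}")
      case True
      then show ?thesis using y by (simp add: P_def indicator_times)
    next
      case False
      then show ?thesis by (simp add: P_zero_x indicator_times)
    qed
  qed
  then show ?thesis using lborel_fubini(3)[OF G_rect_int, of 0 pi "-l" y] by simp
qed

lemma Pbar_section_int: "y \<in> {-l..l} \<Longrightarrow> integrable lborel (\<lambda>s. Pbar (s, y))"
proof -
  assume y: "y \<in> {-l..l}"
  have "(\<lambda>s. LBINT t. P (s, t) * eta l t) = (\<lambda>s. Pbar (s, y))"
    unfolding Pbar_def using y by (simp add: mult.commute)
  then show ?thesis using lborel_fubini(3)[OF P_eta_int] by simp
qed

lemma Q_section_int: "integrable lborel (\<lambda>s. ind {0..x} s * Q s)"
  by (rule integrable_indicator_bounded[OF Q_meas _ _ Q_bound]) auto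

lemma v_P:
  assumes "x \<in> {0..pi}" "y \<in> {-l..l}"
  shows "v (x, y) = v (x, -l) + (LBINT s. ind {0..x} s * P (s, y))"
proof -
  have "v (x, y) - v (x, -l) = (LBINT s. LBINT t. ind ({0..x} \<times> {-l..y}) (s, t) * G (s, t))"
    unfolding lborel_fubini(1)[OF G_rect_int] using assms l by (intro diff_y) auto
  also have "\<dots> = (LBINT s. LBINT t. ind {0..x} s * (ind {-l..y} t * G (s, t)))"
    by (simp add: indicator_times mult.assoc)
  also have "\<dots> = (LBINT s. ind {0..x} s * P (s, y))"
    using assms by (simp add: P_def)
  finally show ?thesis by simp
qed

text \<open>This is \<open>v_P\<close> averaged with the weight \<open>eta l\<close> of mass one.
  The height \<open>y\<close> is arbitrary because \<open>Pbar\<close> does not vary with it inside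
  the strip.\<close>

lemma V_Pbar:
  assumes "x \<in> {0..pi}" "y \<in> {-l..l}"
  shows "V x = v (x, -l) + (LBINT s. ind {0..x} s * Pbar (s, y))"
proof -
  define f where "f = (\<lambda>p. ind {0..x} (fst p) * (P p * eta l (snd p)))"
  have if': "integrable lborel f"
  proof -
    have "integrable lborel (\<lambda>p. P p * eta l (snd p) * ind {0..x} (fst p))"
      by (rule integrable_mult_bounded[OF P_eta_int, where B=1]) (auto simp: indicator_def[of _ "fst _"])
    then show ?thesis by (simp add: f_def mult.commute)
  qed
  have ie: "integrable lborel (\<lambda>y. v (x, -l) * (ind {-l..l} y * eta l y))"
    by (intro integrable_mult_right integrable_continuous_Icc eta_cont)
  have "V x = (LBINT y. v (x, -l) * (ind {-l..l} y * eta l y) + (LBINT s. f (s, y)))"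
    unfolding V_def
  proof (rule Bochner_Integration.integral_cong)
    fix y
    show "ind {-l..l} y * (v (x, y) * eta l y) = v (x, -l) * (ind {-l..l} y * eta l y) + (LBINT s. f (s, y))"
    proof (cases "y \<in> {-l..l}")
      case True
      have "(LBINT s. f (s, y)) = eta l y * (LBINT s. ind {0..x} s * P (s, y))"
        by (simp add: f_def mult_ac flip: Bochner_Integration.integral_mult_right_zero)
      then show ?thesis using v_P[OF assms(1) True] True by (simp add: algebra_simps)
    next
      case False
      then show ?thesis by (simp add: f_def P_def)
    qed
  qed simp
  also have "\<dots> = v (x, -l) * 1 + (LBINT y. LBINT s. f (s, y))"
    using ie lborel_fubini(4)[OF if'] eta_1[OF l] by (subst Bochner_Integration.integral_add) auto
  also have "(LBINT y. LBINT s. f (s, y)) = (LBINT s. LBINT y. f (s, y))"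
    using lborel_fubini(1,2)[OF if'] by simp
  also have "\<dots> = (LBINT s. ind {0..x} s * Pbar (s, y))"
  proof (rule Bochner_Integration.integral_cong)
    fix s
    have "(LBINT y. f (s, y)) = (LBINT y. ind {0..x} s * (eta l y * P (s, y)))"
      by (simp add: f_def mult_ac)
    then show "(LBINT y. f (s, y)) = ind {0..x} s * Pbar (s, y)"
      using assms(2) by (simp add: Pbar_def)
  qed simp
  finally show ?thesis by simp
qed

text \<open>Subtracting \<open>V_Pbar\<close> from \<open>v_P\<close> eliminates the bottom value
  \<open>v (x, -l)\<close>, and \<open>V x\<close> is the integral of \<open>Q\<close> since
  \<open>V\<close> vanishes at 0.\<close>

lemma v_vx:
  assumes "x \<in> {0..pi}" "y \<in> {-l..l}"
  shows "v (x, y) = 0 + (LBINT s. ind {0..x} s * vx (s, y))"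
proof -
  have i: "integrable lborel (\<lambda>s. ind {0..x} s * P (s, y))" "integrable lborel (\<lambda>s. ind {0..x} s * Pbar (s, y))"
    using integrable_mult_indicator[OF _ P_section_int[OF assms(2)], of "{0..x}"]
      integrable_mult_indicator[OF _ Pbar_section_int[OF assms(2)], of "{0..x}"] by simp_all
  have "(LBINT s. ind {0..x} s * vx (s, y))
    = (LBINT s. ind {0..x} s * Q s + (ind {0..x} s * P (s, y) - ind {0..x} s * Pbar (s, y)))"
    using assms by (intro Bochner_Integration.integral_cong) (auto simp: vx_def indicator_def)
  also have "\<dots> = (LBINT s. ind {0..x} s * Q s) + ((LBINT s. ind {0..x} s * P (s, y)) - (LBINT s. ind {0..x} s * Pbar (s, y)))"
    using i Q_section_int by simp
  also have "(LBINT s. ind {0..x} s * Q s) = V x"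
    using Q_diff[of 0 x] assms V_0 by simp
  finally show ?thesis using v_P[OF assms] V_Pbar[OF assms] by simp
qed

lemma v_meas_int: "integrable lborel (\<lambda>p. ind K p * v p)"
  by (rule integrable_continuous_rect[OF v])

text \<open>On almost every horizontal line \<open>v\<close> is the primitive of an integrable
  section of \<open>vx\<close> starting from 0. Integrate by parts against an arbitrary test
  function on that line, then integrate in \<open>y\<close>.\<close>

lemma weak_first_x: "\<exists>h. L2 (Omega l) h \<and> weak_deriv (Omega l) v 1 0 h"
proof (intro exI conjI)
  have vx_int: "integrable lborel vx"
    by (rule sq_integrable_supp_integrable[OF vx_sq bounded_rect rect_sets vx_supp])
  show L2: "L2 (Omega l) vx"
    unfolding L2_iff zext_def[abs_def] by (rule sq_integrable_mult_indicator[OF vx_sq Omega_sets])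
  show "weak_deriv (Omega l) v 1 0 vx"
    unfolding weak_deriv_iff[OF vL2 L2]
  proof (intro allI impI)
    fix \<phi> assume T: "test_fun (Omega l) \<phi>"
    note d = Dmulti_test(2)[OF T, of _ 1 0] and z = test_fun_bounds[OF T]
    have [measurable]: "Dmulti 1 0 \<phi> \<in> borel_measurable borel" "\<phi> \<in> borel_measurable borel"
      using Dmulti_test(1)[OF T] z(1) by blast+
    obtain B1 where B1: "\<And>p. \<bar>Dmulti 1 0 \<phi> p\<bar> \<le> B1" using Dmulti_test(3)[OF T] by blast
    obtain B2 where B2: "\<And>p. \<bar>\<phi> p\<bar> \<le> B2" using z(3) by blast
    have i1: "integrable lborel (\<lambda>p. ind K p * v p * Dmulti 1 0 \<phi> p)"
      by (rule integrable_mult_bounded[OF v_meas_int _ B1]) measurable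
    have i2: "integrable lborel (\<lambda>p. vx p * \<phi> p)"
      by (rule integrable_mult_bounded[OF vx_int _ B2]) measurable
    have "(LBINT p. zext l v p * Dmulti 1 0 \<phi> p) = (LBINT p. ind K p * v p * Dmulti 1 0 \<phi> p)"
      using d by (intro Bochner_Integration.integral_cong) (auto simp: zext_def indicator_def Omega_def)
    also have "\<dots> = (LBINT y. LBINT x. ind K (x, y) * v (x, y) * Dmulti 1 0 \<phi> (x, y))"
      using lborel_fubini(2)[OF i1] by simp
    also have "\<dots> = (LBINT y. - (LBINT x. vx (x, y) * \<phi> (x, y)))"
    proof (rule integral_cong_AE)
      show "(\<lambda>y. LBINT x. ind K (x, y) * v (x, y) * Dmulti 1 0 \<phi> (x, y)) \<in> borel_measurable lborel"
        using lborel_fubini(4)[OF i1] by (rule borel_measurable_integrable)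
      show "(\<lambda>y. - (LBINT x. vx (x, y) * \<phi> (x, y))) \<in> borel_measurable lborel"
        using lborel_fubini(4)[OF i2] by (intro borel_measurable_uminus borel_measurable_integrable)
      show "AE y in lborel. (LBINT x. ind K (x, y) * v (x, y) * Dmulti 1 0 \<phi> (x, y)) = - (LBINT x. vx (x, y) * \<phi> (x, y))"
        using lborel_fubini(6)[OF vx_int]
      proof eventually_elim
        case (elim y)
        show ?case
        proof (cases "y \<in> {-l<..<l}")
          case True
          have "(LBINT x. ind {0..pi} x * (v (x, y) * Dmulti 1 0 \<phi> (x, y))) = - (LBINT x. vx (x, y) * \<phi> (x, y))"
          proof (rule integral_by_parts_primitive[OF elim, of 0 pi _ 0])
            show "v (x, y) = 0 + (LBINT t. ind {0..x} t * vx (t, y))" if "x \<in> {0..pi}" for x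
              by (rule v_vx) (use that True in auto)
            show "((\<lambda>x. \<phi> (x, y)) has_real_derivative Dmulti 1 0 \<phi> (x, y)) (at x)" for x
              by (rule test_fun_DERIV(1)[OF T])
            have "continuous_on UNIV (Dmulti 1 0 \<phi>)"
              unfolding Dmulti_def by (rule test_fun_pds_continuous[OF T]) auto
            then show "continuous_on UNIV (\<lambda>x. Dmulti 1 0 \<phi> (x, y))"
              by (rule continuous_on_compose2) (auto intro!: continuous_intros)
            show "\<phi> (x, y) = 0" if "x \<notin> {0<..<pi}" for x
              using z(2)[of "(x, y)"] that by (auto simp: Omega_def)
          qed auto
          then show ?thesis using True by (simp add: indicator_times mult.assoc)
        next
          case False
          then have "Dmulti 1 0 \<phi> (x, y) = 0" "\<phi> (x, y) = 0" for x
            using d[of "(x, y)"] z(2)[of "(x, y)"] by (auto simp: Omega_def)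
          then show ?thesis by simp
        qed
      qed
    qed
    also have "\<dots> = - (LBINT p. vx p * \<phi> p)"
      using lborel_fubini(2)[OF i2] by simp
    also have "(LBINT p. vx p * \<phi> p) = (LBINT p. zext l vx p * \<phi> p)"
      using z(2) by (intro Bochner_Integration.integral_cong) (auto simp: zext_def indicator_def)
    finally show "(LBINT p. zext l v p * Dmulti 1 0 \<phi> p) = (-1) ^ (1 + 0) * (LBINT p. zext l vx p * \<phi> p)" by simp
  qed
qed

text \<open>The derivative \<open>v\<^sub>y\<close> recovered from \<open>v\<^sub>x\<^sub>y\<close>.
  In contrast to \<open>vx\<close> there is no correction term: \<open>v\<close> vanishes along
  \<open>x = 0\<close>, so \<open>v\<^sub>y\<close> starts from 0 there.\<close>

definition vy :: "real \<times> real \<Rightarrow> real" where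
  "vy q = ind ({0..pi} \<times> UNIV) q * (LBINT s. ind {0..fst q} s * G (s, snd q))"

lemma vy_sq: "sq_integrable vy"
proof -
  \<comment> \<open>The section lemma integrates along the second coordinate, so the coordinates are
    exchanged before and after.\<close>
  have "sq_integrable (\<lambda>q. ind (UNIV \<times> {0..pi}) q * (LBINT t. (\<lambda>p. ind {0..fst p} (snd p)) (snd q, t) * G (snd (fst q, t), fst (fst q, t))))"
    by (rule sq_integrable_section_integral[OF sq_integrable_swap[OF G_sq] _ _ triangle_kernel, where B=1])
      (auto simp: indicator_def intro!: G_supp)
  from sq_integrable_swap[OF this]
  have A: "sq_integrable (\<lambda>p. ind (UNIV \<times> {0..pi}) (snd p, fst p) * (LBINT t. ind {0..fst p} t * G (t, snd p)))"
    by simp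
  have B: "ind (UNIV \<times> {0..pi}) (snd p, fst p) = (ind ({0..pi} \<times> UNIV) p :: real)" for p
    by (cases p) (auto simp: indicator_def)
  show ?thesis using A unfolding B vy_def[abs_def] .
qed

lemma vy_supp: "p \<notin> K \<Longrightarrow> vy p = 0"
proof (cases "snd p \<in> {-l..l}")
  case False
  then show ?thesis unfolding vy_def by (subst G_outside(2)) auto
next
  case True
  assume "p \<notin> K"
  then show ?thesis using True by (cases p) (auto simp: vy_def indicator_def)
qed

lemma v_vy:
  assumes "x \<in> {0..pi}" "y \<in> {-l..l}"
  shows "v (x, y) = v (x, -l) + (LBINT t. ind {-l..y} t * vy (x, t))"
proof -
  have "v (x, y) - v (x, -l) = (LBINT t. LBINT s. ind ({0..x} \<times> {-l..y}) (s, t) * G (s, t))"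
    unfolding lborel_fubini(2)[OF G_rect_int] using assms l by (intro diff_y) auto
  also have "\<dots> = (LBINT t. LBINT s. ind {-l..y} t * (ind {0..x} s * G (s, t)))"
    by (simp add: indicator_times mult.left_commute mult.assoc)
  also have "\<dots> = (LBINT t. ind {-l..y} t * vy (x, t))"
    using assms by (simp add: vy_def)
  finally show ?thesis by simp
qed

lemma weak_first_y: "\<exists>h. L2 (Omega l) h \<and> weak_deriv (Omega l) v 0 1 h"
proof (intro exI conjI)
  have vy_int: "integrable lborel vy"
    by (rule sq_integrable_supp_integrable[OF vy_sq bounded_rect rect_sets vy_supp])
  show L2: "L2 (Omega l) vy"
    unfolding L2_iff zext_def[abs_def] by (rule sq_integrable_mult_indicator[OF vy_sq Omega_sets])
  show "weak_deriv (Omega l) v 0 1 vy"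
    unfolding weak_deriv_iff[OF vL2 L2]
  proof (intro allI impI)
    fix \<phi> assume T: "test_fun (Omega l) \<phi>"
    note d = Dmulti_test(2)[OF T, of _ 0 1] and z = test_fun_bounds[OF T]
    have [measurable]: "Dmulti 0 1 \<phi> \<in> borel_measurable borel" "\<phi> \<in> borel_measurable borel"
      using Dmulti_test(1)[OF T] z(1) by blast+
    obtain B1 where B1: "\<And>p. \<bar>Dmulti 0 1 \<phi> p\<bar> \<le> B1" using Dmulti_test(3)[OF T] by blast
    obtain B2 where B2: "\<And>p. \<bar>\<phi> p\<bar> \<le> B2" using z(3) by blast
    have i1: "integrable lborel (\<lambda>p. ind K p * v p * Dmulti 0 1 \<phi> p)"
      by (rule integrable_mult_bounded[OF v_meas_int _ B1]) measurable
    have i2: "integrable lborel (\<lambda>p. vy p * \<phi> p)"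
      by (rule integrable_mult_bounded[OF vy_int _ B2]) measurable
    have "(LBINT p. zext l v p * Dmulti 0 1 \<phi> p) = (LBINT p. ind K p * v p * Dmulti 0 1 \<phi> p)"
      using d by (intro Bochner_Integration.integral_cong) (auto simp: zext_def indicator_def Omega_def)
    also have "\<dots> = (LBINT x. LBINT y. ind K (x, y) * v (x, y) * Dmulti 0 1 \<phi> (x, y))"
      using lborel_fubini(1)[OF i1] by simp
    also have "\<dots> = (LBINT x. - (LBINT y. vy (x, y) * \<phi> (x, y)))"
    proof (rule integral_cong_AE)
      show "(\<lambda>x. LBINT y. ind K (x, y) * v (x, y) * Dmulti 0 1 \<phi> (x, y)) \<in> borel_measurable lborel"
        using lborel_fubini(3)[OF i1] by (rule borel_measurable_integrable)
      show "(\<lambda>x. - (LBINT y. vy (x, y) * \<phi> (x, y))) \<in> borel_measurable lborel"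
        using lborel_fubini(3)[OF i2] by (intro borel_measurable_uminus borel_measurable_integrable)
      show "AE x in lborel. (LBINT y. ind K (x, y) * v (x, y) * Dmulti 0 1 \<phi> (x, y)) = - (LBINT y. vy (x, y) * \<phi> (x, y))"
        using lborel_fubini(5)[OF vy_int]
      proof eventually_elim
        case (elim x)
        show ?case
        proof (cases "x \<in> {0<..<pi}")
          case True
          have "(LBINT y. ind {-l..l} y * (v (x, y) * Dmulti 0 1 \<phi> (x, y))) = - (LBINT y. vy (x, y) * \<phi> (x, y))"
          proof (rule integral_by_parts_primitive[OF elim, of "-l" l _ "v (x, -l)"])
            show "v (x, y) = v (x, -l) + (LBINT t. ind {-l..y} t * vy (x, t))" if "y \<in> {-l..l}" for y
              by (rule v_vy) (use that True in auto)
            show "((\<lambda>y. \<phi> (x, y)) has_real_derivative Dmulti 0 1 \<phi> (x, y)) (at y)" for y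
              by (rule test_fun_DERIV(2)[OF T])
            have "continuous_on UNIV (Dmulti 0 1 \<phi>)"
              unfolding Dmulti_def by (rule test_fun_pds_continuous[OF T]) auto
            then show "continuous_on UNIV (\<lambda>y. Dmulti 0 1 \<phi> (x, y))"
              by (rule continuous_on_compose2) (auto intro!: continuous_intros)
            show "\<phi> (x, y) = 0" if "y \<notin> {-l<..<l}" for y
              using z(2)[of "(x, y)"] that by (auto simp: Omega_def)
          qed (use l in auto)
          then show ?thesis using True by (simp add: indicator_times mult.assoc)
        next
          case False
          then have "Dmulti 0 1 \<phi> (x, y) = 0" "\<phi> (x, y) = 0" for y
            using d[of "(x, y)"] z(2)[of "(x, y)"] by (auto simp: Omega_def)
          then show ?thesis by simp
        qed
      qed
    qed
    also have "\<dots> = - (LBINT p. vy p * \<phi> p)"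
      using lborel_fubini(1)[OF i2] by simp
    also have "(LBINT p. vy p * \<phi> p) = (LBINT p. zext l vy p * \<phi> p)"
      using z(2) by (intro Bochner_Integration.integral_cong) (auto simp: zext_def indicator_def)
    finally show "(LBINT p. zext l v p * Dmulti 0 1 \<phi> p) = (-1) ^ (0 + 1) * (LBINT p. zext l vy p * \<phi> p)" by simp
  qed
qed

lemma H2_v:
  assumes "L2 (Omega l) h" "weak_deriv (Omega l) v 0 2 h"
  shows "H2 (Omega l) v"
  unfolding H2_def
proof (intro conjI allI impI)
  show "L2 (Omega l) v" by (rule vL2)
  fix i j :: nat assume "i + j \<le> 2"
  then consider "i = 0" "j = 0" | "i = 1" "j = 0" | "i = 0" "j = 1" | "i = 2" "j = 0" | "i = 1" "j = 1" | "i = 0" "j = 2"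
    by linarith
  then show "\<exists>g. weak_deriv (Omega l) v i j g \<and> L2 (Omega l) g"
  proof cases
    case 1
    then show ?thesis using vL2 weak_deriv_iff[OF vL2 vL2, of 0 0] by auto
  qed (use weak_first_x weak_first_y g w assms in blast)+
qed

section \<open>The modulus of continuity\<close>

definition modc :: real where
  "modc = sqrt pi + sqrt (2 * l) + 2 * sqrt pi * (eta_bound l * sqrt (pi * (2 * l)))"

text \<open>Move first in \<open>y\<close>, then in \<open>x\<close>. The three terms of
  \<open>modc\<close> come from the step in \<open>y\<close>, from the rectangle part of the step in
  \<open>x\<close>, and from the Lipschitz mean \<open>V\<close>. The last one is linear in the
  distance and becomes a square root through \<open>b - a \<le> sqrt pi * sqrt d\<close>, as the
  width is at most \<open>pi\<close>.\<close>

lemma modulus: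
  assumes "p \<in> K" "q \<in> K"
  shows "\<bar>v p - v q\<bar> \<le> modc * (nrm G + nrm (zext l w)) * sqrt (dist p q)"
proof -
  obtain x1 y1 x2 y2 where pq: "p = (x1, y1)" "q = (x2, y2)" by (cases p, cases q)
  define d where "d = dist p q"
  have d: "\<bar>x1 - x2\<bar> \<le> d" "\<bar>y1 - y2\<bar> \<le> d" "d \<ge> 0"
    using dist_fst_le[of p q] dist_snd_le[of p q] by (auto simp: d_def pq dist_real_def)
  define E where "E = eta_bound l * sqrt (pi * (2 * l))"
  have E: "E \<ge> 0" unfolding E_def using eta_bound[OF l, of 0] l by (intro mult_nonneg_nonneg) auto
  have 1: "\<bar>v (x1, y1) - v (x1, y2)\<bar> \<le> sqrt pi * nrm G * sqrt d"
  proof -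
    have "\<bar>v (x1, y1) - v (x1, y2)\<bar> \<le> sqrt (pi * \<bar>y1 - y2\<bar>) * nrm G" using diff_y_bound[of x1 y2 y1] assms pq by auto
    also have "\<dots> \<le> sqrt (pi * d) * nrm G" using d by (intro mult_right_mono nrm_nonneg real_sqrt_le_mono) auto
    finally show ?thesis by (simp add: real_sqrt_mult mult_ac)
  qed
  have 2: "\<bar>v (x1, y2) - v (x2, y2)\<bar> \<le> (sqrt (2 * l) * nrm G + 2 * sqrt pi * E * nrm (zext l w)) * sqrt d"
  proof -
    have *: "\<bar>v (b, y2) - v (a, y2)\<bar> \<le> (sqrt (2 * l) * nrm G + 2 * sqrt pi * E * nrm (zext l w)) * sqrt d"
      if "0 \<le> a" "a \<le> b" "b \<le> pi" "b - a \<le> d" for a b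
    proof -
      have s: "sqrt (b - a) \<le> sqrt d" "sqrt (b - a) \<le> sqrt pi" using that by auto
      have "b - a = sqrt (b - a) * sqrt (b - a)" using that by simp
      also have "\<dots> \<le> sqrt pi * sqrt d" using s that by (intro mult_mono) auto
      finally have ba: "b - a \<le> sqrt pi * sqrt d" .
      have W: "2 * (LBINT t. \<bar>W t\<bar>) \<le> 2 * (E * nrm (zext l w))" using W_bound by (simp add: E_def)
      have "\<bar>v (b, y2) - v (a, y2)\<bar> \<le> sqrt ((b - a) * (2 * l)) * nrm G + (b - a) * (2 * (LBINT t. \<bar>W t\<bar>))"
        using diff_x_bound[OF that(1,2,3), of y2] assms pq by auto
      also have "\<dots> \<le> sqrt d * sqrt (2 * l) * nrm G + (sqrt pi * sqrt d) * (2 * (E * nrm (zext l w)))"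
        unfolding real_sqrt_mult[of "b - a"] using s ba W d that l E
        by (intro add_mono mult_mono mult_right_mono nrm_nonneg) (auto intro!: Bochner_Integration.integral_nonneg simp: nrm_nonneg)
      finally show ?thesis by (simp add: algebra_simps)
    qed
    show ?thesis using *[of x1 x2] *[of x2 x1] assms d pq by (cases "x1 \<le> x2") (auto simp: abs_minus_commute)
  qed
  have "\<bar>v p - v q\<bar> \<le> (sqrt pi * nrm G + sqrt (2 * l) * nrm G + 2 * sqrt pi * E * nrm (zext l w)) * sqrt d"
    using 1 2 unfolding pq by (simp add: algebra_simps)
  also have "\<dots> \<le> (modc * (nrm G + nrm (zext l w))) * sqrt d"
  proof (rule mult_right_mono)
    have "0 \<le> (sqrt pi + sqrt (2 * l)) * nrm (zext l w) + 2 * sqrt pi * E * nrm G"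
      using E l nrm_nonneg by (intro add_nonneg_nonneg mult_nonneg_nonneg) auto
    then show "sqrt pi * nrm G + sqrt (2 * l) * nrm G + 2 * sqrt pi * E * nrm (zext l w) \<le> modc * (nrm G + nrm (zext l w))"
      by (simp add: modc_def E_def algebra_simps)
  qed (use d in simp)
  finally show ?thesis by (simp add: d_def)
qed

end

section \<open>Completeness\<close>

abbreviation dist2 :: "('a::euclidean_space \<Rightarrow> real) \<Rightarrow> ('a \<Rightarrow> real) \<Rightarrow> real" where
  "dist2 f g \<equiv> LBINT p. (f p - g p)\<^sup>2"

abbreviation edist :: "real \<Rightarrow> real \<Rightarrow> (real \<times> real \<Rightarrow> real) \<Rightarrow> (real \<times> real \<Rightarrow> real) \<Rightarrow> real" where
  "edist l \<sigma> u v \<equiv> ip l \<sigma> (\<lambda>p. u p - v p) (\<lambda>p. u p - v p)"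

lemma nn_integral_sq:
  assumes "sq_integrable f"
  shows "(\<integral>\<^sup>+p. ennreal ((f p)\<^sup>2) \<partial>lborel) = ennreal (LBINT p. (f p)\<^sup>2)"
  using assms by (intro nn_integral_eq_integral) (auto simp: sq_integrable_def)

lemma sq_integrable_diff: "sq_integrable f \<Longrightarrow> sq_integrable g \<Longrightarrow> sq_integrable (\<lambda>p. f p - g p)"
  using sq_integrable_lincomb[of f g 1 "-1"] by simp

text \<open>On the bounded set \<open>A\<close> the sequence is also Cauchy in L1, hence a
  subsequence converges almost everywhere. Fatou along this subsequence bounds the distance of each
  late \<open>f n\<close> to the limit, so the whole sequence converges.\<close>

lemma sq_integrable_complete:
  fixes f :: "nat \<Rightarrow> 'a::euclidean_space \<Rightarrow> real"
  assumes f: "\<And>n. sq_integrable (f n)" and A: "A \<in> sets borel" "bounded A"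
    and supp: "\<And>n p. p \<notin> A \<Longrightarrow> f n p = 0"
    and cauchy: "\<And>e. e > 0 \<Longrightarrow> \<exists>N. \<forall>m\<ge>N. \<forall>n\<ge>N. dist2 (f m) (f n) < e"
  obtains g where "sq_integrable g" "\<And>p. p \<notin> A \<Longrightarrow> g p = 0"
    "(\<lambda>n. dist2 (f n) g) \<longlonglongrightarrow> 0"
proof -
  have [measurable]: "f n \<in> borel_measurable borel" for n using f by (auto simp: sq_integrable_def)
  note sA = sq_integrable_indicator[OF A(1) emeasure_bounded_lt[OF A(2)]]
  have fi: "integrable lborel (f n)" for n
    by (rule sq_integrable_supp_integrable[OF f A(2,1) supp])
  define c where "c = nrm (ind A :: 'a \<Rightarrow> real)"
  have L1: "(LBINT p. norm (f m p - f n p)) \<le> c * sqrt (dist2 (f m) (f n))" for m n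
  proof -
    have s: "sq_integrable (\<lambda>p. \<bar>f m p - f n p\<bar>)"
      using sq_integrable_diff[OF f f] by (simp add: sq_integrable_def)
    have "(\<lambda>p. ind A p * \<bar>f m p - f n p\<bar>) = (\<lambda>p. norm (f m p - f n p))"
    proof
      show "ind A p * \<bar>f m p - f n p\<bar> = norm (f m p - f n p)" for p
        using supp[of p] by (cases "p \<in> A") auto
    qed
    then show ?thesis using Cauchy_Schwarz_integral[OF sA s] by (simp add: c_def nrm_def)
  qed
  have c: "c \<ge> 0" by (simp add: c_def nrm_nonneg)
  have "\<exists>N. \<forall>i\<ge>N. \<forall>j\<ge>N. (LBINT p. norm (f i p - f j p)) < e" if "e > 0" for e
  proof -
    obtain N where N: "\<And>m n. m \<ge> N \<Longrightarrow> n \<ge> N \<Longrightarrow> dist2 (f m) (f n) < (e / (c + 1))\<^sup>2"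
    proof -
      have "(e / (c + 1))\<^sup>2 > 0" using \<open>e > 0\<close> c by simp
      from cauchy[OF this] show ?thesis using that by blast
    qed
    have "(LBINT p. norm (f i p - f j p)) < e" if "i \<ge> N" "j \<ge> N" for i j
    proof -
      have "sqrt (dist2 (f i) (f j)) \<le> e / (c + 1)"
        using N[OF that] \<open>e > 0\<close> c by (intro real_le_lsqrt) auto
      then have "c * sqrt (dist2 (f i) (f j)) \<le> c * (e / (c + 1))" using c by (intro mult_left_mono)
      also have "\<dots> < e" using \<open>e > 0\<close> c by (simp add: field_simps)
      finally show ?thesis using L1[of i j] by linarith
    qed
    then show ?thesis by blast
  qed
  then obtain r where r: "strict_mono r" "AE p in lborel. Cauchy (\<lambda>i. f (r i) p)"
    using cauchy_L1_AE_cauchy_subseq[of lborel f, OF fi] by blast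
  \<comment> \<open>The indicator makes \<open>g\<close> vanish everywhere outside \<open>A\<close>,
    not merely almost everywhere.\<close>
  define g where "g p = ind A p * lim (\<lambda>i. f (r i) p)" for p
  have g: "g \<in> borel_measurable borel"
    unfolding g_def[abs_def] using A(1) by measurable
  have lim: "AE p in lborel. (\<lambda>i. f (r i) p) \<longlonglongrightarrow> g p"
    using r(2)
  proof eventually_elim
    case (elim p)
    then have "(\<lambda>i. f (r i) p) \<longlonglongrightarrow> lim (\<lambda>i. f (r i) p)"
      by (simp add: Cauchy_convergent convergent_LIMSEQ_iff[symmetric])
    then show ?case
      using supp[of p] by (cases "p \<in> A") (auto simp: g_def)
  qed
  have key: "(\<integral>\<^sup>+p. ennreal ((f n p - g p)\<^sup>2) \<partial>lborel) \<le> ennreal e"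
    if N: "\<And>m. m \<ge> N \<Longrightarrow> dist2 (f n) (f m) < e" for n N e
  proof -
    have "(\<integral>\<^sup>+p. ennreal ((f n p - g p)\<^sup>2) \<partial>lborel) = (\<integral>\<^sup>+p. liminf (\<lambda>i. ennreal ((f n p - f (r i) p)\<^sup>2)) \<partial>lborel)"
    proof (rule nn_integral_cong_AE)
      show "AE p in lborel. ennreal ((f n p - g p)\<^sup>2) = liminf (\<lambda>i. ennreal ((f n p - f (r i) p)\<^sup>2))"
        using lim
      proof eventually_elim
        case (elim p)
        have "(\<lambda>i. ennreal ((f n p - f (r i) p)\<^sup>2)) \<longlonglongrightarrow> ennreal ((f n p - g p)\<^sup>2)"
          by (intro tendsto_intros elim)
        from lim_imp_Liminf[OF trivial_limit_sequentially this] show ?case by (rule sym)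
      qed
    qed
    also have "\<dots> \<le> liminf (\<lambda>i. \<integral>\<^sup>+p. ennreal ((f n p - f (r i) p)\<^sup>2) \<partial>lborel)"
      by (rule nn_integral_liminf) measurable
    also have "\<dots> \<le> liminf (\<lambda>i. ennreal e)"
    proof (rule Liminf_mono)
      show "\<forall>\<^sub>F i in sequentially. (\<integral>\<^sup>+p. ennreal ((f n p - f (r i) p)\<^sup>2) \<partial>lborel) \<le> ennreal e"
        using eventually_ge_at_top[of N]
      proof eventually_elim
        case (elim i)
        then have "r i \<ge> N" using seq_suble[OF r(1), of i] by linarith
        then show ?case
          unfolding nn_integral_sq[OF sq_integrable_diff[OF f f]] using N by (intro ennreal_leI) (simp add: less_imp_le)
      qed
    qed
    also have "\<dots> = ennreal e" by (simp add: Liminf_const)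
    finally show ?thesis .
  qed
  have sq: "sq_integrable (\<lambda>p. f n p - g p)" "dist2 (f n) g \<le> e"
    if N: "\<And>m. m \<ge> N \<Longrightarrow> dist2 (f n) (f m) < e" and e: "e > 0" for n N e
  proof -
    have k: "(\<integral>\<^sup>+p. ennreal ((f n p - g p)\<^sup>2) \<partial>lborel) \<le> ennreal e" by (rule key[OF N])
    have "(\<integral>\<^sup>+p. ennreal (norm ((f n p - g p)\<^sup>2)) \<partial>lborel) < \<infinity>"
      using k by (simp add: le_less_trans)
    then show s: "sq_integrable (\<lambda>p. f n p - g p)"
      unfolding sq_integrable_def using g by (auto intro!: integrableI_bounded)
    show "dist2 (f n) g \<le> e"
      using k unfolding nn_integral_sq[OF s] using e by simp
  qed
  obtain N1 where N1: "\<And>m. m \<ge> N1 \<Longrightarrow> dist2 (f N1) (f m) < 1"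
    using cauchy[of 1] zero_less_one by (metis order_refl)
  show ?thesis
  proof
    have "sq_integrable (\<lambda>p. f N1 p - (f N1 p - g p))"
      by (rule sq_integrable_diff[OF f sq(1)[OF N1]]) auto
    then show "sq_integrable g" by simp
    show "g p = 0" if "p \<notin> A" for p using that by (simp add: g_def)
    show "(\<lambda>n. dist2 (f n) g) \<longlonglongrightarrow> 0"
    proof (rule LIMSEQ_I)
      fix e :: real assume "0 < e"
      then obtain N where N: "\<And>m n. m \<ge> N \<Longrightarrow> n \<ge> N \<Longrightarrow> dist2 (f m) (f n) < e / 2"
      proof -
        have "e / 2 > 0" using \<open>0 < e\<close> by simp
        from cauchy[OF this] show ?thesis using that by blast
      qed
      have le: "dist2 (f n) g \<le> e / 2" if "n \<ge> N" for n
        by (rule sq(2)[of N]) (use N that \<open>0 < e\<close> in auto)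
      then show "\<exists>N. \<forall>n\<ge>N. norm (dist2 (f n) g - 0) < e"
      proof (intro exI[of _ N] allI impI)
        fix n assume "n \<ge> N"
        have "0 \<le> dist2 (f n) g" by (rule Bochner_Integration.integral_nonneg) simp
        moreover have "dist2 (f n) g \<le> e / 2" by (rule le) fact
        ultimately show "norm (dist2 (f n) g - 0) < e"
          using \<open>0 < e\<close> unfolding real_norm_def by linarith
      qed
    qed
  qed
qed

lemma sq_limit_pairing:
  assumes f: "\<And>n. sq_integrable (f n)" and g: "sq_integrable g" and \<phi>: "sq_integrable \<phi>"
    and lim: "(\<lambda>n. dist2 (f n) g) \<longlonglongrightarrow> 0"
  shows "(\<lambda>n. LBINT p. f n p * \<phi> p) \<longlonglongrightarrow> (LBINT p. g p * \<phi> p)"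
proof (rule LIM_zero_cancel, rule Lim_null_comparison)
  show "\<forall>\<^sub>F n in sequentially. norm ((LBINT p. f n p * \<phi> p) - (LBINT p. g p * \<phi> p))
      \<le> sqrt (dist2 (f n) g) * sqrt (LBINT p. (\<phi> p)\<^sup>2)"
  proof (rule always_eventually, rule allI)
    fix n
    have "(LBINT p. f n p * \<phi> p) - (LBINT p. g p * \<phi> p) = (LBINT p. (f n p - g p) * \<phi> p)"
      using sq_integrable_mult[OF f \<phi>] sq_integrable_mult[OF g \<phi>] by (simp add: left_diff_distrib)
    then show "norm ((LBINT p. f n p * \<phi> p) - (LBINT p. g p * \<phi> p))
      \<le> sqrt (dist2 (f n) g) * sqrt (LBINT p. (\<phi> p)\<^sup>2)"
      using Cauchy_Schwarz_integral[OF sq_integrable_diff[OF f g] \<phi>] by simp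
  qed
  have "(\<lambda>n. sqrt (dist2 (f n) g) * sqrt (LBINT p. (\<phi> p)\<^sup>2)) \<longlonglongrightarrow> sqrt 0 * sqrt (LBINT p. (\<phi> p)\<^sup>2)"
    by (intro tendsto_intros lim)
  then show "(\<lambda>n. sqrt (dist2 (f n) g) * sqrt (LBINT p. (\<phi> p)\<^sup>2)) \<longlonglongrightarrow> 0" by simp
qed

lemma sq_integrable_Dmulti:
  assumes "test_fun (Omega l) \<phi>"
  shows "sq_integrable (Dmulti i j \<phi>)"
proof -
  obtain B where B: "\<And>p. \<bar>Dmulti i j \<phi> p\<bar> \<le> B" using Dmulti_test(3)[OF assms] by blast
  have [measurable]: "Dmulti i j \<phi> \<in> borel_measurable borel" by (rule Dmulti_test(1)[OF assms])
  have "integrable lborel (\<lambda>p. ind (Omega l) p * (Dmulti i j \<phi> p)\<^sup>2)"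
  proof (rule integrable_indicator_bounded[where B="B\<^sup>2"])
    show "\<bar>(Dmulti i j \<phi> p)\<^sup>2\<bar> \<le> B\<^sup>2" for p using power_mono[OF B[of p], of 2] by simp
  qed (auto intro!: bounded_Omega)
  moreover have "(\<lambda>p. ind (Omega l) p * (Dmulti i j \<phi> p)\<^sup>2) = (\<lambda>p. (Dmulti i j \<phi> p)\<^sup>2)"
  proof
    show "ind (Omega l) p * (Dmulti i j \<phi> p)\<^sup>2 = (Dmulti i j \<phi> p)\<^sup>2" for p
      using Dmulti_test(2)[OF assms, of p i j] by (cases "p \<in> Omega l") auto
  qed
  ultimately show ?thesis by (simp add: sq_integrable_def)
qed

text \<open>Both sides of the defining identity are pairings with a fixed square integrable
  function, hence continuous under L2 convergence.\<close>

lemma weak_deriv_limit: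
  assumes "\<And>n. L2 (Omega l) (u n)" "\<And>n. L2 (Omega l) (h n)" "L2 (Omega l) u0" "L2 (Omega l) h0"
    and w: "\<And>n. weak_deriv (Omega l) (u n) i j (h n)"
    and u: "(\<lambda>n. dist2 (zext l (u n)) (zext l u0)) \<longlonglongrightarrow> 0"
    and h: "(\<lambda>n. dist2 (zext l (h n)) (zext l h0)) \<longlonglongrightarrow> 0"
  shows "weak_deriv (Omega l) u0 i j h0"
  unfolding weak_deriv_iff[OF assms(3,4)]
proof (intro allI impI)
  fix \<phi> assume T: "test_fun (Omega l) \<phi>"
  have 1: "(\<lambda>n. LBINT p. zext l (u n) p * Dmulti i j \<phi> p) \<longlonglongrightarrow> (LBINT p. zext l u0 p * Dmulti i j \<phi> p)"
    by (rule sq_limit_pairing[OF _ _ sq_integrable_Dmulti[OF T] u]) (use assms in \<open>auto simp: L2_iff\<close>)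
  have "(\<lambda>n. LBINT p. zext l (h n) p * \<phi> p) \<longlonglongrightarrow> (LBINT p. zext l h0 p * \<phi> p)"
    by (rule sq_limit_pairing[OF _ _ sq_integrable_Dmulti[OF T, of 0 0, simplified] h]) (use assms in \<open>auto simp: L2_iff\<close>)
  then have 2: "(\<lambda>n. (-1) ^ (i + j) * (LBINT p. zext l (h n) p * \<phi> p)) \<longlonglongrightarrow> (-1) ^ (i + j) * (LBINT p. zext l h0 p * \<phi> p)"
    by (rule tendsto_mult_left)
  have 3: "(LBINT p. zext l (u n) p * Dmulti i j \<phi> p) = (-1) ^ (i + j) * (LBINT p. zext l (h n) p * \<phi> p)" for n
    by (rule w[of n, unfolded weak_deriv_iff[OF assms(1,2)], rule_format, OF T])
  show "(LBINT p. zext l u0 p * Dmulti i j \<phi> p) = (-1) ^ (i + j) * (LBINT p. zext l h0 p * \<phi> p)"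
    by (rule LIMSEQ_unique[OF 1[unfolded 3] 2])
qed

section \<open>The space of admissible deflections\<close>

lemma H2star_H2: "v \<in> H2star l \<Longrightarrow> H2 (Omega l) v"
  by (simp add: H2star_def)

lemma ip_nonneg:
  assumes "0 < \<sigma>" "\<sigma> < 1" "H2 (Omega l) u"
  shows "0 \<le> ip l \<sigma> u u"
proof (rule order_trans[OF _ ip_lower[OF assms]])
  show "0 \<le> (1 - \<sigma>) * hess2 l u"
    using assms by (intro mult_nonneg_nonneg Bochner_Integration.integral_nonneg) auto
qed

lemma H2star_outside: "v \<in> H2star l \<Longrightarrow> p \<notin> closure (Omega l) \<Longrightarrow> v p = 0"
  and H2star_continuous: "v \<in> H2star l \<Longrightarrow> continuous_on (closure (Omega l)) v"
  and H2star_side: "v \<in> H2star l \<Longrightarrow> y \<in> {-l<..<l} \<Longrightarrow> v (0, y) = 0" "v \<in> H2star l \<Longrightarrow> y \<in> {-l<..<l} \<Longrightarrow> v (pi, y) = 0"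
  unfolding H2star_def by blast+

lemma H2star_lincomb:
  assumes "u \<in> H2star l" "v \<in> H2star l"
  shows "(\<lambda>p. a * u p + b * v p) \<in> H2star l"
  using assms H2_lincomb by (auto simp: H2star_def intro!: continuous_intros)

lemma zero_H2star: "(\<lambda>_. 0) \<in> H2star l"
proof -
  have e: "zext l (\<lambda>_. 0) = (\<lambda>_. 0)" by (rule ext) (simp add: zext_def)
  have L: "L2 (Omega l) (\<lambda>_. 0)" unfolding L2_iff e sq_integrable_def by simp
  have W: "weak_deriv (Omega l) (\<lambda>_. 0) i j (\<lambda>_. 0)" for i j
    unfolding weak_deriv_iff[OF L L] e by simp
  have "H2 (Omega l) (\<lambda>_. 0)" unfolding H2_def using L W by blast
  then show ?thesis unfolding H2star_def by simp
qed

lemma plate_fun_H2star: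
  assumes "l > 0" "v \<in> H2star l"
  shows "plate_fun l v (wd (Omega l) 1 1 v) (wd (Omega l) 2 0 v)"
  using assms wd_props[OF H2star_H2[OF assms(2)]]
  by unfold_locales (auto simp: H2star_def closure_Omega)

lemma H2star_modulus:
  assumes l: "l > 0" and \<sigma>: "0 < \<sigma>" "\<sigma> < 1"
  obtains C where "C > 0"
    "\<And>v p q. v \<in> H2star l \<Longrightarrow> p \<in> closure (Omega l) \<Longrightarrow> q \<in> closure (Omega l) \<Longrightarrow>
       \<bar>v p - v q\<bar> \<le> C * sqrt (ip l \<sigma> v v) * sqrt (dist p q)"
    "\<And>v p. v \<in> H2star l \<Longrightarrow> \<bar>v p\<bar> \<le> C * sqrt (ip l \<sigma> v v)"
proof -
  \<comment> \<open>\<open>modc\<close> depends on \<open>l\<close> alone, so one constant serves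
    every \<open>v\<close>. The 2 counts the two norms in the modulus, each at most the root of the
    energy over \<open>sqrt (1 - \<sigma>)\<close>.\<close>
  define C0 where "C0 = \<bar>plate_fun.modc l\<bar> * (2 / sqrt (1 - \<sigma>))"
  \<comment> \<open>\<open>sqrt pi\<close> bounds the root of the distance to the side
    \<open>x = 0\<close>, where \<open>v\<close> vanishes; the final 1 makes \<open>C\<close>
    positive.\<close>
  define C where "C = C0 * (1 + sqrt pi) + 1"
  have C0: "C0 \<ge> 0" using \<sigma> by (simp add: C0_def)
  have ip0: "ip l \<sigma> v v \<ge> 0" if "v \<in> H2star l" for v
    by (rule ip_nonneg[OF \<sigma> H2star_H2[OF that]])
  have 1: "\<bar>v p - v q\<bar> \<le> C0 * sqrt (ip l \<sigma> v v) * sqrt (dist p q)"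
    if v: "v \<in> H2star l" and p: "p \<in> closure (Omega l)" "q \<in> closure (Omega l)" for v p q
  proof -
    note pf = plate_fun_H2star[OF l v]
    note H = H2star_H2[OF v]
    have i: "integrable lborel (\<lambda>p. (Dx l i j v p)\<^sup>2)" if "i + j \<le> 2" for i j
      using Dx_sq[OF H that] by (simp add: sq_integrable_def)
    have n: "nrm (Dx l i j v) \<le> sqrt (ip l \<sigma> v v) / sqrt (1 - \<sigma>)"
      if "(LBINT p. (Dx l i j v p)\<^sup>2) \<le> hess2 l v" for i j
    proof -
      have "(1 - \<sigma>) * (LBINT p. (Dx l i j v p)\<^sup>2) \<le> ip l \<sigma> v v"
        using mult_left_mono[OF that, of "1 - \<sigma>"] ip_lower[OF \<sigma> H] \<sigma> by linarith
      then have "(LBINT p. (Dx l i j v p)\<^sup>2) \<le> ip l \<sigma> v v / (1 - \<sigma>)" using \<sigma> by (simp add: field_simps)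
      then show ?thesis unfolding nrm_def by (simp add: real_sqrt_divide[symmetric])
    qed
    have n11: "nrm (Dx l 1 1 v) \<le> sqrt (ip l \<sigma> v v) / sqrt (1 - \<sigma>)"
      by (rule n, rule integral_mono) (use i[of 2 0] i[of 1 1] i[of 0 2] in auto)
    have n20: "nrm (Dx l 2 0 v) \<le> sqrt (ip l \<sigma> v v) / sqrt (1 - \<sigma>)"
      by (rule n, rule integral_mono) (use i[of 2 0] i[of 1 1] i[of 0 2] in auto)
    have "\<bar>v p - v q\<bar> \<le> plate_fun.modc l * (nrm (Dx l 1 1 v) + nrm (Dx l 2 0 v)) * sqrt (dist p q)"
      unfolding Dx_def by (rule plate_fun.modulus[OF pf p[unfolded closure_Omega[OF l]]])
    also have "\<dots> \<le> \<bar>plate_fun.modc l\<bar> * (2 / sqrt (1 - \<sigma>) * sqrt (ip l \<sigma> v v)) * sqrt (dist p q)"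
    proof (intro mult_right_mono mult_mono)
      show "nrm (Dx l 1 1 v) + nrm (Dx l 2 0 v) \<le> 2 / sqrt (1 - \<sigma>) * sqrt (ip l \<sigma> v v)" using n11 n20 by simp
    qed (auto simp: nrm_nonneg add_nonneg_nonneg)
    finally show ?thesis by (simp add: C0_def mult_ac)
  qed
  show ?thesis
  proof
    show "C > 0" using C0 by (auto simp: C_def intro!: add_nonneg_pos)
    have CC: "C0 \<le> C" "C0 * sqrt pi \<le> C" using C0 by (auto simp: C_def algebra_simps)
    show "\<bar>v p - v q\<bar> \<le> C * sqrt (ip l \<sigma> v v) * sqrt (dist p q)"
      if v: "v \<in> H2star l" and p: "p \<in> closure (Omega l)" "q \<in> closure (Omega l)" for v p q
    proof -
      have "C0 * sqrt (ip l \<sigma> v v) * sqrt (dist p q) \<le> C * sqrt (ip l \<sigma> v v) * sqrt (dist p q)"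
        using CC ip0[OF v] by (intro mult_right_mono) auto
      then show ?thesis using 1[OF that] by linarith
    qed
    show "\<bar>v p\<bar> \<le> C * sqrt (ip l \<sigma> v v)" if v: "v \<in> H2star l" for v p
    proof (cases "p \<in> closure (Omega l)")
      case True
      obtain x y where p: "p = (x, y)" "x \<in> {0..pi}" "y \<in> {-l..l}"
        using True by (auto simp: closure_Omega[OF l])
      have "(0, y) \<in> closure (Omega l)" using p by (auto simp: closure_Omega[OF l])
      from 1[OF v True this] have "\<bar>v p\<bar> \<le> C0 * sqrt (ip l \<sigma> v v) * sqrt (dist p (0, y))"
        using plate_fun.side_closed(1)[OF plate_fun_H2star[OF l v] p(3)] by simp
      also have "\<dots> \<le> C0 * sqrt (ip l \<sigma> v v) * sqrt pi"
        using p C0 ip0[OF v] by (intro mult_left_mono real_sqrt_le_mono) (auto simp: dist_Pair_Pair dist_real_def)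
      also have "\<dots> = (C0 * sqrt pi) * sqrt (ip l \<sigma> v v)" by simp
      also have "\<dots> \<le> C * sqrt (ip l \<sigma> v v)" using CC ip0[OF v] by (intro mult_right_mono) auto
      finally show ?thesis .
    next
      case False
      have "0 \<le> C * sqrt (ip l \<sigma> v v)"
        using \<open>C > 0\<close> ip0[OF v] by (intro mult_nonneg_nonneg) auto
      then show ?thesis unfolding H2star_outside[OF v False] by simp
    qed
  qed
qed

text \<open>The supremum bound gives a uniform limit \<open>u\<close>, and completeness of L2 gives
  limits of the three second derivatives; closedness of weak derivatives identifies the latter as
  those of \<open>u\<close>. The missing first derivatives come from \<open>plate_fun.H2_v\<close>,
  and \<open>ip_upper\<close> returns from the second derivatives to the energy.\<close>

lemma H2star_complete:
  assumes l: "l > 0" and \<sigma>: "0 < \<sigma>" "\<sigma> < 1" and v: "\<And>n. v n \<in> H2star l"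
    and cauchy: "\<And>e. e > 0 \<Longrightarrow> \<exists>N. \<forall>m\<ge>N. \<forall>n\<ge>N. edist l \<sigma> (v m) (v n) < e"
  obtains u where "u \<in> H2star l" "(\<lambda>n. edist l \<sigma> (v n) u) \<longlonglongrightarrow> 0"
    "\<And>p. (\<lambda>n. v n p) \<longlonglongrightarrow> u p"
proof -
  let ?K = "closure (Omega l)"
  note H = H2star_H2[OF v]
  have diff: "(\<lambda>p. f p - g p) = (\<lambda>p. 1 * f p + (-1) * g p)" for f g :: "real \<times> real \<Rightarrow> real" by simp
  have vd: "(\<lambda>p. v m p - v n p) \<in> H2star l" for m n
    unfolding diff by (rule H2star_lincomb[OF v v])
  obtain C where C: "C > 0" "\<And>v p. v \<in> H2star l \<Longrightarrow> \<bar>v p\<bar> \<le> C * sqrt (ip l \<sigma> v v)"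
    using H2star_modulus[OF l \<sigma>] by metis
  have "uniformly_convergent_on ?K v"
  proof (rule Cauchy_uniformly_convergent, unfold uniformly_Cauchy_on_def, intro allI impI)
    fix e :: real assume e: "e > 0"
    obtain N where N: "\<And>m n. m \<ge> N \<Longrightarrow> n \<ge> N \<Longrightarrow> edist l \<sigma> (v m) (v n) < (e / C)\<^sup>2"
    proof -
      have "(e / C)\<^sup>2 > 0" using e C(1) by simp
      from cauchy[OF this] show ?thesis using that by blast
    qed
    have "dist (v m p) (v n p) < e" if "m \<ge> N" "n \<ge> N" for m n p
    proof -
      have "sqrt (edist l \<sigma> (v m) (v n)) < e / C"
        using N[OF that] e C by (intro real_less_lsqrt) auto
      then have "C * sqrt (edist l \<sigma> (v m) (v n)) < e" using C by (simp add: field_simps)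
      moreover have "\<bar>v m p - v n p\<bar> \<le> C * sqrt (edist l \<sigma> (v m) (v n))"
        by (rule C(2)[OF vd])
      ultimately show ?thesis unfolding dist_real_def by linarith
    qed
    then show "\<exists>M. \<forall>x\<in>?K. \<forall>m\<ge>M. \<forall>n\<ge>M. dist (v m x) (v n x) < e" by blast
  qed
  then have ul: "uniform_limit ?K v (\<lambda>p. lim (\<lambda>n. v n p)) sequentially"
    by (simp add: uniformly_convergent_uniform_limit_iff)
  \<comment> \<open>The pointwise limit is the continuous representative and has the value 0 outside
    the closure, as \<open>H2star\<close> prescribes.\<close>
  define u where "u p = lim (\<lambda>n. v n p)" for p
  have out: "v n p = 0" if "p \<notin> ?K" for n p by (rule H2star_outside[OF v that])
  have lim: "(\<lambda>n. v n p) \<longlonglongrightarrow> u p" for p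
  proof (cases "p \<in> ?K")
    case True
    then show ?thesis using tendsto_uniform_limitI[OF ul] by (simp add: u_def)
  qed (simp add: u_def out)
  have u_out: "u p = 0" if "p \<notin> ?K" for p using that by (simp add: u_def out)
  have cu: "continuous_on ?K u"
    unfolding u_def[abs_def]
    by (rule uniform_limit_theorem[OF _ ul]) (simp_all only: H2star_continuous[OF v] always_eventually trivial_limit_sequentially simp_thms)
  then have cu': "continuous_on ({0..pi} \<times> {-l..l}) u" unfolding closure_Omega[OF l] .
  have side: "u (0, y) = 0" "u (pi, y) = 0" if "y \<in> {-l<..<l}" for y
  proof -
    have "v n (0, y) = 0" "v n (pi, y) = 0" for n using H2star_side[OF v that] by blast+
    then show "u (0, y) = 0" "u (pi, y) = 0" unfolding u_def by simp_all
  qed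
  have uL2: "L2 (Omega l) u" by (rule L2_continuous[OF cu'])
  have vL2: "L2 (Omega l) (v n)" for n using H[of n] unfolding H2_def by blast
  have u_lim: "(\<lambda>n. dist2 (zext l (v n)) (zext l u)) \<longlonglongrightarrow> 0"
  proof (rule LIMSEQ_I)
    fix e :: real assume e: "0 < e"
    define \<mu> where "\<mu> = measure lborel (Omega l)"
    \<comment> \<open>Chosen so that \<open>d\<^sup>2 * \<mu>\<close> is at most
      \<open>e / 2\<close>; the 1 avoids a case distinction on \<mu>.\<close>
    define d where "d = sqrt (e / (\<mu> + 1) / 2)"
    have \<mu>: "\<mu> \<ge> 0" by (simp add: \<mu>_def)
    have d0: "d > 0" unfolding d_def using e \<mu> by simp
    have "d\<^sup>2 = e / (\<mu> + 1) / 2" unfolding d_def using e \<mu> by simp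
    then have "d\<^sup>2 * \<mu> = e / 2 * (\<mu> / (\<mu> + 1))" by simp
    also have "\<dots> \<le> e / 2 * 1" using e \<mu> by (intro mult_left_mono) auto
    finally have d: "d > 0" "d\<^sup>2 * \<mu> < e" using e d0 by linarith+
    have "\<forall>\<^sub>F n in sequentially. \<forall>p\<in>?K. dist (v n p) (u p) < d"
      using ul d(1) unfolding uniform_limit_iff u_def by blast
    then obtain N where N: "\<And>n p. n \<ge> N \<Longrightarrow> p \<in> ?K \<Longrightarrow> \<bar>v n p - u p\<bar> < d"
      by (auto simp: eventually_sequentially dist_real_def)
    have "norm (dist2 (zext l (v n)) (zext l u) - 0) < e" if n: "n \<ge> N" for n
    proof -
      have "dist2 (zext l (v n)) (zext l u) \<le> (LBINT p. d\<^sup>2 * ind (Omega l) p)"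
      proof (rule integral_mono)
        show "integrable lborel (\<lambda>p. (zext l (v n) p - zext l u p)\<^sup>2)"
          using sq_integrable_diff[OF vL2[of n, unfolded L2_iff] uL2[unfolded L2_iff]] unfolding sq_integrable_def by blast
        show "integrable lborel (\<lambda>p. d\<^sup>2 * ind (Omega l) p :: real)"
          using emeasure_bounded_lt[OF bounded_Omega] by (intro integrable_mult_right) auto
        show "(zext l (v n) p - zext l u p)\<^sup>2 \<le> d\<^sup>2 * ind (Omega l) p" for p
        proof (cases "p \<in> Omega l")
          case True
          then have "\<bar>v n p - u p\<bar> \<le> d" using N[OF n, of p] closure_subset by (meson less_imp_le subsetD)
          then show ?thesis using True power_mono[of "\<bar>v n p - u p\<bar>" d 2] by (simp add: zext_def)
        qed (simp add: zext_def)
      qed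
      also have "\<dots> = d\<^sup>2 * \<mu>" by (simp add: \<mu>_def)
      finally have "dist2 (zext l (v n)) (zext l u) < e" using d by linarith
      moreover have "0 \<le> dist2 (zext l (v n)) (zext l u)" by (rule Bochner_Integration.integral_nonneg) simp
      ultimately show ?thesis unfolding real_norm_def by linarith
    qed
    then show "\<exists>N. \<forall>n\<ge>N. norm (dist2 (zext l (v n)) (zext l u) - 0) < e" by blast
  qed
  \<comment> \<open>One argument for all three second derivatives; \<open>dom\<close> expresses that
    the energy controls the derivative in question.\<close>
  have comp: "\<exists>h. L2 (Omega l) h \<and> weak_deriv (Omega l) u i j h \<and> (\<lambda>n. dist2 (Dx l i j (v n)) (zext l h)) \<longlonglongrightarrow> 0"
    if ij: "i + j \<le> 2" and dom: "\<And>f. H2 (Omega l) f \<Longrightarrow> (LBINT p. (Dx l i j f p)\<^sup>2) \<le> hess2 l f" for i j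
  proof -
    have le: "dist2 (Dx l i j (v m)) (Dx l i j (v n)) \<le> edist l \<sigma> (v m) (v n) / (1 - \<sigma>)" for m n
    proof -
      have "dist2 (Dx l i j (v m)) (Dx l i j (v n)) = (LBINT p. (Dx l i j (\<lambda>p. v m p - v n p) p)\<^sup>2)"
      proof (rule integral_cong_AE)
        have [measurable]: "Dx l i j f \<in> borel_measurable borel" if "H2 (Omega l) f" for f
          using Dx_sq[OF that ij] by (simp add: sq_integrable_def)
        note [measurable] = this[OF H] this[OF H2star_H2[OF vd]]
        show "(\<lambda>p. (Dx l i j (v m) p - Dx l i j (v n) p)\<^sup>2) \<in> borel_measurable lborel"
          "(\<lambda>p. (Dx l i j (\<lambda>p. v m p - v n p) p)\<^sup>2) \<in> borel_measurable lborel" by measurable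
        show "AE p in lborel. (Dx l i j (v m) p - Dx l i j (v n) p)\<^sup>2 = (Dx l i j (\<lambda>p. v m p - v n p) p)\<^sup>2"
          using Dx_lincomb[OF l H H ij, of 1 m "-1" n] by eventually_elim simp
      qed
      also have "\<dots> \<le> edist l \<sigma> (v m) (v n) / (1 - \<sigma>)"
      proof -
        have "(1 - \<sigma>) * (LBINT p. (Dx l i j (\<lambda>p. v m p - v n p) p)\<^sup>2)
          \<le> (1 - \<sigma>) * hess2 l (\<lambda>p. v m p - v n p)"
          using \<sigma> by (intro mult_left_mono dom H2star_H2[OF vd]) linarith
        also have "\<dots> \<le> edist l \<sigma> (v m) (v n)" by (rule ip_lower[OF \<sigma> H2star_H2[OF vd]])
        finally show ?thesis using \<sigma> by (subst pos_le_divide_eq) (auto simp only: mult.commute diff_gt_0_iff_gt)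
      qed
      finally show ?thesis .
    qed
    obtain h where h: "sq_integrable h" "\<And>p. p \<notin> Omega l \<Longrightarrow> h p = 0"
      "(\<lambda>n. dist2 (Dx l i j (v n)) h) \<longlonglongrightarrow> 0"
    proof (rule sq_integrable_complete[of "\<lambda>n. Dx l i j (v n)" "Omega l"])
      show "sq_integrable (Dx l i j (v n))" for n by (rule Dx_sq[OF H ij])
      show "Dx l i j (v n) p = 0" if "p \<notin> Omega l" for n p using that by (simp add: Dx_def zext_0)
      fix e :: real assume "e > 0"
      then obtain N where N: "\<And>m n. m \<ge> N \<Longrightarrow> n \<ge> N \<Longrightarrow> edist l \<sigma> (v m) (v n) < e * (1 - \<sigma>)"
      proof -
        have "e * (1 - \<sigma>) > 0" using \<open>e > 0\<close> \<sigma> by simp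
        from cauchy[OF this] show ?thesis using that by blast
      qed
      have "dist2 (Dx l i j (v m)) (Dx l i j (v n)) < e" if "m \<ge> N" "n \<ge> N" for m n
      proof -
        have "edist l \<sigma> (v m) (v n) / (1 - \<sigma>) < e"
          using N[OF that] \<sigma> by (subst pos_divide_less_eq) auto
        with le[of m n] show ?thesis by linarith
      qed
      then show "\<exists>N. \<forall>m\<ge>N. \<forall>n\<ge>N. dist2 (Dx l i j (v m)) (Dx l i j (v n)) < e" by blast
    qed (auto intro: bounded_Omega)
    have eh: "zext l h = h"
    proof
      show "zext l h p = h p" for p using h(2)[of p] by (cases "p \<in> Omega l") (auto simp: zext_def)
    qed
    then have hL2: "L2 (Omega l) h" using h(1) by (simp add: L2_iff)
    have "weak_deriv (Omega l) u i j h"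
      by (rule weak_deriv_limit[OF vL2 wd_props(2)[OF H ij] uL2 hL2 wd_props(1)[OF H ij] u_lim])
        (use h(3) in \<open>simp add: eh Dx_def\<close>)
    then show ?thesis using hL2 h(3) eh by auto
  qed
  have sqi: "integrable lborel (\<lambda>p. (Dx l i j f p)\<^sup>2)" if "H2 (Omega l) f" "i + j \<le> 2" for i j f
    using Dx_sq[OF that] by (simp add: sq_integrable_def)
  have dom_h20: "(LBINT p. (Dx l 2 0 f p)\<^sup>2) \<le> hess2 l f"
    and dom_h11: "(LBINT p. (Dx l 1 1 f p)\<^sup>2) \<le> hess2 l f"
    and dom_h02: "(LBINT p. (Dx l 0 2 f p)\<^sup>2) \<le> hess2 l f"
    if "H2 (Omega l) f" for f
    by (rule integral_mono; use sqi[OF that, of 2 0] sqi[OF that, of 1 1] sqi[OF that, of 0 2] in simp)+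
  obtain h20 where h20: "L2 (Omega l) h20" "weak_deriv (Omega l) u 2 0 h20" "(\<lambda>n. dist2 (Dx l 2 0 (v n)) (zext l h20)) \<longlonglongrightarrow> 0"
    using comp[of 2 0, OF _ dom_h20] by auto
  obtain h11 where h11: "L2 (Omega l) h11" "weak_deriv (Omega l) u 1 1 h11" "(\<lambda>n. dist2 (Dx l 1 1 (v n)) (zext l h11)) \<longlonglongrightarrow> 0"
    using comp[of 1 1, OF _ dom_h11] by auto
  obtain h02 where h02: "L2 (Omega l) h02" "weak_deriv (Omega l) u 0 2 h02" "(\<lambda>n. dist2 (Dx l 0 2 (v n)) (zext l h02)) \<longlonglongrightarrow> 0"
    using comp[of 0 2, OF _ dom_h02] by auto
  have pf: "plate_fun l u h11 h20"
    by (rule plate_fun.intro[OF l cu' side h11(1,2) h20(1,2)])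
  have Hu: "H2 (Omega l) u" by (rule plate_fun.H2_v[OF pf h02(1,2)])
  have us: "u \<in> H2star l" using Hu cu u_out side by (auto simp: H2star_def)
  have Dd: "(LBINT p. (Dx l i j (\<lambda>p. v n p - u p) p)\<^sup>2) = dist2 (Dx l i j (v n)) (zext l h)"
    if ij: "i + j \<le> 2" and h: "L2 (Omega l) h" "weak_deriv (Omega l) u i j h" for i j h n
  proof (rule integral_cong_AE)
    have Hd: "H2 (Omega l) (\<lambda>p. v n p - u p)" unfolding diff by (rule H2_lincomb[OF H Hu])
    show "(\<lambda>p. (Dx l i j (\<lambda>p. v n p - u p) p)\<^sup>2) \<in> borel_measurable lborel"
      using sqi[OF Hd ij] by (rule borel_measurable_integrable)
    show "(\<lambda>p. (Dx l i j (v n) p - zext l h p)\<^sup>2) \<in> borel_measurable lborel"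
      using sq_integrable_diff[OF Dx_sq[OF H ij] h(1)[unfolded L2_iff], of n]
      unfolding sq_integrable_def by (blast intro: borel_measurable_integrable)
    show "AE p in lborel. (Dx l i j (\<lambda>p. v n p - u p) p)\<^sup>2 = (Dx l i j (v n) p - zext l h p)\<^sup>2"
      using Dx_lincomb[OF l H Hu ij, of 1 n "-1"] Dx_AE[OF l Hu ij h(2,1)] by eventually_elim simp
  qed
  have ipb: "edist l \<sigma> (v n) u \<le> 2 * (dist2 (Dx l 2 0 (v n)) (zext l h20)
     + dist2 (Dx l 1 1 (v n)) (zext l h11) + dist2 (Dx l 0 2 (v n)) (zext l h02))" for n
  proof -
    have Hd: "H2 (Omega l) (\<lambda>p. v n p - u p)" unfolding diff by (rule H2_lincomb[OF H Hu])
    show ?thesis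
    proof -
      have "hess2 l (\<lambda>p. v n p - u p)
        = (LBINT p. (Dx l 2 0 (\<lambda>p. v n p - u p) p)\<^sup>2) + (LBINT p. (Dx l 1 1 (\<lambda>p. v n p - u p) p)\<^sup>2) + (LBINT p. (Dx l 0 2 (\<lambda>p. v n p - u p) p)\<^sup>2)"
        using sqi[OF Hd, of 2 0] sqi[OF Hd, of 1 1] sqi[OF Hd, of 0 2] by simp
      also have "(LBINT p. (Dx l 2 0 (\<lambda>p. v n p - u p) p)\<^sup>2) = dist2 (Dx l 2 0 (v n)) (zext l h20)"
        by (rule Dd[OF _ h20(1,2)]) simp
      also have "(LBINT p. (Dx l 1 1 (\<lambda>p. v n p - u p) p)\<^sup>2) = dist2 (Dx l 1 1 (v n)) (zext l h11)"
        by (rule Dd[OF _ h11(1,2)]) simp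
      also have "(LBINT p. (Dx l 0 2 (\<lambda>p. v n p - u p) p)\<^sup>2) = dist2 (Dx l 0 2 (v n)) (zext l h02)"
        by (rule Dd[OF _ h02(1,2)]) simp
      finally show ?thesis using ip_upper[OF \<sigma> Hd] by simp
    qed
  qed
  show ?thesis
  proof
    show "u \<in> H2star l" by (rule us)
    show "(\<lambda>n. v n p) \<longlonglongrightarrow> u p" for p by (rule lim)
    have "(\<lambda>n. 2 * (dist2 (Dx l 2 0 (v n)) (zext l h20)
     + dist2 (Dx l 1 1 (v n)) (zext l h11) + dist2 (Dx l 0 2 (v n)) (zext l h02))) \<longlonglongrightarrow> 2 * (0 + 0 + 0)"
      by (intro tendsto_intros h20 h11 h02)
    then have lim0: "(\<lambda>n. 2 * (dist2 (Dx l 2 0 (v n)) (zext l h20)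
     + dist2 (Dx l 1 1 (v n)) (zext l h11) + dist2 (Dx l 0 2 (v n)) (zext l h02))) \<longlonglongrightarrow> 0" by simp
    show "(\<lambda>n. edist l \<sigma> (v n) u) \<longlonglongrightarrow> 0"
    proof (rule tendsto_sandwich[OF _ _ tendsto_const lim0])
      have Hd: "H2 (Omega l) (\<lambda>p. v n p - u p)" for n unfolding diff by (rule H2_lincomb[OF H Hu])
      show "\<forall>\<^sub>F n in sequentially. 0 \<le> edist l \<sigma> (v n) u"
        by (intro always_eventually allI ip_nonneg[OF \<sigma> Hd])
    qed (intro always_eventually allI ipb)
  qed
qed

section \<open>Functionals in the dual unit ball\<close>

text \<open>The product of the intervals \<open>{- b x..b x}\<close> is compact by Tychonoff. As the
  index set may be uncountable, a pointwise convergent subsequence cannot be expected; what a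
  cluster point gives is closeness at finitely many arguments for arbitrarily late
  \<open>n\<close>.\<close>

lemma pointwise_bounded_cluster:
  fixes F :: "nat \<Rightarrow> 'a \<Rightarrow> real"
  assumes b: "\<And>n x. \<bar>F n x\<bar> \<le> b x"
  shows "\<exists>f. \<forall>S e N. finite S \<longrightarrow> e > 0 \<longrightarrow> (\<exists>n\<ge>N. \<forall>x\<in>S. \<bar>F n x - f x\<bar> < e)"
proof -
  let ?U = "PiE UNIV (\<lambda>x. {- b x..b x})"
  have "compactin (product_topology (\<lambda>i. euclidean) UNIV) ?U"
    unfolding compactin_PiE by auto
  then have "compact ?U" by (simp add: euclidean_product_topology)
  moreover have "filtermap F sequentially \<noteq> bot" by (simp add: filtermap_bot_iff)
  moreover have "\<forall>\<^sub>F g in filtermap F sequentially. g \<in> ?U"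
    unfolding eventually_filtermap using b by (auto simp: abs_le_iff intro!: always_eventually) (metis minus_le_iff)
  ultimately obtain f where f: "inf (nhds f) (filtermap F sequentially) \<noteq> bot"
    unfolding compact_filter by blast
  have "\<exists>n\<ge>N. \<forall>x\<in>S. \<bar>F n x - f x\<bar> < e" if S: "finite S" and e: "e > 0" for S e N
  proof -
    have "open (\<Inter>x\<in>S. (\<lambda>g. g x) -` {f x - e<..<f x + e})"
      using S by (intro open_INT ballI open_vimage) auto
    moreover have "f \<in> (\<Inter>x\<in>S. (\<lambda>g. g x) -` {f x - e<..<f x + e})" using e by auto
    ultimately have 1: "\<forall>\<^sub>F g in nhds f. g \<in> (\<Inter>x\<in>S. (\<lambda>g. g x) -` {f x - e<..<f x + e})"
      by (rule eventually_nhds_in_open)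
    have 2: "\<forall>\<^sub>F g in filtermap F sequentially. g \<in> F ` {N..}"
      unfolding eventually_filtermap using eventually_ge_at_top[of N] by eventually_elim auto
    have "\<forall>\<^sub>F g in inf (nhds f) (filtermap F sequentially).
        g \<in> (\<Inter>x\<in>S. (\<lambda>g. g x) -` {f x - e<..<f x + e}) \<and> g \<in> F ` {N..}"
      unfolding eventually_inf using 1 2 by blast
    then obtain g where "g \<in> (\<Inter>x\<in>S. (\<lambda>g. g x) -` {f x - e<..<f x + e})" "g \<in> F ` {N..}"
      using eventually_happens'[OF f] by blast
    then show ?thesis by (auto simp: abs_less_iff algebra_simps)
  qed
  then show ?thesis by blast
qed

lemma Fset_restrict: "f \<in> Fset l \<Longrightarrow> (\<And>p. p \<in> closure (Omega l) \<Longrightarrow> u p = v p) \<Longrightarrow> f u = f v"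
  unfolding Fset_def dual_C0_def by blast

lemma Fset_add:
  "f \<in> Fset l \<Longrightarrow> continuous_on (closure (Omega l)) u \<Longrightarrow> continuous_on (closure (Omega l)) v \<Longrightarrow>
    f (\<lambda>p. u p + v p) = f u + f v"
  unfolding Fset_def dual_C0_def by blast

lemma Fset_scale:
  "f \<in> Fset l \<Longrightarrow> continuous_on (closure (Omega l)) u \<Longrightarrow> f (\<lambda>p. c * u p) = c * f u"
  unfolding Fset_def dual_C0_def by blast

lemma Fset_diff:
  assumes "f \<in> Fset l" "continuous_on (closure (Omega l)) u" "continuous_on (closure (Omega l)) v"
  shows "f (\<lambda>p. u p - v p) = f u - f v"
proof -
  have "f (\<lambda>p. u p + (-1) * v p) = f u + f (\<lambda>p. (-1) * v p)"
    by (rule Fset_add[OF assms(1,2)]) (intro continuous_intros assms)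
  also have "f (\<lambda>p. (-1) * v p) = (-1) * f v" by (rule Fset_scale[OF assms(1,3)])
  finally show ?thesis by simp
qed

lemma compact_closure_Omega: "compact (closure (Omega l))"
  using bounded_Omega by (simp add: bounded_closure compact_closure)

lemma closure_Omega_nonempty: "l > 0 \<Longrightarrow> closure (Omega l) \<noteq> {}"
  by (auto simp: closure_Omega)

lemma bdd_above_abs_closure_Omega:
  fixes u :: "real \<times> real \<Rightarrow> real"
  assumes "continuous_on (closure (Omega l)) u"
  shows "bdd_above ((\<lambda>p. \<bar>u p\<bar>) ` closure (Omega l))"
proof -
  have "compact ((\<lambda>p. \<bar>u p\<bar>) ` closure (Omega l))"
    by (intro compact_continuous_image continuous_intros assms compact_closure_Omega)
  then show ?thesis by (intro bounded_imp_bdd_above compact_imp_bounded)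
qed

lemma Fset_bound:
  assumes l: "l > 0" and f: "f \<in> Fset l" and u: "continuous_on (closure (Omega l)) u"
    and s: "\<And>p. p \<in> closure (Omega l) \<Longrightarrow> \<bar>u p\<bar> \<le> s"
  shows "\<bar>f u\<bar> \<le> s"
proof -
  let ?K = "closure (Omega l)"
  let ?S = "{\<bar>f u\<bar> | u. continuous_on ?K u \<and> (\<forall>p\<in>?K. \<bar>u p\<bar> \<le> 1)}"
  obtain C where C: "\<And>u. continuous_on ?K u \<Longrightarrow> \<bar>f u\<bar> \<le> C * (SUP p\<in>?K. \<bar>u p\<bar>)"
    using f unfolding Fset_def dual_C0_def by blast
  \<comment> \<open>A real \<open>Sup\<close> says something only about a bounded set, so the bound
    on \<open>dual_norm\<close> becomes usable only after the constant \<open>C\<close> has shown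
    boundedness.\<close>
  have "bdd_above ?S"
  proof (rule bdd_aboveI)
    fix x assume "x \<in> ?S"
    then obtain u where u: "x = \<bar>f u\<bar>" "continuous_on ?K u" "\<And>p. p \<in> ?K \<Longrightarrow> \<bar>u p\<bar> \<le> 1" by blast
    obtain p where p: "p \<in> ?K" using closure_Omega_nonempty[OF l] unfolding ex_in_conv[symmetric] by blast
    have "(SUP p\<in>?K. \<bar>u p\<bar>) \<le> 1" using closure_Omega_nonempty[OF l] u(3) by (rule cSUP_least)
    moreover have "0 \<le> (SUP p\<in>?K. \<bar>u p\<bar>)"
      by (rule order_trans[OF _ cSUP_upper[OF p bdd_above_abs_closure_Omega[OF u(2)]]]) simp
    ultimately have "C * (SUP p\<in>?K. \<bar>u p\<bar>) \<le> \<bar>C\<bar> * 1" by (intro mult_mono) auto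
    then show "x \<le> \<bar>C\<bar>" using C[OF u(2)] u(1) by simp
  qed
  then have unit: "\<bar>f w\<bar> \<le> 1" if "continuous_on ?K w" "\<And>p. p \<in> ?K \<Longrightarrow> \<bar>w p\<bar> \<le> 1" for w
    using cSup_upper[of "\<bar>f w\<bar>" ?S] that f unfolding Fset_def dual_norm_def by force
  have s0: "s \<ge> 0" using closure_Omega_nonempty[OF l] s by (metis abs_ge_zero ex_in_conv order_trans)
  \<comment> \<open>Scaling by a strictly larger \<open>s'\<close> avoids dividing by
    \<open>s\<close>, which may be 0.\<close>
  have "\<bar>f u\<bar> \<le> s'" if "s' > s" for s'
  proof -
    have s': "s' > 0" using that s0 by simp
    have "\<bar>f (\<lambda>p. inverse s' * u p)\<bar> \<le> 1"
    proof (rule unit)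
      show "\<bar>inverse s' * u p\<bar> \<le> 1" if "p \<in> ?K" for p
        using s[OF that] \<open>s' > s\<close> s' by (simp add: abs_mult field_simps)
    qed (intro continuous_intros u)
    then show ?thesis using s' unfolding Fset_scale[OF f u] by (simp add: abs_mult field_simps)
  qed
  then show ?thesis by (rule dense_ge)
qed

lemma FsetI:
  assumes l: "l > 0" and r: "\<And>u v. (\<And>p. p \<in> closure (Omega l) \<Longrightarrow> u p = v p) \<Longrightarrow> f u = f v"
    and a: "\<And>u v. continuous_on (closure (Omega l)) u \<Longrightarrow> continuous_on (closure (Omega l)) v \<Longrightarrow> f (\<lambda>p. u p + v p) = f u + f v"
    and c: "\<And>c u. continuous_on (closure (Omega l)) u \<Longrightarrow> f (\<lambda>p. c * u p) = c * f u"
    and b: "\<And>u. continuous_on (closure (Omega l)) u \<Longrightarrow> \<bar>f u\<bar> \<le> (SUP p\<in>closure (Omega l). \<bar>u p\<bar>)"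
  shows "f \<in> Fset l"
proof -
  let ?K = "closure (Omega l)"
  let ?S = "{\<bar>f u\<bar> | u. continuous_on ?K u \<and> (\<forall>p\<in>?K. \<bar>u p\<bar> \<le> 1)}"
  have "dual_C0 ?K f"
    unfolding dual_C0_def
  proof (intro conjI allI impI exI[of _ 1])
    show "f u = f v" if "\<forall>p\<in>?K. u p = v p" for u v using r that by blast
    show "f (\<lambda>p. u p + v p) = f u + f v" if "continuous_on ?K u \<and> continuous_on ?K v" for u v
      using a that by blast
    show "f (\<lambda>p. c * u p) = c * f u" if "continuous_on ?K u" for c u by (rule c[OF that])
    show "\<bar>f u\<bar> \<le> 1 * (SUP p\<in>?K. \<bar>u p\<bar>)" if "continuous_on ?K u" for u using b[OF that] by simp
  qed
  moreover have "Sup ?S \<le> 1"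
  proof (rule cSup_least)
    have "\<bar>f (\<lambda>_. 0)\<bar> \<in> ?S" by (rule CollectI, rule exI[of _ "\<lambda>_. 0"]) auto
    then show "?S \<noteq> {}" by blast
    fix x assume "x \<in> ?S"
    then obtain u where u: "x = \<bar>f u\<bar>" "continuous_on ?K u" "\<And>p. p \<in> ?K \<Longrightarrow> \<bar>u p\<bar> \<le> 1" by blast
    have "(SUP p\<in>?K. \<bar>u p\<bar>) \<le> 1" using closure_Omega_nonempty[OF l] u(3) by (rule cSUP_least)
    then show "x \<le> 1" using b[OF u(2)] u(1) by simp
  qed
  ultimately show ?thesis by (simp add: Fset_def dual_norm_def)
qed

lemma Fset_uminus:
  assumes "f \<in> Fset l"
  shows "(\<lambda>u. - f u) \<in> Fset l"
  using assms unfolding Fset_def dual_C0_def dual_norm_def by auto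

text \<open>Invariance, additivity, homogeneity and the norm bound each involve at most three
  arguments, so a single \<open>n\<close> that is close at these arguments transfers the property to
  \<open>f0\<close> up to a multiple of \<open>e\<close>.\<close>

lemma Fset_cluster:
  fixes f :: "nat \<Rightarrow> (real \<times> real \<Rightarrow> real) \<Rightarrow> real"
  assumes l: "l > 0" and f: "\<And>n. f n \<in> Fset l"
  obtains f0 where "f0 \<in> Fset l"
    "\<And>z e N. continuous_on (closure (Omega l)) z \<Longrightarrow> e > 0 \<Longrightarrow> \<exists>n\<ge>N. \<bar>f n z - f0 z\<bar> < e"
proof -
  let ?K = "closure (Omega l)"
  \<comment> \<open>members of \<open>Fset\<close> are arbitrary, hence unbounded, at discontinuous arguments\<close>
  define F where "F n u = (if continuous_on ?K u then f n u else 0)" for n u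
  have B: "\<bar>F n u\<bar> \<le> (if continuous_on ?K u then (SUP p\<in>?K. \<bar>u p\<bar>) else 0)" for n u
  proof (cases "continuous_on ?K u")
    case True
    have "\<bar>f n u\<bar> \<le> (SUP p\<in>?K. \<bar>u p\<bar>)"
      by (rule Fset_bound[OF l f True], rule cSUP_upper[OF _ bdd_above_abs_closure_Omega[OF True]])
    then show ?thesis using True unfolding F_def by (simp only: if_True)
  next
    case False
    then show ?thesis by (simp add: F_def)
  qed
  from pointwise_bounded_cluster[of F "\<lambda>u. if continuous_on ?K u then SUP p\<in>?K. \<bar>u p\<bar> else 0", OF B] obtain f0 where
    "\<forall>S e N. finite S \<longrightarrow> e > 0 \<longrightarrow> (\<exists>n\<ge>N. \<forall>x\<in>S. \<bar>F n x - f0 x\<bar> < e)" ..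
  note f0 = this[rule_format]
  have small: "x = 0" if "\<And>e. e > 0 \<Longrightarrow> \<bar>x\<bar> \<le> c * e" "c > 0" for x c :: real
  proof (rule ccontr)
    assume "x \<noteq> 0"
    then show False using that(1)[of "\<bar>x\<bar> / (2 * c)"] that(2) by (simp add: field_simps)
  qed
  show ?thesis
  proof
    show "f0 \<in> Fset l"
    proof (rule FsetI[OF l])
      show "f0 u = f0 v" if uv: "\<And>p. p \<in> ?K \<Longrightarrow> u p = v p" for u v
      proof -
        have c: "continuous_on ?K u \<longleftrightarrow> continuous_on ?K v" using uv by (intro continuous_on_cong) auto
        have F: "F n u = F n v" for n using Fset_restrict[OF f uv] c by (simp add: F_def)
        have "\<bar>f0 u - f0 v\<bar> \<le> 2 * e" if e: "e > 0" for e
        proof -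
          obtain n where "\<forall>x\<in>{u, v}. \<bar>F n x - f0 x\<bar> < e" using f0[of "{u, v}" e 0] e by blast
          then have "\<bar>F n u - f0 u\<bar> < e" "\<bar>F n v - f0 v\<bar> < e" by blast+
          then show ?thesis using F[of n] by linarith
        qed
        from small[OF this] show ?thesis by simp
      qed
      show "f0 (\<lambda>p. u p + v p) = f0 u + f0 v" if "continuous_on ?K u" "continuous_on ?K v" for u v
      proof -
        have F: "F n (\<lambda>p. u p + v p) = F n u + F n v" for n
          unfolding F_def Fset_add[OF f that] using that continuous_on_add[OF that] by (simp only: if_True)
        have "\<bar>f0 (\<lambda>p. u p + v p) - (f0 u + f0 v)\<bar> \<le> 3 * e" if e: "e > 0" for e
        proof -
          obtain n where "\<bar>F n u - f0 u\<bar> < e" "\<bar>F n v - f0 v\<bar> < e" "\<bar>F n (\<lambda>p. u p + v p) - f0 (\<lambda>p. u p + v p)\<bar> < e"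
          proof -
            obtain n where "\<forall>x\<in>{u, v, \<lambda>p. u p + v p}. \<bar>F n x - f0 x\<bar> < e"
              using f0[of "{u, v, \<lambda>p. u p + v p}" e 0] e by blast
            then show ?thesis using that by blast
          qed
          then show ?thesis using F[of n] by linarith
        qed
        from small[OF this] show ?thesis by simp
      qed
      show "f0 (\<lambda>p. c * u p) = c * f0 u" if "continuous_on ?K u" for c u
      proof -
        have F: "F n (\<lambda>p. c * u p) = c * F n u" for n
          unfolding F_def Fset_scale[OF f that] using that continuous_on_mult_left[OF that, of c] by (simp only: if_True)
        have "\<bar>f0 (\<lambda>p. c * u p) - c * f0 u\<bar> \<le> (1 + \<bar>c\<bar>) * e" if e: "e > 0" for e
        proof -
          obtain n where n: "\<bar>F n u - f0 u\<bar> < e" "\<bar>F n (\<lambda>p. c * u p) - f0 (\<lambda>p. c * u p)\<bar> < e"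
          proof -
            obtain n where "\<forall>x\<in>{u, \<lambda>p. c * u p}. \<bar>F n x - f0 x\<bar> < e"
              using f0[of "{u, \<lambda>p. c * u p}" e 0] e by blast
            then show ?thesis using that by blast
          qed
          have "\<bar>c * F n u - c * f0 u\<bar> \<le> \<bar>c\<bar> * e"
            using n(1) by (simp add: abs_mult mult_left_mono flip: right_diff_distrib)
          then show ?thesis using n(2) F[of n] by (simp add: distrib_right)
        qed
        from small[OF this] show ?thesis by (simp add: add_pos_nonneg)
      qed
      show "\<bar>f0 u\<bar> \<le> (SUP p\<in>?K. \<bar>u p\<bar>)" if u: "continuous_on ?K u" for u
      proof (rule field_le_epsilon)
        fix e :: real assume e: "e > 0"
        obtain n where n: "\<bar>F n u - f0 u\<bar> < e" using f0[of "{u}" e 0] e by blast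
        have "\<bar>F n u\<bar> \<le> (SUP p\<in>?K. \<bar>u p\<bar>)"
          using B[of n u] u by simp
        then show "\<bar>f0 u\<bar> \<le> (SUP p\<in>?K. \<bar>u p\<bar>) + e" using n by linarith
      qed
    qed
    show "\<exists>n\<ge>N. \<bar>f n z - f0 z\<bar> < e" if z: "continuous_on ?K z" and e: "e > 0" for z e N
    proof -
      obtain n where n: "n \<ge> N" "\<forall>x\<in>{z}. \<bar>F n x - f0 x\<bar> < e" using f0[of "{z}" e N] e by blast
      have "F n z = f n z" using z by (simp add: F_def)
      with n show ?thesis by auto
    qed
  qed
qed

lemma zero_Fset: "l > 0 \<Longrightarrow> (\<lambda>_. 0) \<in> Fset l"
proof (rule FsetI)
  fix u :: "real \<times> real \<Rightarrow> real"
  assume l: "l > 0" and u: "continuous_on (closure (Omega l)) u"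
  obtain p where "p \<in> closure (Omega l)" using closure_Omega_nonempty[OF l] unfolding ex_in_conv[symmetric] by blast
  from order_trans[OF abs_ge_zero cSUP_upper[OF this bdd_above_abs_closure_Omega[OF u]]]
  show "\<bar>0\<bar> \<le> (SUP p\<in>closure (Omega l). \<bar>u p\<bar>)" by simp
qed auto

section \<open>The obstacle problem\<close>

lemma le_if_le_small_multiple:
  fixes a b c :: real
  assumes le: "\<And>t. 0 < t \<Longrightarrow> t \<le> 1 \<Longrightarrow> a \<le> b + t * c" and c: "0 \<le> c"
  shows "a \<le> b"
proof (rule field_le_epsilon)
  fix e :: real assume e: "e > 0"
  define t where "t = min 1 (e / (c + 1))"
  have t: "0 < t" "t \<le> 1" "t \<le> e / (c + 1)" using e c by (auto simp: t_def)
  have "t * c \<le> (e / (c + 1)) * (c + 1)" using t c e by (intro mult_mono) auto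
  also have "\<dots> = e" using c by simp
  finally show "a \<le> b + e" using le[OF t(1,2)] by linarith
qed

text \<open>Here \<open>e\<close>, \<open>e'\<close> are the energies and \<open>f\<close>,
  \<open>f'\<close> the loads at u and at u + t d, with \<open>b\<close> the product of u and d,
  \<open>c\<close> the energy of d and \<open>a\<close> the load of d. Minimality of energy minus
  twice load, divided by 2 \<open>t\<close>, gives even \<open>t * c / 2\<close>; the rest is given
  away.\<close>

lemma first_variation:
  fixes a b c t :: real
  assumes "0 < t" "0 \<le> c" "e' = e + 2 * t * b + t\<^sup>2 * c" "f' = f + t * a" "e - 2 * f \<le> e' - 2 * f'"
  shows "a \<le> b + t * c"
proof -
  define x where "x = t * c"
  have "0 \<le> t * (2 * (b - a) + t * c)" using assms(3-5) by (simp add: power2_eq_square algebra_simps)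
  then have "0 \<le> 2 * (b - a) + x" using assms(1) by (simp add: zero_le_mult_iff x_def)
  moreover have "0 \<le> x" using assms(1,2) by (simp add: x_def)
  ultimately show ?thesis unfolding x_def[symmetric] by simp
qed

locale obstacle =
  fixes l \<sigma> \<gamma>m \<gamma>p :: real and Ob :: "(real \<times> real) set" and \<psi>m \<psi>p :: "real \<times> real \<Rightarrow> real"
  assumes l: "l > 0" and \<sigma>: "0 < \<sigma>" "\<sigma> < 1" and Ob: "Ob \<subseteq> closure (Omega l)"
    and \<gamma>: "\<gamma>m > 0" "\<gamma>p > 0" and \<psi>m: "\<psi>m \<in> O_minus Ob \<gamma>m" and \<psi>p: "\<psi>p \<in> O_plus Ob \<gamma>p"
begin

abbreviation "A \<equiv> H2star_obst l Ob \<psi>m \<psi>p"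
abbreviation "X \<equiv> H2star l"
abbreviation "K \<equiv> closure (Omega l)"
definition E :: "(real \<times> real \<Rightarrow> real) \<Rightarrow> real" where "E u = ip l \<sigma> u u"

lemma adm_X: "u \<in> A \<Longrightarrow> u \<in> X" by (simp add: H2star_obst_def)

text \<open>The obstacles lie strictly on either side of 0. This makes the constraint set nonempty
  and provides the comparison function for the energy bound.\<close>

lemma zero_adm: "(\<lambda>_. 0) \<in> A"
proof -
  have "\<psi>m p \<le> 0 \<and> 0 \<le> \<psi>p p" if "p \<in> Ob" for p
    using that \<psi>m \<psi>p \<gamma> unfolding O_minus_def O_plus_def by force
  then show ?thesis using zero_H2star[of l] unfolding H2star_obst_def by blast
qed

lemma diff_X: "u \<in> X \<Longrightarrow> v \<in> X \<Longrightarrow> (\<lambda>p. u p - v p) \<in> X"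
  using H2star_lincomb[of u l v 1 "-1"] by simp

lemma convex_adm:
  assumes "u \<in> A" "v \<in> A" "0 \<le> t" "t \<le> 1"
  shows "(\<lambda>p. u p + t * (v p - u p)) \<in> A"
proof -
  have eq: "(\<lambda>p. u p + t * (v p - u p)) = (\<lambda>p. (1 - t) * u p + t * v p)" by (auto simp: algebra_simps)
  have "(\<lambda>p. (1 - t) * u p + t * v p) \<in> X" by (intro H2star_lincomb adm_X assms)
  moreover have "\<psi>m p \<le> (1 - t) * u p + t * v p \<and> (1 - t) * u p + t * v p \<le> \<psi>p p" if "p \<in> Ob" for p
  proof -
    have b: "\<psi>m p \<le> u p" "\<psi>m p \<le> v p" "u p \<le> \<psi>p p" "v p \<le> \<psi>p p"
      using assms that unfolding H2star_obst_def by auto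
    have "\<psi>m p = (1 - t) * \<psi>m p + t * \<psi>m p" "\<psi>p p = (1 - t) * \<psi>p p + t * \<psi>p p" by (simp_all add: algebra_simps)
    moreover have "(1 - t) * \<psi>m p + t * \<psi>m p \<le> (1 - t) * u p + t * v p" "(1 - t) * u p + t * v p \<le> (1 - t) * \<psi>p p + t * \<psi>p p"
      using b assms(3,4) by (auto intro!: add_mono mult_left_mono)
    ultimately show ?thesis by linarith
  qed
  ultimately show ?thesis unfolding eq H2star_obst_def by blast
qed

lemma ip_lin:
  assumes "u \<in> X" "v \<in> X" "w \<in> X"
  shows "ip l \<sigma> (\<lambda>p. a * u p + b * v p) w = a * ip l \<sigma> u w + b * ip l \<sigma> v w"
    and "ip l \<sigma> w (\<lambda>p. a * u p + b * v p) = a * ip l \<sigma> w u + b * ip l \<sigma> w v"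
  using ip_lincomb[OF l H2star_H2[OF assms(1)] H2star_H2[OF assms(2)] H2star_H2[OF assms(3)]]
  by (simp_all only: ip_sym[of l \<sigma> w])

lemma E_quad:
  assumes "u \<in> X" "v \<in> X"
  shows "E (\<lambda>p. a * u p + b * v p) = a\<^sup>2 * E u + 2 * a * b * ip l \<sigma> u v + b\<^sup>2 * E v"
  unfolding E_def ip_lin(1)[OF assms H2star_lincomb[OF assms]] ip_lin(2)[OF assms assms(1)] ip_lin(2)[OF assms assms(2)]
  by (simp add: ip_sym[of l \<sigma> v u] power2_eq_square algebra_simps)

lemma E_nonneg: "u \<in> X \<Longrightarrow> 0 \<le> E u"
  unfolding E_def by (rule ip_nonneg[OF \<sigma> H2star_H2])

lemma ip_Cauchy_Schwarz:
  assumes "u \<in> X" "v \<in> X"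
  shows "\<bar>ip l \<sigma> u v\<bar> \<le> sqrt (E u) * sqrt (E v)"
proof -
  let ?b = "ip l \<sigma> u v"
  have q: "0 \<le> a\<^sup>2 * E u + 2 * a * b * ?b + b\<^sup>2 * E v" for a b
    using E_nonneg[OF H2star_lincomb[OF assms]] unfolding E_quad[OF assms] .
  have "?b\<^sup>2 \<le> E u * E v"
  proof (cases "E v > 0")
    case True
    have "0 \<le> E v * (E u * E v - ?b\<^sup>2)" using q[of "E v" "- ?b"] by (simp add: power2_eq_square algebra_simps)
    then show ?thesis using True by (simp add: zero_le_mult_iff)
  next
    case False
    then have v: "E v = 0" using E_nonneg[OF assms(2)] by simp
    have "?b = 0"
    proof (rule ccontr)
      assume "?b \<noteq> 0"
      \<comment> \<open>With \<open>E v = 0\<close> the form is affine in the second coefficient;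
        the chosen value makes it equal to -1.\<close>
      then show False using q[of 1 "- (E u + 1) / (2 * ?b)"] v by (simp add: field_simps)
    qed
    then show ?thesis by (simp add: v)
  qed
  then have "sqrt (?b\<^sup>2) \<le> sqrt (E u * E v)" by (rule real_sqrt_le_mono)
  then show ?thesis by (simp add: real_sqrt_mult)
qed

definition C :: real where
  "C = (SOME C. C > 0 \<and> (\<forall>v\<in>X. \<forall>p\<in>K. \<forall>q\<in>K. \<bar>v p - v q\<bar> \<le> C * sqrt (E v) * sqrt (dist p q)) \<and> (\<forall>v\<in>X. \<forall>p. \<bar>v p\<bar> \<le> C * sqrt (E v)))"

lemma C: "C > 0"
  and C_modulus: "v \<in> X \<Longrightarrow> p \<in> K \<Longrightarrow> q \<in> K \<Longrightarrow> \<bar>v p - v q\<bar> \<le> C * sqrt (E v) * sqrt (dist p q)"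
  and C_sup: "v \<in> X \<Longrightarrow> \<bar>v p\<bar> \<le> C * sqrt (E v)"
proof -
  have "\<exists>C. C > 0 \<and> (\<forall>v\<in>X. \<forall>p\<in>K. \<forall>q\<in>K. \<bar>v p - v q\<bar> \<le> C * sqrt (E v) * sqrt (dist p q)) \<and> (\<forall>v\<in>X. \<forall>p. \<bar>v p\<bar> \<le> C * sqrt (E v))"
    unfolding E_def by (rule H2star_modulus[OF l \<sigma>]) blast
  from someI_ex[OF this, folded C_def]
  show "C > 0" "v \<in> X \<Longrightarrow> p \<in> K \<Longrightarrow> q \<in> K \<Longrightarrow> \<bar>v p - v q\<bar> \<le> C * sqrt (E v) * sqrt (dist p q)"
    "v \<in> X \<Longrightarrow> \<bar>v p\<bar> \<le> C * sqrt (E v)" by blast+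
qed

lemma X_cont: "u \<in> X \<Longrightarrow> continuous_on K u" by (rule H2star_continuous)

lemma f_bound: "f \<in> Fset l \<Longrightarrow> u \<in> X \<Longrightarrow> \<bar>f u\<bar> \<le> C * sqrt (E u)"
  by (rule Fset_bound[OF l _ X_cont C_sup])

section \<open>Solvability and stability of the variational inequality\<close>

definition sol :: "((real \<times> real \<Rightarrow> real) \<Rightarrow> real) \<Rightarrow> (real \<times> real \<Rightarrow> real) \<Rightarrow> bool" where
  "sol f u \<longleftrightarrow> u \<in> A \<and> (\<forall>\<phi>\<in>A. ip l \<sigma> u (\<lambda>p. \<phi> p - u p) \<ge> f (\<lambda>p. \<phi> p - u p))"

lemma sol_VI: "sol f u \<Longrightarrow> \<forall>\<phi>\<in>A. ip l \<sigma> u (\<lambda>p. \<phi> p - u p) \<ge> f (\<lambda>p. \<phi> p - u p)"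
  by (simp add: sol_def)

text \<open>The functional \<open>J\<close> is twice the usual one. Midpoints of admissible
  functions are admissible, so the parallelogram identity makes a minimising sequence Cauchy in
  energy; completeness supplies the minimiser, and its first variation along segments in
  \<open>A\<close> is the inequality.\<close>

lemma sol_exists:
  assumes f: "f \<in> Fset l"
  shows "\<exists>u. sol f u"
proof -
  define J where "J u = E u - 2 * f u" for u
  \<comment> \<open>Complete the square in \<open>sqrt (E u)\<close>, as the load is at most
    \<open>C * sqrt (E u)\<close>.\<close>
  have Jlow: "- C\<^sup>2 \<le> J u" if "u \<in> X" for u
  proof -
    have "0 \<le> (sqrt (E u) - C)\<^sup>2" by simp
    then have "2 * (C * sqrt (E u)) \<le> E u + C\<^sup>2" using E_nonneg[OF that] by (simp add: power2_diff algebra_simps)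
    then show ?thesis using f_bound[OF f that] unfolding J_def by linarith
  qed
  have bdd: "bdd_below (J ` A)" using Jlow adm_X by (intro bdd_belowI[of _ "- C\<^sup>2"]) auto
  have ne: "J ` A \<noteq> {}" using zero_adm by blast
  define m where "m = Inf (J ` A)"
  have m: "m \<le> J u" if "u \<in> A" for u unfolding m_def using that bdd by (intro cInf_lower) auto
  have "\<exists>u\<in>A. J u < m + 1 / (real n + 1)" for n
  proof -
    have "Inf (J ` A) < m + 1 / (real n + 1)" by (simp add: m_def)
    then show ?thesis unfolding cInf_less_iff[OF ne bdd] by blast
  qed
  then obtain v where v: "\<And>n. v n \<in> A" "\<And>n. J (v n) < m + 1 / (real n + 1)" by metis
  note vX = adm_X[OF v(1)]
  have mid: "E (\<lambda>p. v i p - v j p) \<le> 2 / (real i + 1) + 2 / (real j + 1)" for i j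
  proof -
    define w where "w = (\<lambda>p. v i p + (1/2) * (v j p - v i p))"
    have wA: "w \<in> A" unfolding w_def by (intro convex_adm v) auto
    have w: "w = (\<lambda>p. (1/2) * v i p + (1/2) * v j p)" unfolding w_def by (auto simp: field_simps)
    have Ew: "E w = (1/2)\<^sup>2 * E (v i) + 2 * (1/2) * (1/2) * ip l \<sigma> (v i) (v j) + (1/2)\<^sup>2 * E (v j)"
      unfolding w by (rule E_quad[OF vX vX])
    have fw: "f w = (1/2) * f (v i) + (1/2) * f (v j)"
      unfolding w Fset_scale[OF f X_cont[OF vX], symmetric]
      by (rule Fset_add[OF f]) (intro continuous_intros X_cont vX)+
    \<comment> \<open>Parallelogram identity: by linearity of \<open>f\<close> the loads cancel, and
      only values of \<open>J\<close> remain.\<close>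
    have "E (\<lambda>p. v i p - v j p) = E (v i) - 2 * ip l \<sigma> (v i) (v j) + E (v j)"
      using E_quad[OF vX vX, of 1 i "-1" j] by simp
    also have "\<dots> = 2 * J (v i) + 2 * J (v j) - 4 * J w"
      unfolding J_def Ew fw by (simp add: power2_eq_square)
    also have "\<dots> \<le> 2 / (real i + 1) + 2 / (real j + 1)"
      using v(2)[of i] v(2)[of j] m[OF wA] by simp
    finally show ?thesis .
  qed
  have cau: "\<exists>N. \<forall>i\<ge>N. \<forall>j\<ge>N. edist l \<sigma> (v i) (v j) < e" if e: "e > 0" for e
  proof -
    obtain N where N: "4 / e < real N" using reals_Archimedean2 by blast
    have "E (\<lambda>p. v i p - v j p) < e" if ij: "i \<ge> N" "j \<ge> N" for i j
    proof -
      have *: "2 / (real k + 1) < e / 2" if "k \<ge> N" for k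
      proof -
        have "4 / e < real k + 1" using N that by linarith
        then show ?thesis using e by (simp add: field_simps)
      qed
      show ?thesis using mid[of i j] *[OF ij(1)] *[OF ij(2)] by linarith
    qed
    then show ?thesis unfolding E_def by blast
  qed
  obtain u where u: "u \<in> X" "(\<lambda>n. E (\<lambda>p. v n p - u p)) \<longlonglongrightarrow> 0" "\<And>p. (\<lambda>n. v n p) \<longlonglongrightarrow> u p"
  proof (rule H2star_complete[OF l \<sigma> vX cau])
    fix w assume w: "w \<in> X" "(\<lambda>n. edist l \<sigma> (v n) w) \<longlonglongrightarrow> 0" "\<And>p. (\<lambda>n. v n p) \<longlonglongrightarrow> w p"
    show ?thesis by (rule that[of w, unfolded E_def, OF w])
  qed
  have uA: "u \<in> A"
  proof -
    have "\<psi>m p \<le> u p \<and> u p \<le> \<psi>p p" if "p \<in> Ob" for p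
    proof -
      have b: "\<psi>m p \<le> v n p" "v n p \<le> \<psi>p p" for n using v(1)[of n] that unfolding H2star_obst_def by auto
      have "\<psi>m p \<le> u p" by (rule LIMSEQ_le_const[OF u(3)]) (use b in blast)
      moreover have "u p \<le> \<psi>p p" by (rule LIMSEQ_le_const2[OF u(3)]) (use b in blast)
      ultimately show ?thesis by blast
    qed
    then show ?thesis using u(1) unfolding H2star_obst_def by blast
  qed
  \<comment> \<open>Expand \<open>E (v n)\<close> around \<open>u\<close>; the cross term and the
    load are both at most a constant times the root of the energy of \<open>v n - u\<close>, which
    tends to 0.\<close>
  have Ju: "J u \<le> m"
  proof -
    have "J u \<le> (m + 1 / (real n + 1)) + 2 * (sqrt (E u) + C) * sqrt (E (\<lambda>p. v n p - u p))" for n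
    proof -
      let ?d = "\<lambda>p. v n p - u p"
      have dX: "?d \<in> X" by (rule diff_X[OF vX u(1)])
      have "E (v n) = E u + 2 * ip l \<sigma> u ?d + E ?d" using E_quad[OF u(1) dX, of 1 1] by simp
      moreover have "f ?d = f (v n) - f u" by (rule Fset_diff[OF f X_cont[OF vX] X_cont[OF u(1)]])
      ultimately have "J (v n) = J u + 2 * ip l \<sigma> u ?d + E ?d - 2 * f ?d" by (simp add: J_def)
      moreover have "- (sqrt (E u) * sqrt (E ?d)) \<le> ip l \<sigma> u ?d" using ip_Cauchy_Schwarz[OF u(1) dX] by linarith
      moreover have "f ?d \<le> C * sqrt (E ?d)" using f_bound[OF f dX] by linarith
      moreover have "2 * (sqrt (E u) + C) * sqrt (E ?d) = 2 * (sqrt (E u) * sqrt (E ?d)) + 2 * (C * sqrt (E ?d))"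
        by (simp add: algebra_simps)
      ultimately show ?thesis using v(2)[of n] E_nonneg[OF dX] by linarith
    qed
    moreover have "(\<lambda>n. (m + 1 / (real n + 1)) + 2 * (sqrt (E u) + C) * sqrt (E (\<lambda>p. v n p - u p))) \<longlonglongrightarrow> (m + 0) + 2 * (sqrt (E u) + C) * sqrt 0"
    proof (intro tendsto_intros u(2))
      show "(\<lambda>n. 1 / (real n + 1)) \<longlonglongrightarrow> 0"
        using LIMSEQ_inverse_real_of_nat by (simp add: inverse_eq_divide add.commute)
    qed
    ultimately have "J u \<le> (m + 0) + 2 * (sqrt (E u) + C) * sqrt 0"
      by (intro LIMSEQ_le_const) auto
    then show ?thesis by simp
  qed
  have "f (\<lambda>p. \<phi> p - u p) \<le> ip l \<sigma> u (\<lambda>p. \<phi> p - u p)" if \<phi>: "\<phi> \<in> A" for \<phi>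
  proof -
    let ?d = "\<lambda>p. \<phi> p - u p"
    have dX: "?d \<in> X" by (rule diff_X[OF adm_X[OF \<phi>] u(1)])
    have t: "f ?d \<le> ip l \<sigma> u ?d + t * E ?d" if t: "0 < t" "t \<le> 1" for t
    proof -
      let ?w = "\<lambda>p. u p + t * ?d p"
      have wA: "?w \<in> A" using convex_adm[OF uA \<phi>] t by simp
      have "E ?w = E u + 2 * t * ip l \<sigma> u ?d + t\<^sup>2 * E ?d" using E_quad[OF u(1) dX, of 1 t] by simp
      moreover have "f ?w = f u + t * f ?d"
        unfolding Fset_scale[OF f X_cont[OF dX], symmetric]
        by (rule Fset_add[OF f]) (intro continuous_intros X_cont u(1) adm_X[OF \<phi>])+
      moreover have "E u - 2 * f u \<le> E ?w - 2 * f ?w" using m[OF wA] Ju unfolding J_def by linarith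
      ultimately show ?thesis by (rule first_variation[OF t(1) E_nonneg[OF dX]])
    qed
    show ?thesis by (rule le_if_le_small_multiple[OF t E_nonneg[OF dX]])
  qed
  then show ?thesis using uA unfolding sol_def by blast
qed

text \<open>Test each inequality with the other solution and add. For equal loads the right-hand
  side vanishes, which gives uniqueness.\<close>

lemma sol_stability:
  assumes f: "f \<in> Fset l" "sol f u" and g: "g \<in> Fset l" "sol g w"
  shows "E (\<lambda>p. u p - w p) \<le> f (\<lambda>p. u p - w p) - g (\<lambda>p. u p - w p)"
proof -
  let ?d = "\<lambda>p. u p - w p"
  have uX: "u \<in> X" and wX: "w \<in> X" using f g adm_X unfolding sol_def by auto
  have dX: "?d \<in> X" by (rule diff_X[OF uX wX])
  have neg: "(\<lambda>p. w p - u p) = (\<lambda>p. 0 * ?d p + (-1) * ?d p)" by auto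
  have "ip l \<sigma> u (\<lambda>p. w p - u p) = - ip l \<sigma> u ?d" unfolding neg ip_lin(2)[OF dX dX uX] by simp
  moreover have "f (\<lambda>p. w p - u p) = - f ?d"
    unfolding Fset_diff[OF f(1) X_cont[OF wX] X_cont[OF uX]] Fset_diff[OF f(1) X_cont[OF uX] X_cont[OF wX]] by simp
  ultimately have "ip l \<sigma> u ?d \<le> f ?d" using f(2) g(2) unfolding sol_def by force
  moreover have "g ?d \<le> ip l \<sigma> w ?d" using f(2) g(2) unfolding sol_def by blast
  moreover have "E ?d = ip l \<sigma> u ?d - ip l \<sigma> w ?d"
    using ip_lin(1)[OF uX wX dX, of 1 "-1"] by (simp add: E_def)
  ultimately show ?thesis by linarith
qed

lemma sol_unique:
  assumes "f \<in> Fset l" "sol f u" "sol f w"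
  shows "u = w"
proof
  fix p
  have X: "(\<lambda>p. u p - w p) \<in> X" using assms adm_X unfolding sol_def by (auto intro: diff_X)
  have "E (\<lambda>p. u p - w p) \<le> 0" using sol_stability[OF assms(1,2) assms(1,3)] by simp
  then have "E (\<lambda>p. u p - w p) = 0" using E_nonneg[OF X] by simp
  then show "u p = w p" using C_sup[OF X, of p] by simp
qed

abbreviation "U f \<equiv> u_sol l \<sigma> Ob f \<psi>m \<psi>p"

lemma U_sol: assumes "f \<in> Fset l" shows "sol f (U f)"
proof -
  obtain u where u: "sol f u" using sol_exists[OF assms] by blast
  have "\<exists>!u. sol f u" using u sol_unique[OF assms] by blast
  from theI'[OF this] show ?thesis unfolding u_sol_def sol_def[symmetric] .
qed

lemma U_eq: "f \<in> Fset l \<Longrightarrow> sol f u \<Longrightarrow> U f = u"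
  using sol_unique U_sol by blast

lemma U_X: "f \<in> Fset l \<Longrightarrow> U f \<in> X"
  using U_sol adm_X unfolding sol_def by blast

text \<open>Testing with 0 bounds the energy of \<open>U f\<close> by its load, hence by
  \<open>C * sqrt (E (U f))\<close>. The resulting bound is the same for all loads.\<close>

lemma U_energy:
  assumes f: "f \<in> Fset l"
  shows "sqrt (E (U f)) \<le> C"
proof -
  let ?u = "U f"
  note uX = U_X[OF f]
  have neg: "(\<lambda>p. 0 - ?u p) = (\<lambda>p. 0 * ?u p + (-1) * ?u p)" by auto
  have "f (\<lambda>p. 0 - ?u p) \<le> ip l \<sigma> ?u (\<lambda>p. 0 - ?u p)"
    using bspec[OF sol_VI[OF U_sol[OF f]] zero_adm] .
  also have "\<dots> = - E ?u" unfolding neg ip_lin(2)[OF uX uX uX] by (simp add: E_def)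
  finally have "E ?u \<le> - f (\<lambda>p. 0 - ?u p)" by linarith
  moreover have "(\<lambda>p. 0 - ?u p) = (\<lambda>p. (-1) * ?u p)" by auto
  then have "f (\<lambda>p. 0 - ?u p) = - f ?u" using Fset_scale[OF f X_cont[OF uX], of "-1"] by simp
  ultimately have "E ?u \<le> C * sqrt (E ?u)" using f_bound[OF f uX] by linarith
  then have *: "sqrt (E ?u) * sqrt (E ?u) \<le> C * sqrt (E ?u)" using E_nonneg[OF uX] by simp
  show ?thesis
  proof (cases "E ?u = 0")
    case True
    then show ?thesis using C by simp
  next
    case False
    then have "0 < sqrt (E ?u)" using E_nonneg[OF uX] by simp
    with * show ?thesis by (rule mult_right_le_imp_le)
  qed
qed

section \<open>Maximising the gap over the loads\<close>

abbreviation "gi f \<equiv> gap_inf l \<sigma> Ob f \<psi>m \<psi>p"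

lemma gap_bound:
  assumes "f \<in> Fset l"
  shows "\<bar>gap l \<sigma> Ob f \<psi>m \<psi>p x\<bar> \<le> 2 * C\<^sup>2"
proof -
  have "\<bar>U f p\<bar> \<le> C\<^sup>2" for p
  proof -
    have "C * sqrt (E (U f)) \<le> C * C" using U_energy[OF assms] C by (intro mult_left_mono) auto
    then show ?thesis using C_sup[OF U_X[OF assms], of p] by (simp add: power2_eq_square)
  qed
  from this[of "(x, l)"] this[of "(x, -l)"] show ?thesis unfolding gap_def by linarith
qed

lemma gi_upper: "f \<in> Fset l \<Longrightarrow> x \<in> {0..pi} \<Longrightarrow> \<bar>gap l \<sigma> Ob f \<psi>m \<psi>p x\<bar> \<le> gi f"
  unfolding gap_inf_def using gap_bound by (intro cSUP_upper bdd_aboveI2[where M="2 * C\<^sup>2"]) auto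

lemma gi_bound: "f \<in> Fset l \<Longrightarrow> gi f \<le> 2 * C\<^sup>2"
  unfolding gap_inf_def using gap_bound by (intro cSUP_least) auto

lemma gi_lipschitz:
  assumes f: "f \<in> Fset l" and d: "\<And>p. \<bar>U g p - U f p\<bar> \<le> \<delta>"
  shows "gi g \<le> gi f + 2 * \<delta>"
  unfolding gap_inf_def[of l \<sigma> Ob g]
proof (rule cSUP_least)
  show "{0..pi} \<noteq> {}" by simp
  fix x assume x: "x \<in> {0..pi}"
  show "\<bar>gap l \<sigma> Ob g \<psi>m \<psi>p x\<bar> \<le> gi f + 2 * \<delta>"
    using gi_upper[OF f x] d[of "(x, l)"] d[of "(x, -l)"] unfolding gap_def by linarith
qed

theorem maximizer_exists: "\<exists>f\<in>Fset l. \<forall>g\<in>Fset l. gi g \<le> gi f"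
proof -
  define M where "M = Sup (gi ` Fset l)"
  have bdd: "bdd_above (gi ` Fset l)" using gi_bound by (intro bdd_aboveI2)
  have ne: "gi ` Fset l \<noteq> {}" using zero_Fset[OF l] by blast
  have M: "gi g \<le> M" if "g \<in> Fset l" for g unfolding M_def using that bdd by (intro cSup_upper) auto
  have "\<exists>f\<in>Fset l. M - 1 / (real n + 1) < gi f" for n
  proof -
    have "M - 1 / (real n + 1) < Sup (gi ` Fset l)" by (simp add: M_def)
    then show ?thesis unfolding less_cSup_iff[OF ne bdd] by blast
  qed
  then obtain f0 where f0: "\<And>n. f0 n \<in> Fset l" "\<And>n. M - 1 / (real n + 1) < gi (f0 n)" by metis
  have bound: "\<bar>U (f0 n) p\<bar> \<le> C\<^sup>2" for n p
  proof -
    have "C * sqrt (E (U (f0 n))) \<le> C * C" using U_energy[OF f0(1)] C by (intro mult_left_mono) auto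
    then show ?thesis using C_sup[OF U_X[OF f0(1)], of n p] by (simp add: power2_eq_square)
  qed
  obtain u k where u: "continuous_on K u" "strict_mono (k :: nat \<Rightarrow> nat)"
    "\<And>e. 0 < e \<Longrightarrow> \<exists>N. \<forall>n x. n \<ge> N \<and> x \<in> K \<longrightarrow> norm (U (f0 (k n)) x - u x) < e"
  proof (rule Arzela_Ascoli[of K "\<lambda>n. U (f0 n)" "C\<^sup>2"])
    show "compact K" by (rule compact_closure_Omega)
    show "norm (U (f0 n) x) \<le> C\<^sup>2" for n x using bound by simp
    fix x and e :: real assume x: "x \<in> K" and e: "0 < e"
    \<comment> \<open>Inverts the common modulus \<open>C * C * sqrt d\<close> of all
      solutions.\<close>
    define d where "d = (e / C\<^sup>2)\<^sup>2"
    have d: "d > 0" using e C by (simp add: d_def)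
    have "norm (U (f0 n) x - U (f0 n) y) < e" if y: "y \<in> K" "norm (x - y) < d" for n y
    proof -
      have "sqrt (dist x y) < e / C\<^sup>2"
        using y(2) e C by (intro real_less_lsqrt) (auto simp: d_def dist_norm)
      have "\<bar>U (f0 n) x - U (f0 n) y\<bar> \<le> C * sqrt (E (U (f0 n))) * sqrt (dist x y)"
        by (rule C_modulus[OF U_X[OF f0(1)] x y(1)])
      also have "\<dots> \<le> C * C * sqrt (dist x y)"
        using U_energy[OF f0(1)] C by (intro mult_right_mono mult_left_mono) auto
      also have "\<dots> < C * C * (e / C\<^sup>2)" using \<open>sqrt (dist x y) < e / C\<^sup>2\<close> C by (intro mult_strict_left_mono) auto
      also have "\<dots> = e" using C by (simp add: power2_eq_square)
      finally show ?thesis by simp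
    qed
    then show "\<exists>d>0. \<forall>n y. y \<in> K \<and> norm (x - y) < d \<longrightarrow> norm (U (f0 n) x - U (f0 n) y) < e" using d by blast
  qed (use that in blast)
  define f where "f n = f0 (k n)" for n
  have fF: "f n \<in> Fset l" for n by (simp add: f_def f0)
  have fM: "M - 1 / (real n + 1) < gi (f n)" for n
  proof -
    \<comment> \<open>A strictly increasing index map satisfies \<open>n \<le> k n\<close>, so the
      subsequence keeps the rate of the original sequence.\<close>
    have "1 / (real (k n) + 1) \<le> 1 / (real n + 1)" using seq_suble[OF u(2), of n] by (intro divide_left_mono) auto
    then show ?thesis using f0(2)[of "k n"] unfolding f_def by linarith
  qed
  obtain f1 where f1: "f1 \<in> Fset l" "\<And>z e N. continuous_on K z \<Longrightarrow> e > 0 \<Longrightarrow> \<exists>n\<ge>N. \<bar>f n z - f1 z\<bar> < e"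
  proof (rule Fset_cluster[where f=f, OF l fF])
    fix h assume "h \<in> Fset l" "\<And>z e N. continuous_on K z \<Longrightarrow> e > 0 \<Longrightarrow> \<exists>n\<ge>N. \<bar>f n z - h z\<bar> < e"
    then show ?thesis by (rule that)
  qed
  have cU: "continuous_on K (U g)" if "g \<in> Fset l" for g by (rule X_cont[OF U_X[OF that]])
  \<comment> \<open>The one function at which \<open>f1\<close> has to be approximated; it is built
    from the uniform limit \<open>u\<close> and so does not change with \<open>n\<close>. It is
    continuous, which is all that a test of the loads requires.\<close>
  define z where "z p = u p - U f1 p" for p
  have z: "continuous_on K z" unfolding z_def by (intro continuous_intros u cU f1)
  have key: "M \<le> gi f1 + e + 2 * (C * sqrt (3 * e))" if e: "e > 0" for e
  proof -
    obtain N1 where N1: "\<And>n x. n \<ge> N1 \<Longrightarrow> x \<in> K \<Longrightarrow> \<bar>U (f n) x - u x\<bar> < e"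
      using u(3)[OF e] unfolding f_def real_norm_def by blast
    obtain N2 where N2: "1 / e < real N2" using reals_Archimedean2 by blast
    obtain n where n: "n \<ge> max N1 N2" "\<bar>f n z - f1 z\<bar> < e" using f1(2)[OF z e] by blast
    let ?d = "\<lambda>p. U (f n) p - U f1 p" and ?r = "\<lambda>p. U (f n) p - u p"
    have dX: "?d \<in> X" by (rule diff_X[OF U_X[OF fF] U_X[OF f1(1)]])
    have r: "continuous_on K ?r" by (intro continuous_intros u cU fF)
    have dz: "h ?d = h z + h ?r" if h: "h \<in> Fset l" for h
    proof -
      have "?d = (\<lambda>p. z p + ?r p)" by (auto simp: z_def)
      then show ?thesis using Fset_add[OF h z r] by simp
    qed
    have rb: "\<bar>h ?r\<bar> \<le> e" if "h \<in> Fset l" for h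
      by (rule Fset_bound[OF l that r]) (use N1[of n] n(1) in \<open>auto intro: less_imp_le\<close>)
    have "E ?d \<le> f n ?d - f1 ?d" by (rule sol_stability[OF fF U_sol[OF fF] f1(1) U_sol[OF f1(1)]])
    \<comment> \<open>One \<open>e\<close> is the difference of the loads at \<open>z\<close>; the
      other two are the loads \<open>f n\<close> and \<open>f1\<close>, of norm at most one, applied
      to the uniformly small remainder \<open>?r\<close>.\<close>
    also have "\<dots> \<le> 3 * e" unfolding dz[OF fF] dz[OF f1(1)] using n(2) rb[OF fF, of n] rb[OF f1(1)] by linarith
    finally have Ed: "E ?d \<le> 3 * e" .
    have "\<bar>U (f n) p - U f1 p\<bar> \<le> C * sqrt (3 * e)" for p
    proof -
      have "C * sqrt (E ?d) \<le> C * sqrt (3 * e)" using Ed C by (intro mult_left_mono real_sqrt_le_mono) auto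
      then show ?thesis using C_sup[OF dX, of p] by linarith
    qed
    then have "gi (f n) \<le> gi f1 + 2 * (C * sqrt (3 * e))" by (rule gi_lipschitz[OF f1(1)])
    moreover have "1 / (real n + 1) < e"
    proof -
      have "1 / e < real n + 1" using N2 n(1) by simp
      then show ?thesis using e by (simp add: field_simps)
    qed
    ultimately show ?thesis using fM[of n] by linarith
  qed
  have "M \<le> gi f1"
  proof -
    have ev: "\<forall>\<^sub>F e in at_right 0. M \<le> gi f1 + e + 2 * (C * sqrt (3 * e))"
      using eventually_at_right_less[of 0] by eventually_elim (rule key)
    have lim: "((\<lambda>e. gi f1 + e + 2 * (C * sqrt (3 * e))) \<longlongrightarrow> gi f1 + 0 + 2 * (C * sqrt (3 * 0))) (at_right 0)"
      by (intro tendsto_intros)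
    have "M \<le> gi f1 + 0 + 2 * (C * sqrt (3 * 0))"
      by (rule tendsto_lowerbound[OF lim ev]) simp
    then show ?thesis by simp
  qed
  then show ?thesis using M f1(1) order_trans by blast
qed

text \<open>Symmetric obstacles make \<open>A\<close> invariant under negation, so the inequality
  for \<open>f\<close> may be tested at the negative of each competitor. Both of its sides are
  unchanged when the solution, the load and the competitor all change sign.\<close>

lemma gi_uminus:
  assumes sym: "\<And>p. p \<in> Ob \<Longrightarrow> - \<psi>m p = \<psi>p p" and f: "f \<in> Fset l"
  shows "gi (\<lambda>u. - f u) = gi f"
proof -
  let ?u = "U f"
  note uX = U_X[OF f]
  have negX: "(\<lambda>p. - u p) \<in> X" if "u \<in> X" for u
    using H2star_lincomb[OF that that, of 0 "-1"] by simp
  have negA: "(\<lambda>p. - u p) \<in> A" if u: "u \<in> A" for u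
  proof -
    have "\<psi>m p \<le> - u p \<and> - u p \<le> \<psi>p p" if "p \<in> Ob" for p
      using u that sym[OF that] unfolding H2star_obst_def by force
    then show ?thesis using negX[OF adm_X[OF u]] unfolding H2star_obst_def by blast
  qed
  have uA: "?u \<in> A" using U_sol[OF f] unfolding sol_def by blast
  have "sol (\<lambda>u. - f u) (\<lambda>p. - ?u p)"
    unfolding sol_def
  proof (intro conjI ballI)
    show "(\<lambda>p. - ?u p) \<in> A" by (rule negA[OF uA])
    fix \<phi> assume \<phi>: "\<phi> \<in> A"
    let ?d = "\<lambda>p. - \<phi> p - ?u p"
    have dX: "?d \<in> X" by (rule diff_X[OF adm_X[OF negA[OF \<phi>]] uX])
    have le: "f ?d \<le> ip l \<sigma> ?u ?d" using bspec[OF sol_VI[OF U_sol[OF f]] negA[OF \<phi>]] .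
    have e1: "(\<lambda>p. \<phi> p - - ?u p) = (\<lambda>p. 0 * ?d p + (-1) * ?d p)" by auto
    have e2: "(\<lambda>p. - ?u p) = (\<lambda>p. 0 * ?u p + (-1) * ?u p)" by auto
    have "ip l \<sigma> (\<lambda>p. - ?u p) (\<lambda>p. \<phi> p - - ?u p) = ip l \<sigma> ?u ?d"
      unfolding e1 ip_lin(2)[OF dX dX negX[OF uX]] unfolding e2 ip_lin(1)[OF uX uX dX] by simp
    moreover have "(\<lambda>p. \<phi> p - - ?u p) = (\<lambda>p. (-1) * ?d p)" by auto
    then have "f (\<lambda>p. \<phi> p - - ?u p) = - f ?d" using Fset_scale[OF f X_cont[OF dX], of "-1"] by simp
    ultimately show "- f (\<lambda>p. \<phi> p - - ?u p) \<le> ip l \<sigma> (\<lambda>p. - ?u p) (\<lambda>p. \<phi> p - - ?u p)" using le by linarith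
  qed
  then have "U (\<lambda>u. - f u) = (\<lambda>p. - ?u p)" by (rule U_eq[OF Fset_uminus[OF f]])
  then have "\<bar>gap l \<sigma> Ob (\<lambda>u. - f u) \<psi>m \<psi>p x\<bar> = \<bar>gap l \<sigma> Ob f \<psi>m \<psi>p x\<bar>" for x
    unfolding gap_def by simp
  then show ?thesis unfolding gap_inf_def by simp
qed

end

theorem theorem4p1:
  fixes l \<sigma> \<gamma>m \<gamma>p :: real and Ob :: "(real \<times> real) set"
    and \<psi>m \<psi>p :: "real \<times> real \<Rightarrow> real"
  assumes "l > 0" and "0 < \<sigma>" and "\<sigma> < 1"
    and "Ob \<subseteq> closure (Omega l)" and "Ob \<noteq> {}" and "closed Ob"
    and "\<gamma>m > 0" and "\<gamma>p > 0"
    and "\<psi>m \<in> O_minus Ob \<gamma>m" and "\<psi>p \<in> O_plus Ob \<gamma>p"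
  shows "(\<exists>f\<in>Fset l. \<forall>g\<in>Fset l. gap_inf l \<sigma> Ob g \<psi>m \<psi>p \<le> gap_inf l \<sigma> Ob f \<psi>m \<psi>p)
    \<and> ((\<forall>p\<in>Ob. - \<psi>m p = \<psi>p p) \<longrightarrow>
        (\<forall>f\<in>Fset l. (\<forall>g\<in>Fset l. gap_inf l \<sigma> Ob g \<psi>m \<psi>p \<le> gap_inf l \<sigma> Ob f \<psi>m \<psi>p) \<longrightarrow>
           (\<lambda>u. - f u) \<in> Fset l \<and>
           (\<forall>g\<in>Fset l. gap_inf l \<sigma> Ob g \<psi>m \<psi>p \<le> gap_inf l \<sigma> Ob (\<lambda>u. - f u) \<psi>m \<psi>p)))"
proof -
  have ob: "obstacle l \<sigma> \<gamma>m \<gamma>p Ob \<psi>m \<psi>p"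
    using assms by (intro obstacle.intro)
  show ?thesis
  proof (intro conjI impI ballI)
    show "\<exists>f\<in>Fset l. \<forall>g\<in>Fset l. gap_inf l \<sigma> Ob g \<psi>m \<psi>p \<le> gap_inf l \<sigma> Ob f \<psi>m \<psi>p"
      by (rule obstacle.maximizer_exists[OF ob])
    fix f assume sym: "\<forall>p\<in>Ob. - \<psi>m p = \<psi>p p" and f: "f \<in> Fset l"
      and max: "\<forall>g\<in>Fset l. gap_inf l \<sigma> Ob g \<psi>m \<psi>p \<le> gap_inf l \<sigma> Ob f \<psi>m \<psi>p"
    show "(\<lambda>u. - f u) \<in> Fset l" by (rule Fset_uminus[OF f])
    fix g assume "g \<in> Fset l"
    then have "gap_inf l \<sigma> Ob g \<psi>m \<psi>p \<le> gap_inf l \<sigma> Ob f \<psi>m \<psi>p" using max by blast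
    also have "\<dots> = gap_inf l \<sigma> Ob (\<lambda>u. - f u) \<psi>m \<psi>p"
      by (rule obstacle.gi_uminus[OF ob _ f, symmetric]) (rule bspec[OF sym])
    finally show "gap_inf l \<sigma> Ob g \<psi>m \<psi>p \<le> gap_inf l \<sigma> Ob (\<lambda>u. - f u) \<psi>m \<psi>p" .
  qed
qed

end
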